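(* Assume that the positivity condition, the stabilizability condition and the algebraic solvability condition (all defined in the context) hold. Let $\Lambda_T$ be the unique solution of the finite-horizon $\Lambda$-equation and $\Lambda$ the unique solution of the algebraic $\Lambda$-equation (see context). Then there exist constants $K>0$ and $\lambda>0$, independent of $T$, such that $$\|\Lambda-\Lambda_T(t)\|_{L^2(I\times I;\mathbb R^{d\times d})}\le Ke^{-\lambda(T-t)},\qquad\forall t\in[0,T].$$ Moreover, with $\tilde\Theta_T^*(t)(u,v)=-\mathcal R(P_T(t))^{-1}\Upsilon(P_T(t),\Lambda_T(t))(u,v)$ and $\tilde\Theta^*(u,v)=-\mathcal R(P)^{-1}\Upsilon(P,\Lambda)(u,v)$, there exist constants $K,\lambda>0$, independent of $T$, such that $$\|\tilde\Theta^*-\tilde\Theta_T^*(t)\|_{L^2(I\times I;\mathbb R^{m\times d})}\le Ke^{-\lambda(T-t)},\qquad\forall t\in[0,T].$$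
   Context: **Notation.** $I=[0,1]$ with Lebesgue measure $du$; $\mathbb S^d,\mathbb S^d_+,\mathbb S^d_{++}$ are the real symmetric, symmetric positive semidefinite, symmetric positive definite $d\times d$ matrices. $L^2(I;E)$ consists of measurable $\phi=(\phi^u)_{u\in I}$ with $\int_I|\phi^u|^2du<\infty$; $L^2(I\times I;\mathbb R^{k\times l})$ has norm $\|h\|^2_{L^2(I\times I)}=\int_I\int_I\|h(u,v)\|_F^2\,dv\,du$ (Frobenius norm). **Probabilistic setup** (used in the stabilizability condition). A complete probability space carries, for each $u\in I$, a one-dimensional Brownian motion $W^u$ and an independent $\zeta^u$ uniform on $(0,1)$; the pairs $(W^u,\zeta^u)$, $u\in I$, are independent. $\mathcal F^u_t$ is generated by $(W^u_s)_{s\le t}$, $\zeta^u$ and the null sets. $\mathfrak L^2_0$ is the set of collections $\xi=(\xi^u)_{u\in I}$ of $\mathbb R^d$-valued random variables with $\xi^u$ $\mathcal F^u_0$-measurable, $u\mapsto\mathrm{Law}(W^u_{\cdot\wedge0},\zeta^u,\xi^u)\in\mathcal P_2(C([0,T];\mathbb R)\times(0,1)\times\mathbb R^d)$ measurable ($\mathcal P_2$: probability measures with finite second moment, with the 2-Wasserstein distance), and $\int_I\mathbb E|\xi^u|^2du<\infty$; $\bar\xi^u=\mathbb E[\xi^u]$. **Coefficients.** $b,\sigma\in\mathbb R^d$; $A,\bar A,\tilde A,C,\bar C,\tilde C\in\mathbb R^{d\times d}$; $B,D\in\mathbb R^{d\times m}$; $Q,\bar Q,\check Q\in\mathbb S^d_+$;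 $\tilde Q\in\mathbb R^{d\times d}$; $S\in\mathbb R^{m\times d}$; $R\in\mathbb S^m_{++}$; a graphon $G$, i.e. a measurable $G:I\times I\to\mathbb R$ in $L^2(I\times I)$. **Coefficient maps.** For $P\in\mathbb S^d_+$, $\Pi\in\mathbb S^d$, $\Lambda\in L^2(I\times I;\mathbb R^{d\times d})$, $p\in L^2(I;\mathbb R^d)$: $\mathcal Q(P)=A^\top P+PA+C^\top PC+Q$; $\hat{\mathcal Q}(P,\Pi)=(A+\bar A)^\top(P+\Pi)+(P+\Pi)(A+\bar A)+(C+\bar C)^\top P(C+\bar C)+Q+\bar Q$; $\mathcal M(P)=B^\top P+D^\top PC+S$; $\hat{\mathcal M}(P,\Pi)=B^\top(P+\Pi)+D^\top P(C+\bar C)+S$; $\mathcal R(P)=R+D^\top PD$; $\Upsilon(P,\Lambda)(u,v)=B^\top\Lambda(u,v)+D^\top P\tilde CG(u,v)$; $\Gamma(P,p)(u)=D^\top P\sigma+B^\top p(u)$; $$\begin{aligned}\Psi_1(P,\Pi,\Lambda)(u,v)={}&(P+\Pi)\tilde AG(u,v)+\tilde A^\top(P+\Pi)G(v,u)+(C+\bar C)^\top P\tilde CG(u,v)+\tilde C^\top P(C+\bar C)G(v,u)\\&+\int_I\tilde C^\top G(w,u)P\tilde CG(w,v)dw+(A+\bar A)^\top\Lambda(u,v)+\Lambda(v,u)^\top(A+\bar A)\\&+\int_I\Lambda(w,u)^\top\tilde AG(w,v)dw+\int_I\tilde A^\top G(w,u)\Lambda(w,v)dw+\tilde QG(u,v)+\int_IG(w,u)\check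 QG(w,v)dw,\end{aligned}$$ $$\begin{aligned}\Psi_2(P,\Pi,\Lambda,p)(u)={}&(A+\bar A)^\top p(u)+\tilde A^\top\int_IG(v,u)p(v)dv+(P+\Pi)b+(C+\bar C)^\top P\sigma\\&+\tilde C^\top\int_IG(v,u)P\sigma dv+\int_I\tfrac12(\Lambda(u,v)+\Lambda(v,u)^\top)b\,dv,\end{aligned}$$ $$\begin{aligned}F_{P,\Pi}(\Lambda)(u,v)={}&\Psi_1(P,\Pi,\Lambda)(u,v)-\hat{\mathcal M}(P,\Pi)^\top\mathcal R(P)^{-1}\Upsilon(P,\Lambda)(u,v)-\Upsilon(P,\Lambda)(v,u)^\top\mathcal R(P)^{-1}\hat{\mathcal M}(P,\Pi)\\&-\int_I\Upsilon(P,\Lambda)(w,u)^\top\mathcal R(P)^{-1}\Upsilon(P,\Lambda)(w,v)dw,\end{aligned}$$ $$\tilde F_{P,\Pi,\Lambda}(p)(u)=\Psi_2(P,\Pi,\Lambda,p)(u)-\hat{\mathcal M}(P,\Pi)^\top\mathcal R(P)^{-1}\Gamma(P,p)(u)-\int_I\Upsilon(P,\Lambda)(v,u)^\top\mathcal R(P)^{-1}\Gamma(P,p)(v)dv.$$ **Finite-horizon equations on $[0,T]$, $T>0$** (a.e. $u,v$), with $\Pi_T=\bar\Pi_T-P_T$: $\dot P_T+\mathcal Q(P_T)-\mathcal M(P_T)^\top\mathcal R(P_T)^{-1}\mathcal M(P_T)=0$, $P_T(T)=0$; $\dot{\bar\Pi}_T+\hat{\mathcal Q}(P_T,\Pi_T)-\hat{\mathcal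 M}(P_T,\Pi_T)^\top\mathcal R(P_T)^{-1}\hat{\mathcal M}(P_T,\Pi_T)=0$, $\bar\Pi_T(T)=0$; the finite-horizon $\Lambda$-equation $\dot\Lambda_T(t)(u,v)+F_{P_T(t),\Pi_T(t)}(\Lambda_T(t))(u,v)=0$, $\Lambda_T(T)=0$; with unique solutions $P_T,\bar\Pi_T\in C^1([0,T];\mathbb S^d_+)$, $\Lambda_T\in C^1([0,T];L^2(I\times I;\mathbb R^{d\times d}))$ (they exist under the positivity condition). **Algebraic system**, with $\Pi=\bar\Pi-P$: $\mathcal Q(P)-\mathcal M(P)^\top\mathcal R(P)^{-1}\mathcal M(P)=0$, $\hat{\mathcal Q}(P,\Pi)-\hat{\mathcal M}(P,\Pi)^\top\mathcal R(P)^{-1}\hat{\mathcal M}(P,\Pi)=0$, whose unique solution $(P,\bar\Pi)\in\mathbb S^d_{++}\times\mathbb S^d_{++}$ exists under the positivity and stabilizability conditions; the algebraic $\Lambda$-equation $F_{P,\Pi}(\Lambda)(u,v)=0$ for a.e. $u,v\in I$, for $\Lambda\in L^2(I\times I;\mathbb R^{d\times d})$; and the algebraic $p$-equation $\tilde F_{P,\Pi,\Lambda}(p)(u)=0$ for a.e. $u\in I$, for $p\in L^2(I;\mathbb R^d)$. **Positivity condition.** $Q-S^\top R^{-1}S\in\mathbb S^d_{++}$, $Q+\bar Q-S^\top R^{-1}S\in\mathbb S^d_{++}$, $\check Q\ge0$, and $\int_I\int_I\langle\phi^u,\tilde QG(u,v)\phi^v\rangle dv\,du\ge0$ for all $\phi\in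 L^2(I;\mathbb R^d)$. **Stabilizability condition.** (a) There exist $\bar\Theta\in\mathbb R^{m\times d}$, $\tilde\Theta\in L^2(I\times I;\mathbb R^{m\times d})$ such that for every $\xi\in\mathfrak L^2_0$ the solution of $\frac{d}{dt}\bar X^u=(A+\bar A+B\bar\Theta)\bar X^u+\int_I(\tilde AG(u,v)+B\tilde\Theta(u,v))\bar X^vdv$, $\bar X^u(0)=\bar\xi^u$, satisfies $\int_0^\infty\int_I|\bar X^u(t)|^2du\,dt<\infty$; and (b) there exists $\Theta\in\mathbb R^{m\times d}$ such that for every $\xi\in\mathfrak L^2_0$ the solution of $dX^u=(A+B\Theta)X^udt+(C+D\Theta)X^udW^u$, $X^u(0)=\xi^u$, satisfies $\mathbb E[\int_I\int_0^\infty|X^u(t)|^2dt\,du]<\infty$. **Algebraic solvability condition.** The system formed by the algebraic $\Lambda$- and $p$-equations admits a unique solution with $\Lambda\in L^2(I\times I;\mathbb R^{d\times d})$ and $p\in L^2(I;\mathbb R^d)$ such that $\int_I\int_I\langle\phi^u,\Lambda(u,v)\phi^v\rangle dv\,du\ge0$ for all $\phi\in L^2(I;\mathbb R^d)$; moreover, for each fixed $t\ge0$, $\Lambda_T(t)\to\Lambda$ in $L^2(I\times I;\mathbb R^{d\times d})$ as $T\to\infty$. *)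

theory Defs
  imports "HOL-Probability.Probability"
begin

section \<open>Matrices\<close>

definition sym_mats :: "(real^'n^'n) set" where
  "sym_mats = {P. transpose P = P}"

definition psd_mats :: "(real^'n^'n) set" where
  "psd_mats = {P. transpose P = P \<and> (\<forall>x. 0 \<le> x \<bullet> (P *v x))}"

definition pd_mats :: "(real^'n^'n) set" where
  "pd_mats = {P. transpose P = P \<and> (\<forall>x. x \<noteq> 0 \<longrightarrow> 0 < x \<bullet> (P *v x))}"

text \<open>On \<open>real^'k^'l\<close> the library norm is the Frobenius norm:\<close>

lemma norm_matrix_Frobenius:
  "norm (A :: real^'k^'l) = sqrt (\<Sum>i\<in>UNIV. \<Sum>j\<in>UNIV. (A $ i $ j)\<^sup>2)"
  by (simp add: norm_vec_def L2_set_def sum_nonneg)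


section \<open>The spaces \<open>L\<^sup>2(I)\<close> and \<open>L\<^sup>2(I \<times> I)\<close>\<close>

abbreviation unitI :: "real measure" where
  "unitI \<equiv> lebesgue_on {0..1}"

abbreviation unitI2 :: "(real \<times> real) measure" where
  "unitI2 \<equiv> unitI \<Otimes>\<^sub>M unitI"

text \<open>Elements of \<open>L\<^sup>2\<close> are represented by functions; identities between them are stated
  almost everywhere. A kernel \<open>\<Lambda>\<close> is a function of the pair \<open>(u, v)\<close>.\<close>

definition L2 :: "'x measure \<Rightarrow> ('x \<Rightarrow> 'e::euclidean_space) set" where
  "L2 M = {f \<in> borel_measurable M. integrable M (\<lambda>x. (norm (f x))\<^sup>2)}"

definition L2_norm :: "'x measure \<Rightarrow> ('x \<Rightarrow> 'e::euclidean_space) \<Rightarrow> real" where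
  "L2_norm M f = sqrt (\<integral>x. (norm (f x))\<^sup>2 \<partial>M)"

text \<open>\<open>f \<in> C\<^sup>1(J; L\<^sup>2(M))\<close> with derivative \<open>f'\<close>; difference quotients and continuity are taken in the
  \<open>L\<^sup>2\<close> norm, one-sidedly at endpoints of \<open>J\<close>.\<close>

definition L2_C1 ::
  "'x measure \<Rightarrow> real set \<Rightarrow> (real \<Rightarrow> 'x \<Rightarrow> 'e::euclidean_space) \<Rightarrow> (real \<Rightarrow> 'x \<Rightarrow> 'e) \<Rightarrow> bool" where
  "L2_C1 M J f f' \<longleftrightarrow>
     (\<forall>t\<in>J. f t \<in> L2 M \<and> f' t \<in> L2 M \<and>
       ((\<lambda>s. L2_norm M (\<lambda>x. (f s x - f t x) /\<^sub>R (s - t) - f' t x)) \<longlongrightarrow> 0) (at t within J) \<and>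
       ((\<lambda>s. L2_norm M (\<lambda>x. f' s x - f' t x)) \<longlongrightarrow> 0) (at t within J))"

definition nonneg_kernel :: "(real \<times> real \<Rightarrow> real^'d^'d) \<Rightarrow> bool" where
  "nonneg_kernel k \<longleftrightarrow>
     (\<forall>\<phi>. \<phi> \<in> L2 unitI \<longrightarrow>
        0 \<le> (\<integral>u. (\<integral>v. \<phi> u \<bullet> (k (u, v) *v \<phi> v) \<partial>unitI) \<partial>unitI))"


section \<open>Coefficients\<close>

text \<open>Suffixes: \<open>bar\<close>, \<open>til\<close>, \<open>chk\<close> stand for a bar, a tilde and a check accent. A matrix with \<open>k\<close> rows
  and \<open>l\<close> columns has type \<open>real^'l^'k\<close>.\<close>

record ('d::finite, 'm::finite) lq_coeffs =
  cb    :: "real^'d"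
  csig  :: "real^'d"
  cA    :: "real^'d^'d"
  cAbar :: "real^'d^'d"
  cAtil :: "real^'d^'d"
  cC    :: "real^'d^'d"
  cCbar :: "real^'d^'d"
  cCtil :: "real^'d^'d"
  cB    :: "real^'m^'d"
  cD    :: "real^'m^'d"
  cQ    :: "real^'d^'d"
  cQbar :: "real^'d^'d"
  cQchk :: "real^'d^'d"
  cQtil :: "real^'d^'d"
  cS    :: "real^'d^'m"
  cR    :: "real^'m^'m"
  cG    :: "real \<times> real \<Rightarrow> real"

definition admissible_coeffs :: "('d::finite, 'm::finite) lq_coeffs \<Rightarrow> bool" where
  "admissible_coeffs c \<longleftrightarrow>
     cQ c \<in> psd_mats \<and> cQbar c \<in> psd_mats \<and> cQchk c \<in> psd_mats \<and> cR c \<in> pd_mats \<and> cG c \<in> L2 unitI2"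

definition Qmap :: "('d::finite, 'm::finite) lq_coeffs \<Rightarrow> real^'d^'d \<Rightarrow> real^'d^'d" where
  "Qmap c P = transpose (cA c) ** P + P ** cA c + transpose (cC c) ** P ** cC c + cQ c"

text \<open>In the maps below \<open>Pdif\<close> is the argument \<open>\<Pi> = \<Pi>bar - P\<close>.\<close>

definition Qhat :: "('d::finite, 'm::finite) lq_coeffs \<Rightarrow> real^'d^'d \<Rightarrow> real^'d^'d \<Rightarrow> real^'d^'d" where
  "Qhat c P Pdif =
     transpose (cA c + cAbar c) ** (P + Pdif) + (P + Pdif) ** (cA c + cAbar c)
     + transpose (cC c + cCbar c) ** P ** (cC c + cCbar c) + cQ c + cQbar c"

definition Mmap :: "('d::finite, 'm::finite) lq_coeffs \<Rightarrow> real^'d^'d \<Rightarrow> real^'d^'m" where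
  "Mmap c P = transpose (cB c) ** P + transpose (cD c) ** P ** cC c + cS c"

definition Mhat :: "('d::finite, 'm::finite) lq_coeffs \<Rightarrow> real^'d^'d \<Rightarrow> real^'d^'d \<Rightarrow> real^'d^'m" where
  "Mhat c P Pdif =
     transpose (cB c) ** (P + Pdif) + transpose (cD c) ** P ** (cC c + cCbar c) + cS c"

definition Rmap :: "('d::finite, 'm::finite) lq_coeffs \<Rightarrow> real^'d^'d \<Rightarrow> real^'m^'m" where
  "Rmap c P = cR c + transpose (cD c) ** P ** cD c"

definition Upsilon ::
  "('d::finite, 'm::finite) lq_coeffs \<Rightarrow> real^'d^'d \<Rightarrow> (real \<times> real \<Rightarrow> real^'d^'d)
     \<Rightarrow> real \<times> real \<Rightarrow> real^'d^'m" where
  "Upsilon c P \<Lambda> = (\<lambda>(u, v).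
     transpose (cB c) ** \<Lambda> (u, v) + cG c (u, v) *\<^sub>R (transpose (cD c) ** P ** cCtil c))"

definition Gam ::
  "('d::finite, 'm::finite) lq_coeffs \<Rightarrow> real^'d^'d \<Rightarrow> (real \<Rightarrow> real^'d) \<Rightarrow> real \<Rightarrow> real^'m" where
  "Gam c P p u = (transpose (cD c) ** P) *v csig c + transpose (cB c) *v p u"

definition Psi1 ::
  "('d::finite, 'm::finite) lq_coeffs \<Rightarrow> real^'d^'d \<Rightarrow> real^'d^'d \<Rightarrow> (real \<times> real \<Rightarrow> real^'d^'d)
     \<Rightarrow> real \<times> real \<Rightarrow> real^'d^'d" where
  "Psi1 c P Pdif \<Lambda> = (\<lambda>(u, v).
     cG c (u, v) *\<^sub>R ((P + Pdif) ** cAtil c)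
     + cG c (v, u) *\<^sub>R (transpose (cAtil c) ** (P + Pdif))
     + cG c (u, v) *\<^sub>R (transpose (cC c + cCbar c) ** P ** cCtil c)
     + cG c (v, u) *\<^sub>R (transpose (cCtil c) ** P ** (cC c + cCbar c))
     + (\<integral>w. (cG c (w, u) * cG c (w, v)) *\<^sub>R (transpose (cCtil c) ** P ** cCtil c) \<partial>unitI)
     + transpose (cA c + cAbar c) ** \<Lambda> (u, v)
     + transpose (\<Lambda> (v, u)) ** (cA c + cAbar c)
     + (\<integral>w. cG c (w, v) *\<^sub>R (transpose (\<Lambda> (w, u)) ** cAtil c) \<partial>unitI)
     + (\<integral>w. cG c (w, u) *\<^sub>R (transpose (cAtil c) ** \<Lambda> (w, v)) \<partial>unitI)
     + cG c (u, v) *\<^sub>R cQtil c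
     + (\<integral>w. (cG c (w, u) * cG c (w, v)) *\<^sub>R cQchk c \<partial>unitI))"

definition Psi2 ::
  "('d::finite, 'm::finite) lq_coeffs \<Rightarrow> real^'d^'d \<Rightarrow> real^'d^'d \<Rightarrow> (real \<times> real \<Rightarrow> real^'d^'d)
     \<Rightarrow> (real \<Rightarrow> real^'d) \<Rightarrow> real \<Rightarrow> real^'d" where
  "Psi2 c P Pdif \<Lambda> p u =
     transpose (cA c + cAbar c) *v p u
     + transpose (cAtil c) *v (\<integral>v. cG c (v, u) *\<^sub>R p v \<partial>unitI)
     + (P + Pdif) *v cb c
     + (transpose (cC c + cCbar c) ** P) *v csig c
     + transpose (cCtil c) *v (\<integral>v. cG c (v, u) *\<^sub>R (P *v csig c) \<partial>unitI)
     + (\<integral>v. ((1/2) *\<^sub>R (\<Lambda> (u, v) + transpose (\<Lambda> (v, u)))) *v cb c \<partial>unitI)"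

definition Fmap ::
  "('d::finite, 'm::finite) lq_coeffs \<Rightarrow> real^'d^'d \<Rightarrow> real^'d^'d \<Rightarrow> (real \<times> real \<Rightarrow> real^'d^'d)
     \<Rightarrow> real \<times> real \<Rightarrow> real^'d^'d" where
  "Fmap c P Pdif \<Lambda> = (\<lambda>(u, v).
     Psi1 c P Pdif \<Lambda> (u, v)
     - transpose (Mhat c P Pdif) ** matrix_inv (Rmap c P) ** Upsilon c P \<Lambda> (u, v)
     - transpose (Upsilon c P \<Lambda> (v, u)) ** matrix_inv (Rmap c P) ** Mhat c P Pdif
     - (\<integral>w. transpose (Upsilon c P \<Lambda> (w, u)) ** matrix_inv (Rmap c P) ** Upsilon c P \<Lambda> (w, v) \<partial>unitI))"

definition Ftil ::
  "('d::finite, 'm::finite) lq_coeffs \<Rightarrow> real^'d^'d \<Rightarrow> real^'d^'d \<Rightarrow> (real \<times> real \<Rightarrow> real^'d^'d)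
     \<Rightarrow> (real \<Rightarrow> real^'d) \<Rightarrow> real \<Rightarrow> real^'d" where
  "Ftil c P Pdif \<Lambda> p u =
     Psi2 c P Pdif \<Lambda> p u
     - (transpose (Mhat c P Pdif) ** matrix_inv (Rmap c P)) *v Gam c P p u
     - (\<integral>v. (transpose (Upsilon c P \<Lambda> (v, u)) ** matrix_inv (Rmap c P)) *v Gam c P p v \<partial>unitI)"

definition Theta_til ::
  "('d::finite, 'm::finite) lq_coeffs \<Rightarrow> real^'d^'d \<Rightarrow> (real \<times> real \<Rightarrow> real^'d^'d)
     \<Rightarrow> real \<times> real \<Rightarrow> real^'d^'m" where
  "Theta_til c P \<Lambda> = (\<lambda>(u, v). - (matrix_inv (Rmap c P) ** Upsilon c P \<Lambda> (u, v)))"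


section \<open>Finite-horizon and algebraic equations\<close>

definition C1_curve :: "real set \<Rightarrow> (real \<Rightarrow> 'e::real_normed_vector) \<Rightarrow> (real \<Rightarrow> 'e) \<Rightarrow> bool" where
  "C1_curve J f f' \<longleftrightarrow>
     continuous_on J f' \<and> (\<forall>t\<in>J. (f has_vector_derivative f' t) (at t within J))"

definition finite_horizon_P ::
  "('d::finite, 'm::finite) lq_coeffs \<Rightarrow> real \<Rightarrow> (real \<Rightarrow> real^'d^'d) \<Rightarrow> bool" where
  "finite_horizon_P c T P \<longleftrightarrow>
     (\<forall>t\<in>{0..T}. P t \<in> psd_mats) \<and> P T = 0 \<and>
     (\<exists>P'. C1_curve {0..T} P P' \<and>
       (\<forall>t\<in>{0..T}.
          P' t + Qmap c (P t)
          - transpose (Mmap c (P t)) ** matrix_inv (Rmap c (P t)) ** Mmap c (P t) = 0))"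

definition finite_horizon_Pibar ::
  "('d::finite, 'm::finite) lq_coeffs \<Rightarrow> real \<Rightarrow> (real \<Rightarrow> real^'d^'d) \<Rightarrow> (real \<Rightarrow> real^'d^'d) \<Rightarrow> bool" where
  "finite_horizon_Pibar c T P Pibar \<longleftrightarrow>
     (\<forall>t\<in>{0..T}. Pibar t \<in> psd_mats) \<and> Pibar T = 0 \<and>
     (\<exists>Pibar'. C1_curve {0..T} Pibar Pibar' \<and>
       (\<forall>t\<in>{0..T}.
          Pibar' t + Qhat c (P t) (Pibar t - P t)
          - transpose (Mhat c (P t) (Pibar t - P t)) ** matrix_inv (Rmap c (P t))
              ** Mhat c (P t) (Pibar t - P t) = 0))"

definition finite_horizon_Lambda ::
  "('d::finite, 'm::finite) lq_coeffs \<Rightarrow> real \<Rightarrow> (real \<Rightarrow> real^'d^'d) \<Rightarrow> (real \<Rightarrow> real^'d^'d)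
     \<Rightarrow> (real \<Rightarrow> real \<times> real \<Rightarrow> real^'d^'d) \<Rightarrow> bool" where
  "finite_horizon_Lambda c T P Pibar \<Lambda> \<longleftrightarrow>
     (AE z in unitI2. \<Lambda> T z = 0) \<and>
     (\<exists>\<Lambda>'. L2_C1 unitI2 {0..T} \<Lambda> \<Lambda>' \<and>
       (\<forall>t\<in>{0..T}. AE z in unitI2.
          \<Lambda>' t z + Fmap c (P t) (Pibar t - P t) (\<Lambda> t) z = 0))"

definition algebraic_Riccati ::
  "('d::finite, 'm::finite) lq_coeffs \<Rightarrow> real^'d^'d \<Rightarrow> real^'d^'d \<Rightarrow> bool" where
  "algebraic_Riccati c P Pibar \<longleftrightarrow>
     P \<in> pd_mats \<and> Pibar \<in> pd_mats \<and>
     Qmap c P - transpose (Mmap c P) ** matrix_inv (Rmap c P) ** Mmap c P = 0 \<and>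
     Qhat c P (Pibar - P)
       - transpose (Mhat c P (Pibar - P)) ** matrix_inv (Rmap c P) ** Mhat c P (Pibar - P) = 0"

definition algebraic_Lambda ::
  "('d::finite, 'm::finite) lq_coeffs \<Rightarrow> real^'d^'d \<Rightarrow> real^'d^'d \<Rightarrow> (real \<times> real \<Rightarrow> real^'d^'d) \<Rightarrow> bool" where
  "algebraic_Lambda c P Pdif \<Lambda> \<longleftrightarrow> \<Lambda> \<in> L2 unitI2 \<and> (AE z in unitI2. Fmap c P Pdif \<Lambda> z = 0)"

definition algebraic_p ::
  "('d::finite, 'm::finite) lq_coeffs \<Rightarrow> real^'d^'d \<Rightarrow> real^'d^'d \<Rightarrow> (real \<times> real \<Rightarrow> real^'d^'d)
     \<Rightarrow> (real \<Rightarrow> real^'d) \<Rightarrow> bool" where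
  "algebraic_p c P Pdif \<Lambda> p \<longleftrightarrow> p \<in> L2 unitI \<and> (AE u in unitI. Ftil c P Pdif \<Lambda> p u = 0)"


section \<open>Brownian motions, filtrations and initial data\<close>

definition brownian_motion :: "'w measure \<Rightarrow> (real \<Rightarrow> 'w \<Rightarrow> real) \<Rightarrow> bool" where
  "brownian_motion M W \<longleftrightarrow>
     (\<forall>t\<ge>0. W t \<in> borel_measurable M) \<and>
     (\<forall>\<omega>\<in>space M. W 0 \<omega> = 0 \<and> continuous_on {0..} (\<lambda>t. W t \<omega>)) \<and>
     (\<forall>s t. 0 \<le> s \<and> s < t \<longrightarrow>
        distributed M lborel (\<lambda>\<omega>. W t \<omega> - W s \<omega>) (normal_density 0 (sqrt (t - s)))) \<and>
     (\<forall>(n::nat) \<tau>. 0 \<le> \<tau> 0 \<and> (\<forall>i<n. \<tau> i \<le> \<tau> (Suc i)) \<longrightarrow>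
        prob_space.indep_vars M (\<lambda>_. borel) (\<lambda>i \<omega>. W (\<tau> (Suc i)) \<omega> - W (\<tau> i) \<omega>) {..<n})"

definition noise_setup ::
  "'w measure \<Rightarrow> (real \<Rightarrow> real \<Rightarrow> 'w \<Rightarrow> real) \<Rightarrow> (real \<Rightarrow> 'w \<Rightarrow> real) \<Rightarrow> bool" where
  "noise_setup M W \<zeta> \<longleftrightarrow>
     prob_space M \<and> complete_measure M \<and>
     (\<forall>u\<in>{0..1}.
        brownian_motion M (W u) \<and>
        \<zeta> u \<in> borel_measurable M \<and> (\<forall>\<omega>\<in>space M. \<zeta> u \<omega> \<in> {0<..<1}) \<and>
        distr M lborel (\<zeta> u) = uniform_measure lborel {0<..<1} \<and>
        prob_space.indep_set M
          {(\<lambda>\<omega>. \<lambda>t\<in>{0..}. W u t \<omega>) -` A \<inter> space M | A. A \<in> sets (\<Pi>\<^sub>M t\<in>{0..}. borel)}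
          {\<zeta> u -` A \<inter> space M | A. A \<in> sets borel}) \<and>
     prob_space.indep_vars M (\<lambda>_. (\<Pi>\<^sub>M t\<in>{0..}. borel) \<Otimes>\<^sub>M borel)
       (\<lambda>u \<omega>. (\<lambda>t\<in>{0..}. W u t \<omega>, \<zeta> u \<omega>)) {0..1}"

definition filt :: "'w measure \<Rightarrow> (real \<Rightarrow> 'w \<Rightarrow> real) \<Rightarrow> ('w \<Rightarrow> real) \<Rightarrow> real \<Rightarrow> 'w measure" where
  "filt M W \<zeta> t = sigma (space M)
     ({W s -` A \<inter> space M | s A. s \<in> {0..t} \<and> A \<in> sets borel}
      \<union> {\<zeta> -` A \<inter> space M | A. A \<in> sets borel}
      \<union> null_sets M)"

text \<open>\<open>C([0,T]; \<real>)\<close> with its Borel \<open>\<sigma>\<close>-algebra, which is generated by the evaluations.\<close>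

definition path_space :: "real \<Rightarrow> (real \<Rightarrow> real) measure" where
  "path_space T = restrict_space (\<Pi>\<^sub>M t\<in>{0..T}. borel) {x. continuous_on {0..T} x}"

definition mark_space :: "real \<Rightarrow> ((real \<Rightarrow> real) \<times> real \<times> (real^'d)) measure" where
  "mark_space T = path_space T \<Otimes>\<^sub>M (restrict_space borel {0<..<1} \<Otimes>\<^sub>M borel)"

definition mark_dist ::
  "real \<Rightarrow> (real \<Rightarrow> real) \<times> real \<times> (real^'d) \<Rightarrow> (real \<Rightarrow> real) \<times> real \<times> (real^'d) \<Rightarrow> real" where
  "mark_dist T = (\<lambda>(x, a, y) (x', a', y').
     sqrt ((SUP t\<in>{0..T}. \<bar>x t - x' t\<bar>)\<^sup>2 + (a - a')\<^sup>2 + (dist y y')\<^sup>2))"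

text \<open>\<open>\<P>\<^sub>2\<close> on the mark space and the 2-Wasserstein distance; the reference point for the second
  moment is immaterial.\<close>

definition P2 :: "real \<Rightarrow> ((real \<Rightarrow> real) \<times> real \<times> (real^'d)) measure set" where
  "P2 T = {\<mu>. prob_space \<mu> \<and> sets \<mu> = sets (mark_space T) \<and>
     (\<integral>\<^sup>+ z. ennreal ((mark_dist T z (\<lambda>t\<in>{0..T}. 0, 1/2, 0))\<^sup>2) \<partial>\<mu>) < \<infinity>}"

definition couplings ::
  "real \<Rightarrow> ((real \<Rightarrow> real) \<times> real \<times> (real^'d)) measure \<Rightarrow> ((real \<Rightarrow> real) \<times> real \<times> (real^'d)) measure
     \<Rightarrow> (((real \<Rightarrow> real) \<times> real \<times> (real^'d)) \<times> ((real \<Rightarrow> real) \<times> real \<times> (real^'d))) measure set" where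
  "couplings T \<mu> \<nu> = {\<gamma>. prob_space \<gamma> \<and> sets \<gamma> = sets (mark_space T \<Otimes>\<^sub>M mark_space T) \<and>
     distr \<gamma> (mark_space T) fst = \<mu> \<and> distr \<gamma> (mark_space T) snd = \<nu>}"

definition wasserstein2 ::
  "real \<Rightarrow> ((real \<Rightarrow> real) \<times> real \<times> (real^'d)) measure
     \<Rightarrow> ((real \<Rightarrow> real) \<times> real \<times> (real^'d)) measure \<Rightarrow> real" where
  "wasserstein2 T \<mu> \<nu> =
     sqrt (enn2real (INF \<gamma>\<in>couplings T \<mu> \<nu>. \<integral>\<^sup>+ z. ennreal ((mark_dist T (fst z) (snd z))\<^sup>2) \<partial>\<gamma>))"

definition P2_borel :: "real \<Rightarrow> ((real \<Rightarrow> real) \<times> real \<times> (real^'d)) measure measure" where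
  "P2_borel T = sigma (P2 T)
     {U. U \<subseteq> P2 T \<and> (\<forall>\<mu>\<in>U. \<exists>r>0. \<forall>\<nu>\<in>P2 T. wasserstein2 T \<mu> \<nu> < r \<longrightarrow> \<nu> \<in> U)}"

text \<open>The path component of the law is the Brownian path stopped at time \<open>0\<close>. It is constant in time, so the
  horizon \<open>T\<close> of the path space carries no information; all \<open>T > 0\<close> are allowed.\<close>

definition initial_law ::
  "'w measure \<Rightarrow> (real \<Rightarrow> 'w \<Rightarrow> real) \<Rightarrow> ('w \<Rightarrow> real) \<Rightarrow> ('w \<Rightarrow> real^'d) \<Rightarrow> real
     \<Rightarrow> ((real \<Rightarrow> real) \<times> real \<times> (real^'d)) measure" where
  "initial_law M W \<zeta> \<xi> T = distr M (mark_space T) (\<lambda>\<omega>. (\<lambda>t\<in>{0..T}. W (min t 0) \<omega>, \<zeta> \<omega>, \<xi> \<omega>))"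

definition initial_data ::
  "'w measure \<Rightarrow> (real \<Rightarrow> real \<Rightarrow> 'w \<Rightarrow> real) \<Rightarrow> (real \<Rightarrow> 'w \<Rightarrow> real)
     \<Rightarrow> (real \<Rightarrow> 'w \<Rightarrow> real^'d) set" where
  "initial_data M W \<zeta> = {\<xi>.
     (\<forall>u\<in>{0..1}. \<xi> u \<in> borel_measurable (filt M (W u) (\<zeta> u) 0)) \<and>
     (\<forall>T>0. (\<lambda>u. initial_law M (W u) (\<zeta> u) (\<xi> u) T) \<in> unitI \<rightarrow>\<^sub>M P2_borel T) \<and>
     (\<integral>\<^sup>+ u. (\<integral>\<^sup>+ \<omega>. ennreal ((norm (\<xi> u \<omega>))\<^sup>2) \<partial>M) \<partial>unitI) < \<infinity>}"


section \<open>It\^o integral and linear stochastic differential equations\<close>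

text \<open>Simple processes: on \<open>(\<tau> i, \<tau> (i+1)]\<close> the value is a bounded \<open>\<F>\<^bsub>\<tau> i\<^esub>\<close>-measurable vector \<open>\<eta> i\<close>.\<close>

definition simple_adapted ::
  "(real \<Rightarrow> 'w measure) \<Rightarrow> nat \<Rightarrow> (nat \<Rightarrow> real) \<Rightarrow> (nat \<Rightarrow> 'w \<Rightarrow> real^'d) \<Rightarrow> bool" where
  "simple_adapted F n \<tau> \<eta> \<longleftrightarrow>
     0 \<le> \<tau> 0 \<and> (\<forall>i<n. \<tau> i \<le> \<tau> (Suc i)) \<and>
     (\<forall>i<n. \<eta> i \<in> borel_measurable (F (\<tau> i)) \<and> (\<exists>K. \<forall>\<omega>\<in>space (F (\<tau> i)). norm (\<eta> i \<omega>) \<le> K))"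

definition simple_value ::
  "nat \<Rightarrow> (nat \<Rightarrow> real) \<Rightarrow> (nat \<Rightarrow> 'w \<Rightarrow> real^'d) \<Rightarrow> real \<Rightarrow> 'w \<Rightarrow> real^'d" where
  "simple_value n \<tau> \<eta> s \<omega> = (\<Sum>i<n. indicator {\<tau> i<..\<tau> (Suc i)} s *\<^sub>R \<eta> i \<omega>)"

definition simple_integral ::
  "(real \<Rightarrow> 'w \<Rightarrow> real) \<Rightarrow> nat \<Rightarrow> (nat \<Rightarrow> real) \<Rightarrow> (nat \<Rightarrow> 'w \<Rightarrow> real^'d) \<Rightarrow> real \<Rightarrow> 'w \<Rightarrow> real^'d" where
  "simple_integral W n \<tau> \<eta> t \<omega> =
     (\<Sum>i<n. (W (min t (\<tau> (Suc i))) \<omega> - W (min t (\<tau> i)) \<omega>) *\<^sub>R \<eta> i \<omega>)"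

text \<open>\<open>Y = \<integral>\<^sub>0\<^sup>t H\<^sub>s dW\<^sub>s\<close> as the \<open>L\<^sup>2\<close> limit of the integrals of simple processes approximating \<open>H\<close> on \<open>[0,t]\<close>.\<close>

definition has_ito_integral ::
  "'w measure \<Rightarrow> (real \<Rightarrow> 'w measure) \<Rightarrow> (real \<Rightarrow> 'w \<Rightarrow> real) \<Rightarrow> (real \<Rightarrow> 'w \<Rightarrow> real^'d) \<Rightarrow> real
     \<Rightarrow> ('w \<Rightarrow> real^'d) \<Rightarrow> bool" where
  "has_ito_integral M F W H t Y \<longleftrightarrow>
     Y \<in> borel_measurable M \<and>
     (\<exists>n \<tau> \<eta>.
        (\<forall>k::nat. simple_adapted F (n k) (\<tau> k) (\<eta> k)) \<and>
        (\<lambda>k. \<integral>\<^sup>+ \<omega>. (\<integral>\<^sup>+ s\<in>{0..t}. ennreal ((norm (simple_value (n k) (\<tau> k) (\<eta> k) s \<omega> - H s \<omega>))\<^sup>2) \<partial>lborel) \<partial>M)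
          \<longlonglongrightarrow> 0 \<and>
        (\<lambda>k. \<integral>\<^sup>+ \<omega>. ennreal ((norm (simple_integral W (n k) (\<tau> k) (\<eta> k) t \<omega> - Y \<omega>))\<^sup>2) \<partial>M) \<longlonglongrightarrow> 0)"

text \<open>\<open>X\<close> is a (continuous, adapted, locally square-integrable) strong solution of
  \<open>dX = a X dt + c X dW\<close>, \<open>X\<^sub>0 = \<xi>\<close>.\<close>

definition linear_sde_solution ::
  "'w measure \<Rightarrow> (real \<Rightarrow> 'w measure) \<Rightarrow> (real \<Rightarrow> 'w \<Rightarrow> real) \<Rightarrow> real^'d^'d \<Rightarrow> real^'d^'d
     \<Rightarrow> ('w \<Rightarrow> real^'d) \<Rightarrow> (real \<Rightarrow> 'w \<Rightarrow> real^'d) \<Rightarrow> bool" where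
  "linear_sde_solution M F W a c \<xi> X \<longleftrightarrow>
     (\<forall>t\<ge>0. X t \<in> borel_measurable (F t)) \<and>
     (\<forall>\<omega>\<in>space M. continuous_on {0..} (\<lambda>t. X t \<omega>)) \<and>
     (\<forall>t\<ge>0. (\<integral>\<^sup>+ \<omega>. (\<integral>\<^sup>+ s\<in>{0..t}. ennreal ((norm (X s \<omega>))\<^sup>2) \<partial>lborel) \<partial>M) < \<infinity>) \<and>
     (\<forall>t\<ge>0. \<exists>Y. has_ito_integral M F W (\<lambda>s \<omega>. c *v X s \<omega>) t Y \<and>
        (AE \<omega> in M. X t \<omega> = \<xi> \<omega> + integral {0..t} (\<lambda>s. a *v X s \<omega>) + Y \<omega>))"


section \<open>Standing conditions\<close>

definition positivity_condition :: "('d::finite, 'm::finite) lq_coeffs \<Rightarrow> bool" where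
  "positivity_condition c \<longleftrightarrow>
     cQ c - transpose (cS c) ** matrix_inv (cR c) ** cS c \<in> pd_mats \<and>
     cQ c + cQbar c - transpose (cS c) ** matrix_inv (cR c) ** cS c \<in> pd_mats \<and>
     cQchk c \<in> psd_mats \<and>
     nonneg_kernel (\<lambda>z. cG c z *\<^sub>R cQtil c)"

text \<open>\<open>X \<in> C\<^sup>1([0,\<infinity>); L\<^sup>2(I))\<close> solves the mean equation under the feedback \<open>(\<Theta>bar, \<Theta>til)\<close>.\<close>

definition mean_solution ::
  "('d::finite, 'm::finite) lq_coeffs \<Rightarrow> real^'d^'m \<Rightarrow> (real \<times> real \<Rightarrow> real^'d^'m)
     \<Rightarrow> (real \<Rightarrow> real^'d) \<Rightarrow> (real \<Rightarrow> real \<Rightarrow> real^'d) \<Rightarrow> bool" where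
  "mean_solution c \<Theta>bar \<Theta>til x0 X \<longleftrightarrow>
     (AE u in unitI. X 0 u = x0 u) \<and>
     (\<exists>X'. L2_C1 unitI {0..} X X' \<and>
       (\<forall>t\<ge>0. AE u in unitI.
          X' t u = (cA c + cAbar c + cB c ** \<Theta>bar) *v X t u
            + (\<integral>v. (cG c (u, v) *\<^sub>R cAtil c + cB c ** \<Theta>til (u, v)) *v X t v \<partial>unitI)))"

text \<open>Each clause says that the solution exists and that every version of it is square integrable over
  \<open>[0,\<infinity>)\<close>. In part (b) the expectation is taken for each \<open>u\<close> before integrating over \<open>u\<close>: for a continuum of
  independent noises the state need not be jointly measurable in \<open>(u, \<omega>)\<close>, while \<open>u \<mapsto> E \<integral> |X\<^sup>u|\<^sup>2 dt\<close> is
  measurable.\<close>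

definition stabilizability_condition ::
  "('d::finite, 'm::finite) lq_coeffs \<Rightarrow> 'w measure \<Rightarrow> (real \<Rightarrow> real \<Rightarrow> 'w \<Rightarrow> real)
     \<Rightarrow> (real \<Rightarrow> 'w \<Rightarrow> real) \<Rightarrow> bool" where
  "stabilizability_condition c M W \<zeta> \<longleftrightarrow>
     (\<exists>\<Theta>bar \<Theta>til. \<Theta>til \<in> L2 unitI2 \<and>
       (\<forall>\<xi>. \<xi> \<in> initial_data M W \<zeta> \<longrightarrow>
          (\<exists>X. mean_solution c \<Theta>bar \<Theta>til (\<lambda>u. \<integral>\<omega>. \<xi> u \<omega> \<partial>M) X) \<and>
          (\<forall>X. mean_solution c \<Theta>bar \<Theta>til (\<lambda>u. \<integral>\<omega>. \<xi> u \<omega> \<partial>M) X \<longrightarrow>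
             (\<integral>\<^sup>+ t\<in>{0..}. (\<integral>\<^sup>+ u. ennreal ((norm (X t u))\<^sup>2) \<partial>unitI) \<partial>lborel) < \<infinity>))) \<and>
     (\<exists>\<Theta>::real^'d^'m. \<forall>\<xi>. \<xi> \<in> initial_data M W \<zeta> \<longrightarrow>
        (let solves = (\<lambda>X. \<forall>u\<in>{0..1}.
               linear_sde_solution M (filt M (W u) (\<zeta> u)) (W u)
                 (cA c + cB c ** \<Theta>) (cC c + cD c ** \<Theta>) (\<xi> u) (X u))
         in (\<exists>X. solves X) \<and>
            (\<forall>X. solves X \<longrightarrow>
               (\<integral>\<^sup>+ u. (\<integral>\<^sup>+ \<omega>. (\<integral>\<^sup>+ t\<in>{0..}. ennreal ((norm (X u t \<omega>))\<^sup>2) \<partial>lborel) \<partial>M) \<partial>unitI) < \<infinity>)))"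

definition algebraic_solution ::
  "('d::finite, 'm::finite) lq_coeffs \<Rightarrow> real^'d^'d \<Rightarrow> real^'d^'d
     \<Rightarrow> (real \<times> real \<Rightarrow> real^'d^'d) \<Rightarrow> (real \<Rightarrow> real^'d) \<Rightarrow> bool" where
  "algebraic_solution c P Pdif \<Lambda> p \<longleftrightarrow>
     algebraic_Lambda c P Pdif \<Lambda> \<and> algebraic_p c P Pdif \<Lambda> p \<and> nonneg_kernel \<Lambda>"

text \<open>\<open>(\<Lambda>, p)\<close> is the unique (up to null sets) solution of the algebraic system with \<open>\<Lambda>\<close> nonnegative, and
  \<open>LamT T t\<close>, the value at time \<open>t\<close> of the solution with horizon \<open>T\<close>, tends to \<open>\<Lambda>\<close> as \<open>T \<rightarrow> \<infinity>\<close>.\<close>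

definition algebraic_solvability_condition ::
  "('d::finite, 'm::finite) lq_coeffs \<Rightarrow> real^'d^'d \<Rightarrow> real^'d^'d
     \<Rightarrow> (real \<Rightarrow> real \<Rightarrow> real \<times> real \<Rightarrow> real^'d^'d)
     \<Rightarrow> (real \<times> real \<Rightarrow> real^'d^'d) \<Rightarrow> (real \<Rightarrow> real^'d) \<Rightarrow> bool" where
  "algebraic_solvability_condition c P Pdif LamT \<Lambda> p \<longleftrightarrow>
     algebraic_solution c P Pdif \<Lambda> p \<and>
     (\<forall>\<Lambda>' p'. algebraic_solution c P Pdif \<Lambda>' p' \<longrightarrow>
        (AE z in unitI2. \<Lambda>' z = \<Lambda> z) \<and> (AE u in unitI. p' u = p u)) \<and>
     (\<forall>t\<ge>0. ((\<lambda>T. L2_norm unitI2 (\<lambda>z. LamT T t z - \<Lambda> z)) \<longlongrightarrow> 0) at_top)"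

end

theory Submission
  imports Defs
begin

text \<open>
  Reversing time turns the finite-horizon equations into autonomous flows issuing from \<open>0\<close>. A Riccati
  field is a minimum over feedbacks of fields that are monotone in the unknown, so the matrix flows
  \<open>P\<close> and \<open>\<Pi>bar\<close> stay below the algebraic solution \<open>X\<^sub>\<infinity>\<close>, and \<open>exp(-\<nu>s) (X\<^sub>\<infinity> + k X(s))\<close> is a
  supersolution for the gap \<open>X\<^sub>\<infinity> - X(s)\<close>; this makes the gap exponentially small.

  The error \<open>E = \<Lambda> - \<Lambda>(s)\<close> of the kernel flow satisfies \<open>E' = A* E + E A + E \<rho> E + O(exp(-\<gamma>s))\<close>, where
  \<open>A\<close> is the closed-loop operator on \<open>L\<^sup>2(I)\<close>. The Riccati equation of the operator \<open>\<Pi>bar + \<Lambda>\<close> says that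
  \<open>A\<close> is dissipative for this coercive form, which yields a Lyapunov form for \<open>E \<mapsto> A* E + E A\<close> in the
  Hilbert-Schmidt norm. As \<open>E\<close> tends to \<open>0\<close> by assumption, the quadratic term is eventually
  absorbed, and Gronwall's inequality gives the rate.
\<close>

section \<open>Matrices and the comparison principle\<close>

text \<open>The obstacle is that the closed-loop operator \<open>A\<close> is a constant matrix plus
  an integral operator and is dissipative only in the inner product of
  \<open>\<Pi>bar + \<Lambda>\<close>, whereas the error equation needs decay of \<open>A*\<close>
  acting from the left and of \<open>A\<close> acting from the right, in the Hilbert-Schmidt norm.
  Dissipativity for a given form does not pass to the adjoint, but bounds on powers do. Stability is
  therefore expressed by bounds on the powers of the explicit Euler steps \<open>1 + h A\<close>,
  uniform in small \<open>h\<close>: they transfer to \<open>A*\<close> by duality, to right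
  multiplication by taking adjoints, and they multiply because left and right multiplications
  commute.

  The error equation takes its symmetric form only for self-adjoint kernels. Self-adjointness of
  \<open>\<Lambda>\<close> and of the flow is not among the hypotheses; it is extracted from the
  solvability of the algebraic equation.

  The constants do not depend on \<open>T\<close> because all horizons are pieces of one flow in the
  reversed time \<open>s = T - t\<close>. The value at \<open>t = 0\<close> with horizon
  \<open>T\<close> is this flow at time \<open>T\<close>, so letting the horizon tend to infinity
  means following the flow.\<close>

lemma norm_matrix_mult_le:
  fixes A :: "real^'b^'a" and B :: "real^'c^'b"
  shows "norm (A ** B) \<le> norm A * norm B"
proof -
  have sq: "(norm M)\<^sup>2 = (\<Sum>i\<in>UNIV. (norm (M $ i))\<^sup>2)" for M :: "real^'x^'y"
    by (simp add: norm_vec_def L2_set_def sum_nonneg)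
  have cols: "(norm B)\<^sup>2 = (\<Sum>j\<in>UNIV. (norm (column j B))\<^sup>2)"
    by (simp add: norm_vec_def L2_set_def sum_nonneg column_def) (rule sum.swap)
  have "(norm (A ** B))\<^sup>2 = (\<Sum>i\<in>UNIV. \<Sum>j\<in>UNIV. ((A $ i) \<bullet> column j B)\<^sup>2)"
    by (simp add: norm_vec_def L2_set_def sum_nonneg matrix_matrix_mult_def inner_vec_def column_def)
  also have "\<dots> \<le> (\<Sum>i\<in>UNIV. \<Sum>j\<in>UNIV. (norm (A $ i))\<^sup>2 * (norm (column j B))\<^sup>2)"
    by (intro sum_mono) (metis Cauchy_Schwarz_ineq power2_norm_eq_inner)
  also have "\<dots> = (norm A * norm B)\<^sup>2"
    unfolding power_mult_distrib sq[of A] cols by (simp add: sum_product)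
  finally show ?thesis
    by (rule power2_le_imp_le) simp
qed

lemma bounded_bilinear_matrix_mult:
  "bounded_bilinear ((**) :: real^'b^'a \<Rightarrow> real^'c^'b \<Rightarrow> real^'c^'a)"
proof
  show "\<exists>K. \<forall>(a::real^'b^'a) (b::real^'c^'b). norm (a ** b) \<le> norm a * norm b * K"
    by (rule exI[of _ 1]) (simp add: norm_matrix_mult_le)
qed (simp_all add: matrix_matrix_mult_def vec_eq_iff sum.distrib algebra_simps sum_distrib_left)

lemma norm_matrix_vector_mult_le:
  fixes A :: "real^'b^'a"
  shows "norm (A *v x) \<le> norm A * norm x"
proof -
  have "(norm (A *v x))\<^sup>2 = (\<Sum>i\<in>UNIV. ((A $ i) \<bullet> x)\<^sup>2)"
    by (simp add: norm_vec_def L2_set_def sum_nonneg matrix_vector_mult_def inner_vec_def)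
  also have "\<dots> \<le> (\<Sum>i\<in>UNIV. (norm (A $ i))\<^sup>2 * (norm x)\<^sup>2)"
    by (intro sum_mono) (metis Cauchy_Schwarz_ineq power2_norm_eq_inner)
  also have "\<dots> = (norm A * norm x)\<^sup>2"
    by (simp add: power_mult_distrib norm_vec_def[of A] L2_set_def sum_nonneg sum_distrib_right)
  finally show ?thesis
    by (rule power2_le_imp_le) simp
qed

lemma bounded_bilinear_matrix_vector_mult:
  "bounded_bilinear ((*v) :: real^'b^'a \<Rightarrow> real^'b \<Rightarrow> real^'a)"
proof
  show "\<exists>K. \<forall>(a::real^'b^'a) b. norm (a *v b) \<le> norm a * norm b * K"
    by (rule exI[of _ 1]) (simp add: norm_matrix_vector_mult_le)
qed (simp_all add: matrix_vector_mult_def vec_eq_iff sum.distrib algebra_simps sum_distrib_left)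

lemmas continuous_on_matrix_vector [continuous_intros] =
  bounded_bilinear.continuous_on[OF bounded_bilinear_matrix_vector_mult]

lemma bounded_linear_transpose:
  "bounded_linear (transpose :: real^'b^'a \<Rightarrow> real^'a^'b)"
proof
  show "\<exists>K. \<forall>x::real^'b^'a. norm (transpose x) \<le> norm x * K"
    by (rule exI[of _ 1])
      (simp add: norm_matrix_Frobenius transpose_def sum.swap[of _ "UNIV::'a set"])
qed (simp_all add: transpose_def vec_eq_iff)

lemma inner_matrix_transpose:
  fixes A :: "real^'b^'a"
  shows "(A *v x) \<bullet> y = x \<bullet> (transpose A *v y)"
  by (simp add: dot_lmul_matrix[symmetric] inner_commute del: transpose_matrix_vector)

lemmas matrix_distribs =
  bounded_bilinear.add_left[OF bounded_bilinear_matrix_mult]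
  bounded_bilinear.add_right[OF bounded_bilinear_matrix_mult]
  bounded_bilinear.diff_left[OF bounded_bilinear_matrix_mult]
  bounded_bilinear.diff_right[OF bounded_bilinear_matrix_mult]
  bounded_bilinear.minus_left[OF bounded_bilinear_matrix_mult]
  bounded_bilinear.minus_right[OF bounded_bilinear_matrix_mult]
  bounded_bilinear.scaleR_left[OF bounded_bilinear_matrix_mult]
  bounded_bilinear.scaleR_right[OF bounded_bilinear_matrix_mult]

lemmas matrix_vector_distribs =
  bounded_bilinear.add_left[OF bounded_bilinear_matrix_vector_mult]
  bounded_bilinear.add_right[OF bounded_bilinear_matrix_vector_mult]
  bounded_bilinear.diff_left[OF bounded_bilinear_matrix_vector_mult]
  bounded_bilinear.diff_right[OF bounded_bilinear_matrix_vector_mult]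
  bounded_bilinear.minus_left[OF bounded_bilinear_matrix_vector_mult]
  bounded_bilinear.minus_right[OF bounded_bilinear_matrix_vector_mult]
  bounded_bilinear.scaleR_left[OF bounded_bilinear_matrix_vector_mult]
  bounded_bilinear.scaleR_right[OF bounded_bilinear_matrix_vector_mult]

lemmas transpose_distribs =
  linear_add[OF bounded_linear.linear[OF bounded_linear_transpose]]
  linear_diff[OF bounded_linear.linear[OF bounded_linear_transpose]]
  linear_neg[OF bounded_linear.linear[OF bounded_linear_transpose]]
  linear_scale[OF bounded_linear.linear[OF bounded_linear_transpose]]

lemma symmetric_inner:
  fixes A :: "real^'n^'n"
  assumes "transpose A = A"
  shows "(A *v x) \<bullet> y = x \<bullet> (A *v y)" "x \<bullet> (A *v y) = y \<bullet> (A *v x)"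
  using assms inner_matrix_transpose[of A] by (metis, metis inner_commute)

lemma norm_transpose [simp]: "norm (transpose A) = norm (A :: real^'b^'a)"
  by (simp add: norm_matrix_Frobenius transpose_def sum.swap[of _ "UNIV::'a set"])

section \<open>Coercive and positive semidefinite matrices\<close>

lemma pd_coercive:
  fixes A :: "real^'n^'n"
  assumes "A \<in> pd_mats"
  shows "\<exists>r>0. \<forall>x. r * (norm x)\<^sup>2 \<le> x \<bullet> (A *v x)"
proof -
  have c: "compact (sphere 0 1 :: (real^'n) set)" by simp
  have ne: "sphere (0::real^'n) 1 \<noteq> {}" by (simp add: sphere_eq_empty)
  have "continuous_on (sphere 0 1) (\<lambda>x. x \<bullet> (A *v x))"
    by (intro continuous_intros)
  from continuous_attains_inf[OF c ne this] obtain z where z: "z \<in> sphere 0 1"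
    "\<And>y. y \<in> sphere 0 1 \<Longrightarrow> z \<bullet> (A *v z) \<le> y \<bullet> (A *v y)" by auto
  let ?r = "z \<bullet> (A *v z)"
  have "z \<noteq> 0" using z(1) by auto
  then have "?r > 0" using assms by (simp add: pd_mats_def)
  moreover have "?r * (norm x)\<^sup>2 \<le> x \<bullet> (A *v x)" for x
  proof (cases "x = 0")
    case False
    have "?r \<le> (x /\<^sub>R norm x) \<bullet> (A *v (x /\<^sub>R norm x))"
      using False by (intro z(2)) simp
    also have "\<dots> = (x \<bullet> (A *v x)) / (norm x)\<^sup>2"
      by (simp add: matrix_vector_distribs power2_eq_square divide_inverse mult.assoc)
    finally show ?thesis using False by (simp add: field_simps)
  qed simp
  ultimately show ?thesis by blast
qed

text \<open>Coercivity leaves only the zero vector in the kernel, which in finite dimension gives a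
  two-sided inverse. Testing with \<open>x = matrix_inv A *v y\<close> yields the bound; it depends
  on \<open>r\<close> alone and is therefore uniform over all matrices sharing that
  constant.\<close>

lemma coercive_inverse:
  fixes A :: "real^'n^'n"
  assumes r: "0 < r" and co: "\<And>x. r * (norm x)\<^sup>2 \<le> x \<bullet> (A *v x)"
  shows "A ** matrix_inv A = mat 1" "matrix_inv A ** A = mat 1"
    "norm (matrix_inv A *v y) \<le> norm y / r"
proof -
  have "x = 0" if "A *v x = 0" for x
  proof -
    have "r * (norm x)\<^sup>2 \<le> 0" using co[of x] that by simp
    then show ?thesis using r by (simp add: mult_le_0_iff)
  qed
  then obtain B where "B ** A = mat 1"
    using matrix_left_invertible_ker[of A] by blast
  then have "invertible A"
    using invertible_left_inverse by blast
  then have "A ** matrix_inv A = mat 1 \<and> matrix_inv A ** A = mat 1"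
    unfolding invertible_def matrix_inv_def by (rule someI_ex)
  then show 1: "A ** matrix_inv A = mat 1" "matrix_inv A ** A = mat 1" by auto
  let ?x = "matrix_inv A *v y"
  have "A *v ?x = y" by (simp add: matrix_vector_mul_assoc 1)
  then have "r * (norm ?x)\<^sup>2 \<le> ?x \<bullet> y" using co[of ?x] by simp
  also have "\<dots> \<le> norm ?x * norm y" by (rule norm_cauchy_schwarz)
  finally have "norm ?x * (r * norm ?x) \<le> norm ?x * norm y"
    by (simp add: power2_eq_square algebra_simps)
  then have "norm ?x = 0 \<or> r * norm ?x \<le> norm y"
    by (metis mult_le_cancel_left norm_ge_zero order_le_less)
  then have "r * norm ?x \<le> norm y" using r by auto
  then show "norm ?x \<le> norm y / r" using r by (simp add: field_simps)
qed

lemma transpose_inverse: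
  fixes A :: "real^'n^'n"
  assumes "A ** matrix_inv A = mat 1" "matrix_inv A ** A = mat 1" "transpose A = A"
  shows "transpose (matrix_inv A) = matrix_inv A"
proof -
  have "transpose (matrix_inv A) ** A = mat 1"
    using arg_cong[OF assms(1), of transpose] by (simp add: matrix_transpose_mul assms(3))
  then have "transpose (matrix_inv A) ** A ** matrix_inv A = matrix_inv A" by simp
  then show ?thesis by (simp add: matrix_mul_assoc[symmetric] assms(1))
qed

lemma norm_le_matrix_entries:
  fixes E :: "real^'n^'m"
  assumes "\<And>i j. \<bar>E $ i $ j\<bar> \<le> k"
  shows "norm E \<le> real (CARD('m) * CARD('n)) * k"
proof -
  have "norm E \<le> (\<Sum>i\<in>UNIV. norm (E $ i))"
    by (simp add: norm_vec_def L2_set_le_sum)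
  also have "\<dots> \<le> (\<Sum>i\<in>(UNIV::'m set). \<Sum>j\<in>(UNIV::'n set). \<bar>E $ i $ j\<bar>)"
    by (intro sum_mono norm_le_l1_cart)
  also have "\<dots> \<le> (\<Sum>i\<in>(UNIV::'m set). \<Sum>j\<in>(UNIV::'n set). k)"
    by (intro sum_mono assms)
  finally show ?thesis by simp
qed

text \<open>Polarization: four times an entry is the difference of the values of the form at
  \<open>x + y\<close> and \<open>x - y\<close> for coordinate vectors, and both values lie between
  0 and \<open>4 * k\<close>. This converts order estimates between quadratic forms into norm
  estimates.\<close>

lemma psd_norm_le:
  fixes E :: "real^'n^'n"
  assumes sym: "transpose E = E" and lo: "\<And>x. 0 \<le> x \<bullet> (E *v x)"
    and hi: "\<And>x. x \<bullet> (E *v x) \<le> k * (norm x)\<^sup>2"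
  shows "norm E \<le> real (CARD('n) * CARD('n)) * k"
proof (rule norm_le_matrix_entries)
  fix i j :: 'n
  let ?x = "axis i (1::real) :: real^'n" and ?y = "axis j (1::real) :: real^'n"
  have k: "0 \<le> k" using lo[of ?x] hi[of ?x] by simp
  have b: "z \<bullet> (E *v z) \<le> 4 * k" if z: "(norm z)\<^sup>2 \<le> 4" for z
  proof -
    have "k * (norm z)\<^sup>2 \<le> k * 4" by (rule mult_left_mono[OF z k])
    then show ?thesis using hi[of z] by linarith
  qed
  have "norm (?x + ?y) \<le> 2" "norm (?x - ?y) \<le> 2"
    using norm_triangle_ineq[of ?x ?y] norm_triangle_ineq4[of ?x ?y] by simp_all
  then have n: "(norm (?x + ?y))\<^sup>2 \<le> 4" "(norm (?x - ?y))\<^sup>2 \<le> 4"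
    using power_mono[of "norm (?x + ?y)" 2 2] power_mono[of "norm (?x - ?y)" 2 2] by simp_all
  have "4 * (?x \<bullet> (E *v ?y)) = (?x + ?y) \<bullet> (E *v (?x + ?y)) - (?x - ?y) \<bullet> (E *v (?x - ?y))"
    using symmetric_inner(2)[OF sym, of ?y ?x]
    by (simp add: matrix_vector_distribs inner_add_left inner_add_right inner_diff_left inner_diff_right)
  moreover have "?x \<bullet> (E *v ?y) = E $ i $ j"
    by (simp add: inner_axis' matrix_vector_mul_component inner_axis)
  ultimately show "\<bar>E $ i $ j\<bar> \<le> k"
    using b[OF n(1)] b[OF n(2)] lo[of "?x + ?y"] lo[of "?x - ?y"] by linarith
qed

text \<open>If \<open>w = Z *v x\<close> were nonzero, a small step from \<open>x\<close> along
  \<open>- w\<close> would lower the form from 0 to the negative value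
  \<open>t * (t * q - 2 * (w \<bullet> w))\<close>.\<close>

lemma psd_kernel:
  fixes Z :: "real^'n^'n"
  assumes sym: "transpose Z = Z" and psd: "\<And>y. 0 \<le> y \<bullet> (Z *v y)" and x: "x \<bullet> (Z *v x) = 0"
  shows "Z *v x = 0"
proof (rule ccontr)
  assume "Z *v x \<noteq> 0"
  define w where "w = Z *v x"
  define q where "q = w \<bullet> (Z *v w)"
  have w: "w \<bullet> w > 0" using \<open>Z *v x \<noteq> 0\<close> by (simp add: w_def)
  \<comment> \<open>The \<open>+ 1\<close> keeps the denominator positive when \<open>q = 0\<close>,
    and \<open>t * q\<close> is still at most \<open>w \<bullet> w\<close>.\<close>
  define t where "t = (w \<bullet> w) / (q + 1)"
  have q: "q \<ge> 0" unfolding q_def by (rule psd)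
  have t: "t > 0" using w q by (simp add: t_def)
  have "0 \<le> (x - t *\<^sub>R w) \<bullet> (Z *v (x - t *\<^sub>R w))" by (rule psd)
  also have "\<dots> = t * (t * q - 2 * (w \<bullet> w))"
    using x symmetric_inner(2)[OF sym, of x w]
    by (simp add: matrix_vector_distribs inner_diff_left inner_diff_right q_def w_def[symmetric]
        inner_commute algebra_simps)
  also have "t * q - 2 * (w \<bullet> w) < 0"
  proof -
    have "t * q \<le> t * (q + 1)" using t by simp
    also have "\<dots> = w \<bullet> w" using q by (simp add: t_def)
    finally show ?thesis using w by linarith
  qed
  then have "t * (t * q - 2 * (w \<bullet> w)) < 0" using t by (simp add: mult_pos_neg)
  finally show False by simp
qed

text \<open>A maximum principle for matrix curves. Adding \<open>e * exp (\<kappa> * s)\<close>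
  times the identity makes the form strictly positive at the start; at a first time where it
  degenerates, the null vector turns the hypothesis into a strictly positive derivative, so the form
  would have been negative just before. The vectors \<open>a\<close> and \<open>c\<close> may depend
  on \<open>s\<close> and \<open>x\<close> in any way, even discontinuously: only the bound by
  \<open>K\<close> enters.\<close>

lemma sym_curve_nonneg:
  fixes Z Z' :: "real \<Rightarrow> real^'n^'n"
  assumes der: "\<And>s. s \<in> {0..T} \<Longrightarrow> (Z has_vector_derivative Z' s) (at s within {0..T})"
    and sym: "\<And>s. s \<in> {0..T} \<Longrightarrow> transpose (Z s) = Z s"
    and init: "\<And>x. 0 \<le> x \<bullet> (Z 0 *v x)"
    and ineq: "\<And>s x. s \<in> {0..T} \<Longrightarrow> \<exists>a c. norm a \<le> K * norm x \<and> norm c \<le> K * norm x \<and>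
        2 * (a \<bullet> (Z s *v x)) + c \<bullet> (Z s *v c) \<le> x \<bullet> (Z' s *v x)"
    and t: "t \<in> {0..T}"
  shows "0 \<le> x \<bullet> (Z t *v x)"
proof -
  \<comment> \<open>At the null vector the terms with \<open>a\<close> and \<open>c\<close> cost at
    most \<open>2 * K + K\<^sup>2\<close> times the added multiple of the identity; one more unit
    makes its growth win strictly.\<close>
  define \<kappa> where "\<kappa> = 2 * K + K\<^sup>2 + 1"
  have contZ: "continuous_on {0..T} Z"
    unfolding continuous_on_eq_continuous_within using has_vector_derivative_continuous[OF der] by blast
  have pos: "0 < x \<bullet> (Z s *v x) + e * exp (\<kappa> * s) * (x \<bullet> x)"
    if e: "e > 0" and s: "s \<in> {0..T}" and x: "x \<in> sphere 0 1" for e s x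
  proof (rule ccontr)
    define f where "f = (\<lambda>p. snd p \<bullet> (Z (fst p) *v snd p) + e * exp (\<kappa> * fst p) * (snd p \<bullet> snd p))"
    define Bad where "Bad = ({0..T} \<times> sphere (0::real^'n) 1) \<inter> {p. f p \<le> 0}"
    assume "\<not> ?thesis"
    then have "f (s, x) \<le> 0" by (simp add: f_def)
    then have "(s, x) \<in> Bad" using s x unfolding Bad_def by simp
    then have ne: "Bad \<noteq> {}" by blast
    have contf: "continuous_on ({0..T} \<times> sphere 0 1) f"
      unfolding f_def
      by (intro continuous_intros continuous_on_compose2[OF contZ]) auto
    have "closed Bad"
      unfolding Bad_def using continuous_closed_preimage[OF contf, of "{..0}"]
      by (simp add: closed_Times vimage_def Int_def)
    moreover have "bounded Bad"
      unfolding Bad_def by (intro bounded_subset[OF compact_imp_bounded[OF compact_Times[OF compact_Icc compact_sphere]]]) blast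
    ultimately have "compact Bad" by (simp add: compact_eq_bounded_closed)
    \<comment> \<open>The bad set is compact, so it contains a point with the smallest time
      coordinate.\<close>
    from continuous_attains_inf[OF this ne continuous_on_fst[OF continuous_on_id]]
    obtain p where p: "p \<in> Bad" and pmin: "\<And>y. y \<in> Bad \<Longrightarrow> fst p \<le> fst y" by auto
    obtain s0 x0 where px: "p = (s0, x0)" by (cases p)
    have s0: "s0 \<in> {0..T}" and x0: "norm x0 = 1" and f0: "f (s0, x0) \<le> 0"
      using p by (auto simp: Bad_def px)
    have before: "0 < f (s, y)" if "s < s0" "0 \<le> s" "norm y = 1" for s y
      using pmin[of "(s, y)"] that s0 by (force simp: px Bad_def)
    have s0pos: "0 < s0"
    proof (rule ccontr)
      assume "\<not> 0 < s0"
      then have "s0 = 0" using s0 by simp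
      then show False using f0 init[of x0] e x0 by (auto simp: f_def power2_norm_eq_inner[symmetric])
    qed
    define Z\<epsilon> where "Z\<epsilon> = Z s0 + (e * exp (\<kappa> * s0)) *\<^sub>R mat 1"
    have Z\<epsilon>: "Z\<epsilon> *v y = Z s0 *v y + (e * exp (\<kappa> * s0)) *\<^sub>R y" for y
      by (simp add: Z\<epsilon>_def matrix_vector_distribs)
    \<comment> \<open>Positivity on the whole sphere before \<open>s0\<close> survives in the limit
      as nonnegativity at \<open>s0\<close>. Hence the perturbed matrix is positive semidefinite
      there, and \<open>psd_kernel\<close> makes \<open>x0\<close> a genuine null vector.\<close>
    have lim: "0 \<le> f (s0, y)" if y: "norm y = 1" for y
    proof (rule continuous_ge_on_closure[where S = "{0..<s0}" and f = "\<lambda>s. f (s, y)"])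
      have cl: "closure {0..<s0} = {0..s0}" using s0pos by (simp add: closure_atLeastLessThan)
      have "continuous_on {0..s0} Z" using s0 by (intro continuous_on_subset[OF contZ]) simp
      then have "continuous_on {0..s0} (\<lambda>s. y \<bullet> (Z s *v y) + e * exp (\<kappa> * s) * (y \<bullet> y))"
        by (intro continuous_intros)
      then show "continuous_on (closure {0..<s0}) (\<lambda>s. f (s, y))"
        unfolding cl by (simp add: f_def)
      show "s0 \<in> closure {0..<s0}" unfolding cl using s0pos by simp
      show "0 \<le> f (s, y)" if "s \<in> {0..<s0}" for s
        using before[of s y] that y by simp
    qed
    have Z\<epsilon>f: "y \<bullet> (Z\<epsilon> *v y) = f (s0, y)" for y
      by (simp add: Z\<epsilon> f_def inner_add_right)
    have psd: "0 \<le> y \<bullet> (Z\<epsilon> *v y)" for y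
    proof (cases "y = 0")
      case False
      have "0 \<le> (y /\<^sub>R norm y) \<bullet> (Z\<epsilon> *v (y /\<^sub>R norm y))"
        unfolding Z\<epsilon>f using False by (intro lim) simp
      also have "\<dots> = (y \<bullet> (Z\<epsilon> *v y)) / (norm y)\<^sup>2"
        by (simp add: matrix_vector_distribs power2_eq_square divide_inverse mult.assoc)
      finally show ?thesis using False by (simp add: zero_le_divide_iff)
    qed simp
    have sym\<epsilon>: "transpose Z\<epsilon> = Z\<epsilon>"
      using sym[OF s0] by (simp add: Z\<epsilon>_def transpose_distribs)
    have f00: "f (s0, x0) = 0" using f0 lim[OF x0] by simp
    then have ker: "Z\<epsilon> *v x0 = 0"
      by (intro psd_kernel[OF sym\<epsilon> psd]) (simp add: Z\<epsilon>f)
    obtain a c where ac: "norm a \<le> K * norm x0" "norm c \<le> K * norm x0"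
      "2 * (a \<bullet> (Z s0 *v x0)) + c \<bullet> (Z s0 *v c) \<le> x0 \<bullet> (Z' s0 *v x0)"
      using ineq[OF s0] by blast
    have na: "norm a \<le> K" and nc: "norm c \<le> K" using ac x0 by auto
    let ?E = "e * exp (\<kappa> * s0)"
    have E: "?E > 0" using e by simp
    have ax: "\<bar>a \<bullet> x0\<bar> \<le> K" using Cauchy_Schwarz_ineq2[of a x0] x0 na by simp
    have cc: "c \<bullet> c \<le> K\<^sup>2" using nc by (simp add: power2_norm_eq_inner[symmetric] power_mono)
    have eq1: "a \<bullet> (Z s0 *v x0) = - ?E * (a \<bullet> x0)"
      using Z\<epsilon>[of x0] ker by (simp add: add_eq_0_iff2)
    have eq2: "c \<bullet> (Z s0 *v c) = c \<bullet> (Z\<epsilon> *v c) - ?E * (c \<bullet> c)"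
      by (simp add: Z\<epsilon> inner_add_right)
    have "0 < ?E * (\<kappa> - 2 * (a \<bullet> x0) - c \<bullet> c)"
      using ax cc by (intro mult_pos_pos[OF E]) (auto simp: \<kappa>_def)
    also have "\<dots> \<le> 2 * (a \<bullet> (Z s0 *v x0)) + c \<bullet> (Z s0 *v c) + e * (\<kappa> * exp (\<kappa> * s0))"
      unfolding eq1 eq2 using psd[of c] by (simp add: algebra_simps)
    also have "\<dots> \<le> x0 \<bullet> (Z' s0 *v x0) + e * (\<kappa> * exp (\<kappa> * s0))" using ac by simp
    finally have dpos: "0 < x0 \<bullet> (Z' s0 *v x0) + e * (\<kappa> * exp (\<kappa> * s0))" .
    have "((\<lambda>s. Z s *v x0) has_vector_derivative (Z' s0 *v x0)) (at s0 within {0..T})"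
      using bounded_linear.has_vector_derivative[OF
          bounded_bilinear.bounded_linear_left[OF bounded_bilinear_matrix_vector_mult] der[OF s0]] .
    then have "((\<lambda>s. x0 \<bullet> (Z s *v x0)) has_real_derivative (x0 \<bullet> (Z' s0 *v x0))) (at s0 within {0..T})"
      unfolding has_real_derivative_iff_has_vector_derivative
      by (rule bounded_linear.has_vector_derivative[OF bounded_linear_inner_right])
    then have "((\<lambda>s. f (s, x0)) has_real_derivative
        (x0 \<bullet> (Z' s0 *v x0) + e * (\<kappa> * exp (\<kappa> * s0)))) (at s0 within {0..T})"
      unfolding f_def using x0 by (auto intro!: derivative_eq_intros simp: power2_norm_eq_inner[symmetric])
    from has_real_derivative_pos_inc_left[OF this dpos] obtain d where d: "d > 0"
      "\<And>h. 0 < h \<Longrightarrow> s0 - h \<in> {0..T} \<Longrightarrow> h < d \<Longrightarrow> f (s0 - h, x0) < f (s0, x0)" by auto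
    define h where "h = min (d/2) (s0/2)"
    have h: "0 < h" "h < d" "s0 - h \<in> {0..T}" "s0 - h < s0" "0 \<le> s0 - h"
      using d(1) s0pos s0 by (auto simp: h_def min_def)
    show False using d(2)[OF h(1,3,2)] before[OF h(4,5) x0] f00 by simp
  qed
  \<comment> \<open>Dividing \<open>e\<close> by \<open>exp (\<kappa> * t)\<close> makes the
    perturbation at time \<open>t\<close> exactly \<open>e\<close>, which is arbitrary.\<close>
  have unit: "0 \<le> x \<bullet> (Z t *v x)" if x: "x \<in> sphere 0 1" for x
  proof (rule field_le_epsilon)
    fix e :: real assume e: "e > 0"
    have "0 < x \<bullet> (Z t *v x) + (e / exp (\<kappa> * t)) * exp (\<kappa> * t) * (x \<bullet> x)"
      using e by (intro pos t x) simp
    then show "0 \<le> x \<bullet> (Z t *v x) + e"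
      using x by (simp add: power2_norm_eq_inner[symmetric])
  qed
  show ?thesis
  proof (cases "x = 0")
    case False
    have "0 \<le> (x /\<^sub>R norm x) \<bullet> (Z t *v (x /\<^sub>R norm x))"
      using False by (intro unit) simp
    also have "\<dots> = (x \<bullet> (Z t *v x)) / (norm x)\<^sup>2"
      by (simp add: matrix_vector_distribs power2_eq_square divide_inverse mult.assoc)
    finally show ?thesis using False by (simp add: zero_le_divide_iff)
  qed simp
qed


section \<open>Exponential convergence and Riccati flows\<close>

text \<open>Rate and constant are hidden behind existential quantifiers, because only closure
  matters: sums, bounded linear images and bilinear products of such curves converge exponentially
  again. No sign is imposed on \<open>K\<close>; \<open>expconvE\<close> delivers a positive
  one.\<close>

definition expconv :: "(real \<Rightarrow> 'a::real_normed_vector) \<Rightarrow> 'a \<Rightarrow> bool" where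
  "expconv f l \<longleftrightarrow> (\<exists>K \<gamma>. \<gamma> > 0 \<and> (\<forall>s\<ge>0. norm (f s - l) \<le> K * exp (- \<gamma> * s)))"

lemma expconvI: "\<gamma> > 0 \<Longrightarrow> (\<And>s. s \<ge> 0 \<Longrightarrow> norm (f s - l) \<le> K * exp (- \<gamma> * s)) \<Longrightarrow> expconv f l"
  unfolding expconv_def by blast

lemma expconvE:
  assumes "expconv f l"
  obtains K \<gamma> where "K > 0" "\<gamma> > 0" "\<And>s. s \<ge> 0 \<Longrightarrow> norm (f s - l) \<le> K * exp (- \<gamma> * s)"
proof -
  obtain K \<gamma> where g: "\<gamma> > 0" "\<And>s. s \<ge> 0 \<Longrightarrow> norm (f s - l) \<le> K * exp (- \<gamma> * s)"
    using assms unfolding expconv_def by blast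
  have "norm (f s - l) \<le> (\<bar>K\<bar> + 1) * exp (- \<gamma> * s)" if "s \<ge> 0" for s
    by (rule order_trans[OF g(2)[OF that]]) (simp add: mult_right_mono)
  then show thesis using that[of "\<bar>K\<bar> + 1" \<gamma>] g by auto
qed

lemma expconv_const: "expconv (\<lambda>s. l) l"
  by (rule expconvI[of 1 _ _ 0]) auto

lemma expconv_bounded:
  assumes "expconv f l"
  obtains K where "K > 0" "\<And>s. s \<ge> 0 \<Longrightarrow> norm (f s) \<le> K"
proof -
  obtain K \<gamma> where K: "K > 0" "\<gamma> > 0" "\<And>s. s \<ge> 0 \<Longrightarrow> norm (f s - l) \<le> K * exp (- \<gamma> * s)"
    using expconvE[OF assms] by blast
  have "norm (f s) \<le> norm l + K" if "s \<ge> 0" for s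
  proof -
    have "K * exp (- \<gamma> * s) \<le> K * 1" using K that by (intro mult_left_mono) auto
    then show ?thesis using K(3)[OF that] norm_triangle_sub[of "f s" l] by simp
  qed
  then show thesis using that[of "norm l + K"] K by (simp add: add_nonneg_pos)
qed

lemma exp_decay_weaken:
  fixes a b s K :: real
  assumes "0 \<le> K" "a \<le> b" "0 \<le> s"
  shows "K * exp (- b * s) \<le> K * exp (- a * s)"
  using assms by (intro mult_left_mono) (auto intro: mult_right_mono)

lemma expconv_add:
  assumes "expconv f l" "expconv g m"
  shows "expconv (\<lambda>s. f s + g s) (l + m)"
proof -
  obtain K1 a where 1: "K1 > 0" "a > 0" "\<And>s. s \<ge> 0 \<Longrightarrow> norm (f s - l) \<le> K1 * exp (- a * s)"
    using expconvE[OF assms(1)] by blast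
  obtain K2 b where 2: "K2 > 0" "b > 0" "\<And>s. s \<ge> 0 \<Longrightarrow> norm (g s - m) \<le> K2 * exp (- b * s)"
    using expconvE[OF assms(2)] by blast
  show ?thesis
  proof (rule expconvI[of "min a b" _ _ "K1 + K2"])
    fix s :: real assume s: "s \<ge> 0"
    have "norm (f s + g s - (l + m)) \<le> norm (f s - l) + norm (g s - m)"
      by (metis add_diff_add norm_triangle_ineq)
    also have "\<dots> \<le> K1 * exp (- a * s) + K2 * exp (- b * s)"
      by (intro add_mono 1(3) 2(3) s)
    also have "\<dots> \<le> K1 * exp (- min a b * s) + K2 * exp (- min a b * s)"
      using 1 2 s by (intro add_mono exp_decay_weaken) auto
    finally show "norm (f s + g s - (l + m)) \<le> (K1 + K2) * exp (- min a b * s)"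
      by (simp add: algebra_simps)
  qed (use 1 2 in simp)
qed

lemma expconv_linear:
  assumes "bounded_linear h" "expconv f l"
  shows "expconv (\<lambda>s. h (f s)) (h l)"
proof -
  interpret bounded_linear h by fact
  obtain B where B: "\<And>x. norm (h x) \<le> norm x * B" "B > 0" using pos_bounded by blast
  obtain K a where 1: "K > 0" "a > 0" "\<And>s. s \<ge> 0 \<Longrightarrow> norm (f s - l) \<le> K * exp (- a * s)"
    using expconvE[OF assms(2)] by blast
  show ?thesis
  proof (rule expconvI[OF 1(2), of _ _ "K * B"])
    fix s :: real assume s: "s \<ge> 0"
    have "norm (h (f s) - h l) \<le> norm (f s - l) * B" using B(1) by (simp add: diff[symmetric])
    also have "\<dots> \<le> K * exp (- a * s) * B" using 1(3)[OF s] B(2) by (intro mult_right_mono) auto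
    finally show "norm (h (f s) - h l) \<le> K * B * exp (- a * s)" by (simp add: algebra_simps)
  qed
qed

lemmas expconv_minus = expconv_linear[OF bounded_linear_minus[OF bounded_linear_ident]]

lemma expconv_diff: "expconv f l \<Longrightarrow> expconv g m \<Longrightarrow> expconv (\<lambda>s. f s - g s) (l - m)"
  using expconv_add[OF _ expconv_minus] by fastforce

text \<open>\<open>h (f s) (g s)\<close> differs from \<open>h (f s) m\<close> by a bounded argument
  paired with a decaying one, and \<open>h (f s) m\<close> is a linear image of
  \<open>f s\<close>.\<close>

lemma expconv_bilinear:
  assumes "bounded_bilinear h" and f: "expconv f l" and g: "expconv g m"
  shows "expconv (\<lambda>s. h (f s) (g s)) (h l m)"
proof -
  interpret bounded_bilinear h by fact
  obtain B where B: "\<And>x y. norm (h x y) \<le> norm x * norm y * B" "B > 0" using pos_bounded by blast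
  obtain C where C: "C > 0" "\<And>s. s \<ge> 0 \<Longrightarrow> norm (f s) \<le> C" using expconv_bounded[OF f] by blast
  obtain K a where K: "K > 0" "a > 0" "\<And>s. s \<ge> 0 \<Longrightarrow> norm (g s - m) \<le> K * exp (- a * s)"
    using expconvE[OF g] by blast
  have 1: "expconv (\<lambda>s. h (f s) (g s - m)) 0"
  proof (rule expconvI[OF K(2), of _ _ "C * K * B"])
    fix s :: real assume s: "s \<ge> 0"
    have "norm (h (f s) (g s - m)) \<le> norm (f s) * norm (g s - m) * B" by (rule B(1))
    also have "\<dots> \<le> C * (K * exp (- a * s)) * B"
      using C(2)[OF s] C(1) K(3)[OF s] B(2) by (intro mult_right_mono mult_mono) auto
    finally show "norm (h (f s) (g s - m) - 0) \<le> C * K * B * exp (- a * s)" by (simp add: algebra_simps)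
  qed
  have 2: "expconv (\<lambda>s. h (f s) m) (h l m)"
    by (rule expconv_linear[OF bounded_linear_left f])
  have "(\<lambda>s. h (f s) (g s)) = (\<lambda>s. h (f s) (g s - m) + h (f s) m)" by (simp add: diff_right)
  then show ?thesis using expconv_add[OF 1 2] by simp
qed

lemmas expconv_matrix_mult = expconv_bilinear[OF bounded_bilinear_matrix_mult]
lemmas expconv_transpose = expconv_linear[OF bounded_linear_transpose]

text \<open>Instantiated twice: for the equation of \<open>P\<close>, and for that of
  \<open>\<Pi>bar\<close>, where \<open>A + Abar\<close>, \<open>C + Cbar\<close> and
  \<open>Q + Qbar\<close> take the places of \<open>A\<close>, \<open>C\<close> and
  \<open>Q\<close>. The assumption \<open>cost\<close> is the positivity condition in control form:
  the running cost is coercive in the state, uniformly over all controls.\<close>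

locale riccati =
  fixes A C Q :: "real^'d^'d" and B D :: "real^'m^'d" and S :: "real^'d^'m" and R :: "real^'m^'m"
    and \<delta> r :: real
  assumes \<delta>: "0 < \<delta>" and r: "0 < r"
    and cost: "\<And>x \<theta>. \<delta> * (norm x)\<^sup>2 \<le> x \<bullet> (Q *v x) + 2 * (\<theta> \<bullet> (S *v x)) + \<theta> \<bullet> (R *v \<theta>)"
    and R_coercive: "\<And>\<theta>. r * (norm \<theta>)\<^sup>2 \<le> \<theta> \<bullet> (R *v \<theta>)"
    and R_sym: "transpose R = R"
begin

definition N where "N Y = R + transpose D ** Y ** D"
definition MM where "MM X Y = transpose B ** X + transpose D ** Y ** C + S"
text \<open>\<open>X\<close> is the unknown and \<open>Y\<close> the matrix in the noise terms and
  in the control weight. The equation of \<open>P\<close> has \<open>Y = X\<close>; the equation of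
  \<open>\<Pi>bar\<close> has \<open>X = \<Pi>bar\<close> and \<open>Y = P\<close>.\<close>

definition ric where
  "ric X Y = transpose A ** X + X ** A + transpose C ** Y ** C + Q
     - transpose (MM X Y) ** matrix_inv (N Y) ** MM X Y"
definition cst where "cst x \<theta> = x \<bullet> (Q *v x) + 2 * (\<theta> \<bullet> (S *v x)) + \<theta> \<bullet> (R *v \<theta>)"
text \<open>The expression that dynamic programming minimizes over the control
  \<open>\<theta>\<close>: the drift of the form of \<open>X\<close>, the second-order term weighted
  by \<open>Y\<close>, and the running cost. Its minimizer is \<open>opt\<close>.\<close>

definition qf where
  "qf X Y x \<theta> = 2 * ((A *v x + B *v \<theta>) \<bullet> (X *v x))
     + (C *v x + D *v \<theta>) \<bullet> (Y *v (C *v x + D *v \<theta>)) + cst x \<theta>"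
definition opt where "opt X Y x = - (matrix_inv (N Y) *v (MM X Y *v x))"

lemma N_coercive:
  assumes "Y \<in> psd_mats"
  shows "r * (norm \<theta>)\<^sup>2 \<le> \<theta> \<bullet> (N Y *v \<theta>)"
proof -
  have "\<theta> \<bullet> (N Y *v \<theta>) = \<theta> \<bullet> (R *v \<theta>) + (D *v \<theta>) \<bullet> (Y *v (D *v \<theta>))"
    by (simp add: N_def matrix_vector_distribs inner_add_right inner_matrix_transpose
        matrix_vector_mul_assoc[symmetric] del: transpose_matrix_vector)
  moreover have "0 \<le> (D *v \<theta>) \<bullet> (Y *v (D *v \<theta>))" using assms by (simp add: psd_mats_def)
  ultimately show ?thesis using R_coercive[of \<theta>] by linarith
qed

lemma N_sym: "Y \<in> psd_mats \<Longrightarrow> transpose (N Y) = N Y"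
  by (simp add: N_def transpose_distribs matrix_transpose_mul R_sym psd_mats_def matrix_mul_assoc)

lemmas N_inv = coercive_inverse[OF r N_coercive]

text \<open>Completing the square in \<open>\<theta>\<close>. The remainder is nonnegative by
  coercivity of \<open>N Y\<close> and vanishes at \<open>opt\<close>, so a Riccati field lies below
  \<open>qf\<close> for every control and is attained at one.\<close>

lemma qf_eq:
  assumes X: "transpose X = X" and Y: "Y \<in> psd_mats"
  shows "qf X Y x \<theta> = x \<bullet> (ric X Y *v x) + (\<theta> - opt X Y x) \<bullet> (N Y *v (\<theta> - opt X Y x))"
proof -
  define m where "m = MM X Y *v x"
  define \<phi> where "\<phi> = matrix_inv (N Y) *v m"
  have N\<phi>: "N Y *v \<phi> = m"
    by (simp add: \<phi>_def matrix_vector_mul_assoc N_inv(1)[OF Y])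
  have sY: "transpose Y = Y" using Y by (simp add: psd_mats_def)
  have ric: "x \<bullet> (ric X Y *v x) = 2 * ((A *v x) \<bullet> (X *v x)) + (C *v x) \<bullet> (Y *v (C *v x)) + x \<bullet> (Q *v x) - m \<bullet> \<phi>"
    using symmetric_inner(2)[OF X, of x "A *v x"]
    by (simp add: ric_def matrix_vector_distribs inner_add_right inner_diff_right inner_matrix_transpose
        matrix_vector_mul_assoc[symmetric] m_def \<phi>_def del: transpose_matrix_vector)
  have m: "\<theta> \<bullet> m = (B *v \<theta>) \<bullet> (X *v x) + (D *v \<theta>) \<bullet> (Y *v (C *v x)) + \<theta> \<bullet> (S *v x)"
    by (simp add: m_def MM_def matrix_vector_distribs inner_add_right inner_matrix_transpose
        matrix_vector_mul_assoc[symmetric] del: transpose_matrix_vector)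
  have N: "\<theta> \<bullet> (N Y *v \<theta>) = \<theta> \<bullet> (R *v \<theta>) + (D *v \<theta>) \<bullet> (Y *v (D *v \<theta>))"
    by (simp add: N_def matrix_vector_distribs inner_add_right inner_matrix_transpose
        matrix_vector_mul_assoc[symmetric] del: transpose_matrix_vector)
  have "(\<theta> - opt X Y x) \<bullet> (N Y *v (\<theta> - opt X Y x)) = (\<theta> + \<phi>) \<bullet> (N Y *v (\<theta> + \<phi>))"
    by (simp add: opt_def \<phi>_def m_def)
  also have "\<dots> = \<theta> \<bullet> (N Y *v \<theta>) + 2 * (\<theta> \<bullet> m) + m \<bullet> \<phi>"
    using symmetric_inner(2)[OF N_sym[OF Y], of \<phi> \<theta>] N\<phi>
    by (simp add: matrix_vector_distribs inner_add_left inner_add_right inner_commute)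
  finally show ?thesis
    using symmetric_inner(2)[OF sY, of "D *v \<theta>" "C *v x"]
    by (simp add: ric m N qf_def cst_def matrix_vector_distribs inner_add_left inner_add_right inner_commute)
qed

lemma ric_le:
  assumes "transpose X = X" "Y \<in> psd_mats"
  shows "x \<bullet> (ric X Y *v x) \<le> qf X Y x \<theta>"
proof -
  have "0 \<le> (\<theta> - opt X Y x) \<bullet> (N Y *v (\<theta> - opt X Y x))"
    by (rule order_trans[OF _ N_coercive[OF assms(2)]]) (use r in simp)
  then show ?thesis by (simp add: qf_eq[OF assms])
qed

lemma ric_opt:
  assumes "transpose X = X" "Y \<in> psd_mats"
  shows "x \<bullet> (ric X Y *v x) = qf X Y x (opt X Y x)"
  by (simp add: qf_eq[OF assms])

text \<open>The optimal feedback is linear in \<open>x\<close> and, by the uniform bound on the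
  inverse of \<open>N Y\<close>, bounded uniformly over \<open>X\<close> and \<open>Y\<close> in a
  ball. This supplies the vectors and the constant that \<open>sym_curve_nonneg\<close> asks
  for.\<close>

lemma feedback_bound:
  obtains K where "K \<ge> 0" "\<And>X Y x. Y \<in> psd_mats \<Longrightarrow> norm X \<le> k \<Longrightarrow> norm Y \<le> k \<Longrightarrow>
      norm (A *v x + B *v opt X Y x) \<le> K * norm x \<and> norm (C *v x + D *v opt X Y x) \<le> K * norm x"
proof -
  define L where "L = (norm B * \<bar>k\<bar> + norm D * \<bar>k\<bar> * norm C + norm S) / r"
  define K where "K = norm A + norm B * L + (norm C + norm D * L)"
  have L0: "L \<ge> 0" using r by (simp add: L_def)
  have K0: "K \<ge> 0" using L0 by (simp add: K_def)
  have "norm (A *v x + B *v opt X Y x) \<le> K * norm x \<and> norm (C *v x + D *v opt X Y x) \<le> K * norm x"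
    if Y: "Y \<in> psd_mats" and X: "norm X \<le> k" and Yk: "norm Y \<le> k" for X Y x
  proof -
    have "norm (MM X Y) \<le> norm (transpose B ** X) + norm (transpose D ** Y ** C) + norm S"
      unfolding MM_def by (intro norm_triangle_mono norm_triangle_ineq order_refl)
    also have "\<dots> \<le> norm B * \<bar>k\<bar> + norm D * \<bar>k\<bar> * norm C + norm S"
    proof (intro add_mono order_refl)
      show "norm (transpose B ** X) \<le> norm B * \<bar>k\<bar>"
        by (rule order_trans[OF norm_matrix_mult_le]) (use X in \<open>auto intro: mult_left_mono\<close>)
      have "norm (transpose D ** Y) \<le> norm D * \<bar>k\<bar>"
        by (rule order_trans[OF norm_matrix_mult_le]) (use Yk in \<open>auto intro: mult_left_mono\<close>)
      then show "norm (transpose D ** Y ** C) \<le> norm D * \<bar>k\<bar> * norm C"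
        by (rule order_trans[OF norm_matrix_mult_le mult_right_mono]) simp
    qed
    finally have M: "norm (MM X Y) / r \<le> L" using r by (simp add: L_def divide_right_mono)
    have "norm (opt X Y x) \<le> norm (MM X Y *v x) / r"
      unfolding opt_def norm_minus_cancel by (rule N_inv(3)[OF Y])
    also have "\<dots> \<le> norm (MM X Y) * norm x / r"
      using r by (intro divide_right_mono norm_matrix_vector_mult_le) simp
    also have "\<dots> \<le> L * norm x" using mult_right_mono[OF M norm_ge_zero[of x]] by simp
    finally have o: "norm (opt X Y x) \<le> L * norm x" .
    have g: "norm (V *v x + W *v opt X Y x) \<le> (norm V + norm W * L) * norm x"
      for V :: "real^'d^'d" and W :: "real^'m^'d"
    proof -
      have "norm (V *v x + W *v opt X Y x) \<le> norm V * norm x + norm W * (L * norm x)"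
        by (intro norm_triangle_mono norm_matrix_vector_mult_le
            order_trans[OF norm_matrix_vector_mult_le mult_left_mono[OF o]]) simp
      then show ?thesis by (simp add: algebra_simps)
    qed
    have "norm A + norm B * L \<le> K" "norm C + norm D * L \<le> K" using L0 by (auto simp: K_def)
    then show ?thesis using g[of A B] g[of C D] by (meson mult_right_mono norm_ge_zero order_trans)
  qed
  then show thesis using that[of K] K0 by blast
qed

text \<open>Insert the control that is optimal for \<open>(X2, Y2)\<close>: the field of
  \<open>X2\<close> equals its \<open>qf\<close>, the field of \<open>X1\<close> is at most its
  \<open>qf\<close>, and the running costs cancel. What remains is linear in \<open>X2 - X1\<close>,
  plus the form of \<open>Y2 - Y1\<close> at \<open>c\<close>. In the coupled alternative the latter
  is the form of the unknown difference itself; in the ordered one it is nonnegative, and 0 is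
  supplied for \<open>c\<close>. The feedback belongs to the upper curve, hence the bounds on
  \<open>X2\<close> and \<open>Y2\<close>.\<close>

lemma ric_mono:
  fixes X1 X2 Y1 Y2 :: "real \<Rightarrow> real^'d^'d"
  assumes d1: "\<And>s. s \<in> {0..T} \<Longrightarrow> (X1 has_vector_derivative ric (X1 s) (Y1 s)) (at s within {0..T})"
    and d2: "\<And>s. s \<in> {0..T} \<Longrightarrow> (X2 has_vector_derivative ric (X2 s) (Y2 s)) (at s within {0..T})"
    and sym: "\<And>s. s \<in> {0..T} \<Longrightarrow> transpose (X1 s) = X1 s" "\<And>s. s \<in> {0..T} \<Longrightarrow> transpose (X2 s) = X2 s"
    and Y: "\<And>s. s \<in> {0..T} \<Longrightarrow> Y1 s \<in> psd_mats" "\<And>s. s \<in> {0..T} \<Longrightarrow> Y2 s \<in> psd_mats"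
    and bdd: "\<And>s. s \<in> {0..T} \<Longrightarrow> norm (X2 s) \<le> k" "\<And>s. s \<in> {0..T} \<Longrightarrow> norm (Y2 s) \<le> k"
    and init: "\<And>x. x \<bullet> (X1 0 *v x) \<le> x \<bullet> (X2 0 *v x)"
    and alt: "(\<forall>s\<in>{0..T}. Y1 s = X1 s \<and> Y2 s = X2 s) \<or>
      (\<forall>s\<in>{0..T}. \<forall>x. x \<bullet> (Y1 s *v x) \<le> x \<bullet> (Y2 s *v x))"
    and t: "t \<in> {0..T}"
  shows "x \<bullet> (X1 t *v x) \<le> x \<bullet> (X2 t *v x)"
proof -
  obtain K where K: "K \<ge> 0" "\<And>X Y x. Y \<in> psd_mats \<Longrightarrow> norm X \<le> k \<Longrightarrow> norm Y \<le> k \<Longrightarrow>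
      norm (A *v x + B *v opt X Y x) \<le> K * norm x \<and> norm (C *v x + D *v opt X Y x) \<le> K * norm x"
    using feedback_bound by blast
  have "0 \<le> x \<bullet> ((X2 t - X1 t) *v x)"
  proof (rule sym_curve_nonneg[where Z' = "\<lambda>s. ric (X2 s) (Y2 s) - ric (X1 s) (Y1 s)" and K = K and T = T])
    fix s assume s: "s \<in> {0..T}"
    show "((\<lambda>s. X2 s - X1 s) has_vector_derivative ric (X2 s) (Y2 s) - ric (X1 s) (Y1 s)) (at s within {0..T})"
      by (intro has_vector_derivative_diff d1 d2 s)
    show "transpose (X2 s - X1 s) = X2 s - X1 s" by (simp add: transpose_distribs sym[OF s])
    fix x
    define \<theta> where "\<theta> = opt (X2 s) (Y2 s) x"
    let ?a = "A *v x + B *v \<theta>" and ?c = "C *v x + D *v \<theta>"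
    have b: "norm ?a \<le> K * norm x" "norm ?c \<le> K * norm x"
      using K(2)[OF Y(2)[OF s] bdd[OF s], of x] by (auto simp: \<theta>_def)
    have main: "2 * (?a \<bullet> ((X2 s - X1 s) *v x)) + (?c \<bullet> (Y2 s *v ?c) - ?c \<bullet> (Y1 s *v ?c))
        \<le> x \<bullet> ((ric (X2 s) (Y2 s) - ric (X1 s) (Y1 s)) *v x)"
      using ric_opt[OF sym(2)[OF s] Y(2)[OF s], of x] ric_le[OF sym(1)[OF s] Y(1)[OF s], of x \<theta>]
      by (simp add: \<theta>_def[symmetric] qf_def matrix_vector_distribs inner_diff_right)
    from alt show "\<exists>a c. norm a \<le> K * norm x \<and> norm c \<le> K * norm x \<and>
        2 * (a \<bullet> ((X2 s - X1 s) *v x)) + c \<bullet> ((X2 s - X1 s) *v c)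
        \<le> x \<bullet> ((ric (X2 s) (Y2 s) - ric (X1 s) (Y1 s)) *v x)"
    proof
      assume "\<forall>s\<in>{0..T}. Y1 s = X1 s \<and> Y2 s = X2 s"
      then have "?c \<bullet> (Y2 s *v ?c) - ?c \<bullet> (Y1 s *v ?c) = ?c \<bullet> ((X2 s - X1 s) *v ?c)"
        using s by (simp add: matrix_vector_distribs inner_diff_right inner_add_right)
      with main b show ?thesis by metis
    next
      assume "\<forall>s\<in>{0..T}. \<forall>x. x \<bullet> (Y1 s *v x) \<le> x \<bullet> (Y2 s *v x)"
      then have "?c \<bullet> (Y1 s *v ?c) \<le> ?c \<bullet> (Y2 s *v ?c)" using s by blast
      with main b K(1) show ?thesis by (intro exI[of _ ?a] exI[of _ 0]) auto
    qed
  qed (use init t in \<open>auto simp: matrix_vector_distribs inner_diff_right\<close>)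
  then show ?thesis by (simp add: matrix_vector_distribs inner_diff_right)
qed

text \<open>In the derivative of the supersolution the summand \<open>k X\<close> produces
  \<open>k\<close> times the running cost, at least \<open>k * \<delta> * (norm x)\<^sup>2\<close>.
  This gain pays for the drift of \<open>Xinf\<close>, for the decay rate and for the deviation of
  \<open>Y\<close> from \<open>Yinf\<close>. That deviation is either the gap of \<open>X\<close>
  itself (coupled case) or already known to decay exponentially.\<close>

lemma ric_decay:
  fixes X Y :: "real \<Rightarrow> real^'d^'d"
  assumes der: "\<And>s. s \<ge> 0 \<Longrightarrow> (X has_vector_derivative ric (X s) (Y s)) (at s within {0..})"
    and X: "\<And>s. s \<ge> 0 \<Longrightarrow> X s \<in> psd_mats" and X0: "X 0 = 0"
    and Y: "\<And>s. s \<ge> 0 \<Longrightarrow> Y s \<in> psd_mats"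
    and Xinf: "Xinf \<in> psd_mats" and Yinf: "Yinf \<in> psd_mats" and eq: "ric Xinf Yinf = 0"
    and alt: "(\<forall>s\<ge>0. Y s = X s) \<and> Yinf = Xinf \<or>
      (\<forall>s\<ge>0. \<forall>x. x \<bullet> (Y s *v x) \<le> x \<bullet> (Yinf *v x)) \<and> expconv Y Yinf"
  shows "expconv X Xinf" "\<And>s x. s \<ge> 0 \<Longrightarrow> x \<bullet> (X s *v x) \<le> x \<bullet> (Xinf *v x)"
proof -
  have sub: "(X has_vector_derivative ric (X s) (Y s)) (at s within {0..T})" if "s \<in> {0..T}" for s T
    using der[of s] that by (auto intro: has_vector_derivative_within_subset)
  have symX: "transpose (X s) = X s" if "s \<ge> 0" for s using X[OF that] by (simp add: psd_mats_def)
  have symXinf: "transpose Xinf = Xinf" using Xinf by (simp add: psd_mats_def)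
  have alt1: "(\<forall>s\<ge>0. Y s = X s) \<and> Yinf = Xinf \<or> (\<forall>s\<ge>0. \<forall>x. x \<bullet> (Y s *v x) \<le> x \<bullet> (Yinf *v x))"
    using alt by blast
  \<comment> \<open>Comparison with the constant curve \<open>Xinf\<close>, which solves the same
    equation with \<open>Yinf\<close> since its field vanishes.\<close>
  show le: "x \<bullet> (X s *v x) \<le> x \<bullet> (Xinf *v x)" if s: "s \<ge> 0" for s x
  proof (rule ric_mono[where T = s and ?X1.0 = X and ?Y1.0 = Y and ?X2.0 = "\<lambda>_. Xinf" and ?Y2.0 = "\<lambda>_. Yinf" and k = "norm Xinf + norm Yinf"])
    show "((\<lambda>_. Xinf) has_vector_derivative ric Xinf Yinf) (at s' within {0..s})" for s'
      by (simp add: eq)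
    show "x \<bullet> (X 0 *v x) \<le> x \<bullet> (Xinf *v x)" for x
      using Xinf by (simp add: X0 psd_mats_def)
  qed (use sub symX symXinf Y Yinf alt1 s X0 Xinf in \<open>auto simp: psd_mats_def\<close>)
  define n where "n = norm Xinf"
  have ninf: "x \<bullet> (Xinf *v y) \<le> n * norm x * norm y" "\<bar>x \<bullet> (Xinf *v y)\<bar> \<le> n * norm x * norm y" for x y
  proof -
    have "\<bar>x \<bullet> (Xinf *v y)\<bar> \<le> norm x * norm (Xinf *v y)" by (rule Cauchy_Schwarz_ineq2)
    also have "\<dots> \<le> norm x * (n * norm y)"
      unfolding n_def by (intro mult_left_mono norm_matrix_vector_mult_le) simp
    finally show "\<bar>x \<bullet> (Xinf *v y)\<bar> \<le> n * norm x * norm y" by (simp add: algebra_simps)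
    then show "x \<bullet> (Xinf *v y) \<le> n * norm x * norm y" by linarith
  qed
  have n2: "x \<bullet> (Xinf *v x) \<le> n * (norm x)\<^sup>2" for x
    using ninf(1)[of x x] by (simp add: power2_eq_square mult.assoc)
  let ?d = "real (CARD('d) * CARD('d))"
  have Xb: "norm (X s) \<le> ?d * n" if s: "s \<ge> 0" for s
    using X[OF s] le[OF s] n2 by (intro psd_norm_le) (auto simp: psd_mats_def intro: order_trans)
  obtain k0 where Ybdd: "\<And>s. s \<ge> 0 \<Longrightarrow> norm (Y s) \<le> k0"
  proof (cases "\<forall>s\<ge>0. Y s = X s")
    case True then show ?thesis using that[of "?d * n"] Xb by simp
  next
    case False
    then have "expconv Y Yinf" using alt by blast
    then show ?thesis by (rule expconv_bounded) (rule that)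
  qed
  obtain K where K: "K \<ge> 0" "\<And>X Y x. Y \<in> psd_mats \<Longrightarrow> norm X \<le> max k0 (?d * n) \<Longrightarrow> norm Y \<le> max k0 (?d * n) \<Longrightarrow>
      norm (A *v x + B *v opt X Y x) \<le> K * norm x \<and> norm (C *v x + D *v opt X Y x) \<le> K * norm x"
    using feedback_bound by blast
  \<comment> \<open>In the coupled case no decay of \<open>Y\<close> is known yet; there 0 and 1 are
    placeholders with the right signs.\<close>
  obtain kY \<mu> where kY: "kY \<ge> 0" "\<mu> > 0" and
    alt': "Yinf = Xinf \<and> (\<forall>s\<ge>0. Y s = X s) \<or> (\<forall>s\<ge>0. norm (Y s - Yinf) \<le> kY * exp (- \<mu> * s))"
  proof (cases "Yinf = Xinf \<and> (\<forall>s\<ge>0. Y s = X s)")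
    case True then show ?thesis using that[of 0 1] by auto
  next
    case False
    then have "expconv Y Yinf" using alt by blast
    then obtain K \<gamma> where "K > 0" "\<gamma> > 0" "\<And>s. s \<ge> 0 \<Longrightarrow> norm (Y s - Yinf) \<le> K * exp (- \<gamma> * s)"
      using expconvE by blast
    then show ?thesis using that[of K \<gamma>] by auto
  qed
  \<comment> \<open>The first bound keeps the rate below that of \<open>Y\<close>; the second lets
    the rate be paid by half of the cost gain, as \<open>\<nu>k\<close> records. The
    \<open>+ 1\<close> guards against \<open>n = 0\<close>.\<close>
  define \<nu> where "\<nu> = min \<mu> (\<delta> / (4 * (n + 1)))"
  have n0: "n \<ge> 0" by (simp add: n_def)
  have \<nu>: "\<nu> > 0" "\<nu> \<le> \<mu>" using \<delta> n0 kY by (auto simp: \<nu>_def)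
  have \<nu>n: "\<nu> * n \<le> \<delta> / 4"
  proof -
    have "\<nu> * n \<le> \<delta> / (4 * (n + 1)) * (n + 1)"
      using n0 \<delta> \<nu> by (intro mult_mono) (auto simp: \<nu>_def)
    also have "\<dots> = \<delta> / 4" using n0 by (simp add: field_simps)
    finally show ?thesis .
  qed
  \<comment> \<open>Everything to be absorbed, per unit of \<open>w\<close>: twice the pairing of
    \<open>a\<close> with \<open>Xinf *v x\<close>, the form of \<open>Xinf\<close> at
    \<open>c\<close> (coupled case), and the error \<open>Y - Yinf\<close> at \<open>c\<close>
    (decoupled case).\<close>
  define H where "H = (2 * K + K\<^sup>2) * n + kY * K\<^sup>2"
  have H0: "H \<ge> 0" using K(1) n0 kY by (simp add: H_def)
  \<comment> \<open>\<open>H\<close> then fits into half of the gain \<open>k * \<delta>\<close>,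
    the other half being reserved for the rate \<open>\<nu>\<close>. The leading 1 gives
    \<open>1 + k \<le> 2 * k\<close>.\<close>
  define k where "k = 1 + 2 * H / \<delta>"
  have k1: "k \<ge> 1" using H0 \<delta> by (simp add: k_def)
  then have k0': "k \<ge> 0" by simp
  have kH: "H \<le> k * \<delta> / 2" using \<delta> by (simp add: k_def field_simps)
  have \<nu>k: "\<nu> * ((1 + k) * n) \<le> k * \<delta> / 2"
  proof -
    have "\<nu> * ((1 + k) * n) \<le> \<nu> * n * (2 * k)"
      using mult_left_mono[OF mult_right_mono[of "1 + k" "2 * k" n], of \<nu>] k1 \<nu>(1) n0
      by (simp add: algebra_simps)
    also have "\<dots> \<le> \<delta> / 4 * (2 * k)" using k1 by (intro mult_right_mono \<nu>n) simp
    finally show ?thesis by (simp add: mult.commute)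
  qed
  let ?e = "\<lambda>s. exp (- \<nu> * s)"
  have up: "x \<bullet> (Xinf *v x) - x \<bullet> (X t *v x) \<le> (1 + k) * n * ?e t * (norm x)\<^sup>2" if t: "t \<ge> 0" for t x
  proof -
    define Z where "Z = (\<lambda>s. ?e s *\<^sub>R (Xinf + k *\<^sub>R X s) - (Xinf - X s))"
    define Z' where "Z' = (\<lambda>s. ?e s *\<^sub>R (k *\<^sub>R ric (X s) (Y s)) + (- \<nu> * ?e s) *\<^sub>R (Xinf + k *\<^sub>R X s)
        + ric (X s) (Y s))"
    have "0 \<le> x \<bullet> (Z t *v x)"
    proof (rule sym_curve_nonneg[where Z' = Z' and K = K and T = t])
      fix s assume s': "s \<in> {0..t}"
      then have s: "s \<ge> 0" by simp
      show "(Z has_vector_derivative Z' s) (at s within {0..t})"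
        unfolding Z_def Z'_def
        by (auto intro!: derivative_eq_intros sub[OF s'])
      show "transpose (Z s) = Z s" by (simp add: Z_def transpose_distribs symX[OF s] symXinf)
      fix x
      define \<theta> where "\<theta> = opt (X s) (Y s) x"
      define a where "a = A *v x + B *v \<theta>"
      define c where "c = C *v x + D *v \<theta>"
      define g where "g = cst x \<theta>"
      define w where "w = (norm x)\<^sup>2"
      have w0: "w \<ge> 0" by (simp add: w_def)
      have ac: "norm a \<le> K * norm x" "norm c \<le> K * norm x"
        using K(2)[OF Y[OF s], of "X s" x] Xb[OF s] Ybdd[OF s] by (auto simp: \<theta>_def a_def c_def)
      have g: "g \<ge> \<delta> * w" using cost by (simp add: g_def cst_def w_def)
      have e0: "?e s > 0" by simp
      have r1: "x \<bullet> (ric (X s) (Y s) *v x) = 2 * (a \<bullet> (X s *v x)) + c \<bullet> (Y s *v c) + g"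
        using ric_opt[OF symX[OF s] Y[OF s], of x] by (simp add: \<theta>_def a_def c_def g_def qf_def)
      \<comment> \<open>The control is optimal for \<open>X s\<close> and thus merely one competitor
        for \<open>Xinf\<close>, where the minimum is 0; this bounds the drift of
        \<open>Xinf\<close> from below.\<close>
      have r2: "0 \<le> 2 * (a \<bullet> (Xinf *v x)) + c \<bullet> (Yinf *v c) + g"
        using ric_le[OF symXinf Yinf, of x \<theta>] by (simp add: eq a_def c_def g_def qf_def)
      have xX: "0 \<le> x \<bullet> (X s *v x)" "x \<bullet> (X s *v x) \<le> n * w" "x \<bullet> (Xinf *v x) \<le> n * w"
        using X[OF s] le[OF s, of x] n2[of x] by (auto simp: psd_mats_def w_def)
      have ax: "a \<bullet> (Xinf *v x) \<le> K * n * w"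
      proof -
        have "a \<bullet> (Xinf *v x) \<le> n * norm a * norm x" by (rule ninf)
        also have "\<dots> \<le> n * (K * norm x) * norm x" using ac n0 by (intro mult_right_mono mult_left_mono) auto
        finally show ?thesis by (simp add: w_def power2_eq_square algebra_simps)
      qed
      have nc: "(norm c)\<^sup>2 \<le> K\<^sup>2 * w"
        using power_mono[OF ac(2), of 2] by (simp add: w_def power_mult_distrib)
      have cx: "c \<bullet> (Xinf *v c) \<le> K\<^sup>2 * n * w"
        using order_trans[OF n2[of c] mult_left_mono[OF nc n0]] by (simp add: algebra_simps)
      have lam: "\<nu> * (x \<bullet> (Xinf *v x) + k * (x \<bullet> (X s *v x))) \<le> k * \<delta> / 2 * w"
      proof -
        have "x \<bullet> (Xinf *v x) + k * (x \<bullet> (X s *v x)) \<le> (1 + k) * n * w"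
          using xX mult_left_mono[OF xX(2) k0'] by (simp add: algebra_simps)
        then have "\<nu> * (x \<bullet> (Xinf *v x) + k * (x \<bullet> (X s *v x))) \<le> \<nu> * ((1 + k) * n * w)"
          using \<nu> by (intro mult_left_mono) auto
        also have "\<dots> = \<nu> * ((1 + k) * n) * w" by simp
        also have "\<dots> \<le> k * \<delta> / 2 * w" using w0 by (intro mult_right_mono \<nu>k)
        finally show ?thesis .
      qed
      have kg: "k * g \<ge> k * \<delta> * w" using mult_left_mono[OF g k0'] by (simp add: algebra_simps)
      define BR where "BR = - \<nu> * (x \<bullet> (Xinf *v x) + k * (x \<bullet> (X s *v x))) + k * g - 2 * (a \<bullet> (Xinf *v x))"
      have BR: "BR \<ge> (K\<^sup>2 * n + kY * K\<^sup>2) * w"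
      proof -
        have "H * w \<le> k * \<delta> / 2 * w" by (intro mult_right_mono kH w0)
        then have "2 * K * n * w + (K\<^sup>2 * n + kY * K\<^sup>2) * w \<le> k * \<delta> / 2 * w"
          by (simp add: H_def algebra_simps)
        then show ?thesis using lam kg ax unfolding BR_def by (simp add: algebra_simps)
      qed
      have Zx: "x \<bullet> (Z' s *v x) - 2 * (a \<bullet> (Z s *v x)) \<ge> ?e s * BR + ?e s * (k * (c \<bullet> (Y s *v c))) - (c \<bullet> (Yinf *v c) - c \<bullet> (Y s *v c))"
        using r2
        by (simp add: Z_def Z'_def BR_def matrix_vector_distribs inner_add_right inner_diff_right r1 algebra_simps)
      from alt' show "\<exists>a c. norm a \<le> K * norm x \<and> norm c \<le> K * norm x \<and>
          2 * (a \<bullet> (Z s *v x)) + c \<bullet> (Z s *v c) \<le> x \<bullet> (Z' s *v x)"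
      proof
        assume "Yinf = Xinf \<and> (\<forall>s\<ge>0. Y s = X s)"
        then have Ys: "Yinf = Xinf" "Y s = X s" using s by auto
        have "c \<bullet> (Xinf *v c) \<le> BR"
          using BR cx kY w0 K(1) by (smt (verit) mult_nonneg_nonneg zero_le_power2 distrib_right)
        then have "?e s * (c \<bullet> (Xinf *v c)) \<le> ?e s * BR" by (intro mult_left_mono) auto
        moreover have "c \<bullet> (Z s *v c) = ?e s * (c \<bullet> (Xinf *v c)) + ?e s * (k * (c \<bullet> (X s *v c)))
            - (c \<bullet> (Xinf *v c) - c \<bullet> (X s *v c))"
          by (simp add: Z_def matrix_vector_distribs inner_add_right inner_diff_right algebra_simps)
        ultimately have "2 * (a \<bullet> (Z s *v x)) + c \<bullet> (Z s *v c) \<le> x \<bullet> (Z' s *v x)"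
          using Zx unfolding Ys by linarith
        then show ?thesis using ac by blast
      next
        assume Ye: "\<forall>s\<ge>0. norm (Y s - Yinf) \<le> kY * exp (- \<mu> * s)"
        have "c \<bullet> (Yinf *v c) - c \<bullet> (Y s *v c) = - (c \<bullet> ((Y s - Yinf) *v c))"
          by (simp add: matrix_vector_distribs inner_diff_right)
        also have "\<dots> \<le> norm c * norm ((Y s - Yinf) *v c)"
          using Cauchy_Schwarz_ineq2[of c "(Y s - Yinf) *v c"] by linarith
        also have "\<dots> \<le> norm c * (norm (Y s - Yinf) * norm c)"
          by (intro mult_left_mono norm_matrix_vector_mult_le) simp
        also have "\<dots> = norm (Y s - Yinf) * (norm c)\<^sup>2" by (simp add: power2_eq_square)
        also have "\<dots> \<le> (kY * exp (- \<mu> * s)) * (K\<^sup>2 * w)"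
          using Ye s nc kY by (intro mult_mono) auto
        also have "\<dots> \<le> (kY * ?e s) * (K\<^sup>2 * w)"
          using kY \<nu> s w0 by (intro mult_right_mono exp_decay_weaken) auto
        also have "\<dots> \<le> ?e s * BR"
        proof -
          have "kY * (K\<^sup>2 * w) \<le> BR"
            using BR n0 w0 by (smt (verit) mult_nonneg_nonneg zero_le_power2 distrib_right mult.assoc)
          then have "?e s * (kY * (K\<^sup>2 * w)) \<le> ?e s * BR" by (intro mult_left_mono) auto
          then show ?thesis by (simp add: algebra_simps)
        qed
        finally have "c \<bullet> (Yinf *v c) - c \<bullet> (Y s *v c) \<le> ?e s * BR" .
        moreover have "0 \<le> ?e s * (k * (c \<bullet> (Y s *v c)))"
          using Y[OF s] k1 by (simp add: psd_mats_def)
        ultimately have "2 * (a \<bullet> (Z s *v x)) \<le> x \<bullet> (Z' s *v x)"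
          using Zx by linarith
        \<comment> \<open>The second vector is 0 here: \<open>Y\<close> is given data, so its
          contribution at \<open>c\<close> has been estimated directly and is not handed to the
          comparison principle.\<close>
        then show ?thesis using ac K(1) by (intro exI[of _ a] exI[of _ 0]) auto
      qed
    next
      show "0 \<le> x \<bullet> (Z 0 *v x)" for x
        by (simp add: Z_def X0)
    qed (use t in auto)
    then have "x \<bullet> (Xinf *v x) - x \<bullet> (X t *v x) \<le> ?e t * (x \<bullet> (Xinf *v x) + k * (x \<bullet> (X t *v x)))"
      by (simp add: Z_def matrix_vector_distribs inner_add_right inner_diff_right algebra_simps)
    also have "\<dots> \<le> ?e t * (n * (norm x)\<^sup>2 + k * (n * (norm x)\<^sup>2))"
      using n2[of x] le[OF t, of x] k1 by (intro mult_left_mono add_mono) auto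
    finally show ?thesis by (simp add: algebra_simps)
  qed
  show "expconv X Xinf"
  proof (rule expconvI[OF \<nu>(1), of _ _ "?d * ((1 + k) * n)"])
    fix s :: real assume s: "s \<ge> 0"
    have "norm (Xinf - X s) \<le> ?d * ((1 + k) * n * ?e s)"
      using up[OF s] le[OF s] symX[OF s] symXinf
      by (intro psd_norm_le) (auto simp: transpose_distribs matrix_vector_distribs inner_diff_right)
    then show "norm (X s - Xinf) \<le> ?d * ((1 + k) * n) * ?e s"
      by (simp add: norm_minus_commute algebra_simps)
  qed
qed

end


section \<open>Kernels as functions\<close>

interpretation unitI: finite_measure unitI
  by (rule finite_measure_lebesgue_on) simp

interpretation unitI2: pair_sigma_finite unitI unitI
  by unfold_locales

section \<open>Calculus of square-integrable functions and of their sections\<close>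

lemma L2_measurable: "f \<in> L2 M \<Longrightarrow> f \<in> borel_measurable M"
  by (simp add: L2_def)

lemma L2_integrable: "f \<in> L2 M \<Longrightarrow> integrable M (\<lambda>x. (norm (f x))\<^sup>2)"
  by (simp add: L2_def)

lemma L2_integrable_prod:
  assumes f: "f \<in> L2 M" and g: "g \<in> L2 M"
  shows "integrable M (\<lambda>x. norm (f x) * norm (g x))"
proof (rule Bochner_Integration.integrable_bound)
  show "integrable M (\<lambda>x. (norm (f x))\<^sup>2 + (norm (g x))\<^sup>2)"
    by (intro Bochner_Integration.integrable_add L2_integrable f g)
  show "(\<lambda>x. norm (f x) * norm (g x)) \<in> borel_measurable M"
    using L2_measurable[OF f, measurable] L2_measurable[OF g, measurable] by measurable
  show "AE x in M. norm (norm (f x) * norm (g x)) \<le> norm ((norm (f x))\<^sup>2 + (norm (g x))\<^sup>2)"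
  proof (rule AE_I2)
    fix x
    have "2 * (norm (f x) * norm (g x)) \<le> (norm (f x))\<^sup>2 + (norm (g x))\<^sup>2"
      using sum_squares_bound[of "norm (f x)" "norm (g x)"] by (simp add: mult.assoc)
    moreover have "0 \<le> norm (f x) * norm (g x)" by simp
    ultimately have "norm (f x) * norm (g x) \<le> (norm (f x))\<^sup>2 + (norm (g x))\<^sup>2" by linarith
    then show "norm (norm (f x) * norm (g x)) \<le> norm ((norm (f x))\<^sup>2 + (norm (g x))\<^sup>2)" by simp
  qed
qed

lemma L2_bilinear_measurable:
  fixes f :: "'x \<Rightarrow> 'a::euclidean_space" and g :: "'x \<Rightarrow> 'b::euclidean_space"
    and h :: "'a \<Rightarrow> 'b \<Rightarrow> 'c::euclidean_space"
  assumes h: "bounded_bilinear h"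
    and [measurable]: "f \<in> borel_measurable M" "g \<in> borel_measurable M"
  shows "(\<lambda>x. h (f x) (g x)) \<in> borel_measurable M"
proof -
  have "continuous_on UNIV (\<lambda>x. h (fst x) (snd x))"
    by (rule bounded_bilinear.continuous_on[OF h continuous_on_fst[OF continuous_on_id] continuous_on_snd[OF continuous_on_id]])
  then show ?thesis
    by (rule borel_measurable_continuous_Pair[OF assms(2,3)])
qed

lemma L2_integrable_bilinear:
  fixes f :: "'x \<Rightarrow> 'a::euclidean_space" and g :: "'x \<Rightarrow> 'b::euclidean_space"
    and h :: "'a \<Rightarrow> 'b \<Rightarrow> 'c::euclidean_space"
  assumes h: "bounded_bilinear h" and f: "f \<in> L2 M" and g: "g \<in> L2 M"
  shows "integrable M (\<lambda>x. h (f x) (g x))"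
proof -
  obtain K where K: "\<And>a b. norm (h a b) \<le> norm a * norm b * K" "K > 0"
    using bounded_bilinear.pos_bounded[OF h] by blast
  show ?thesis
  proof (rule Bochner_Integration.integrable_bound)
    show "integrable M (\<lambda>x. norm (f x) * norm (g x) * K)"
      by (intro integrable_mult_left L2_integrable_prod f g)
    show "(\<lambda>x. h (f x) (g x)) \<in> borel_measurable M"
      by (rule L2_bilinear_measurable[OF h L2_measurable[OF f] L2_measurable[OF g]])
    show "AE x in M. norm (h (f x) (g x)) \<le> norm (norm (f x) * norm (g x) * K)"
      using K by (auto intro!: AE_I2 simp: abs_mult)
  qed
qed

lemmas L2_integrable_inner = L2_integrable_bilinear[OF bounded_bilinear_inner]
lemmas L2_integrable_mult = L2_integrable_bilinear[OF bounded_bilinear_matrix_mult]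
lemmas L2_integrable_mult_vec = L2_integrable_bilinear[OF bounded_bilinear_matrix_vector_mult]

lemma L2_bound:
  assumes f: "f \<in> borel_measurable M" and g: "g \<in> L2 M" and K: "\<And>x. norm (f x) \<le> K * norm (g x)"
  shows "f \<in> L2 M"
proof -
  have "integrable M (\<lambda>x. (norm (f x))\<^sup>2)"
  proof (rule Bochner_Integration.integrable_bound)
    show "integrable M (\<lambda>x. K\<^sup>2 * (norm (g x))\<^sup>2)"
      by (intro integrable_mult_right L2_integrable g)
    show "AE x in M. norm ((norm (f x))\<^sup>2) \<le> norm (K\<^sup>2 * (norm (g x))\<^sup>2)"
      using power_mono[OF K norm_ge_zero, of _ 2] by (auto intro!: AE_I2 simp: power_mult_distrib)
  qed (use f[measurable] in measurable)
  then show ?thesis using f by (simp add: L2_def)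
qed

lemma L2_linear:
  fixes h :: "'a::euclidean_space \<Rightarrow> 'b::euclidean_space"
  assumes h: "bounded_linear h" and f: "f \<in> L2 M"
  shows "(\<lambda>x. h (f x)) \<in> L2 M"
proof -
  obtain K where K: "\<And>a. norm (h a) \<le> norm a * K"
    using bounded_linear.bounded[OF h] by blast
  have "h \<in> borel_measurable borel"
    by (intro borel_measurable_continuous_onI linear_continuous_on h)
  then have "(\<lambda>x. h (f x)) \<in> borel_measurable M"
    by (rule measurable_compose[OF L2_measurable[OF f]])
  then show ?thesis
    by (rule L2_bound[OF _ f, of _ K]) (use K in \<open>simp add: mult.commute\<close>)
qed

lemma L2_zero: "(\<lambda>x. 0) \<in> L2 M"
  by (simp add: L2_def)

lemma L2_add:
  assumes f: "f \<in> L2 M" and g: "g \<in> L2 M"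
  shows "(\<lambda>x. f x + g x) \<in> L2 M"
proof -
  have m: "(\<lambda>x. f x + g x) \<in> borel_measurable M"
    using L2_measurable[OF f, measurable] L2_measurable[OF g, measurable] by measurable
  have "(norm (f x + g x))\<^sup>2 = (norm (f x))\<^sup>2 + 2 * (f x \<bullet> g x) + (norm (g x))\<^sup>2" for x
    by (simp add: power2_norm_eq_inner inner_add_left inner_add_right inner_commute)
  moreover have "integrable M (\<lambda>x. (norm (f x))\<^sup>2 + 2 * (f x \<bullet> g x) + (norm (g x))\<^sup>2)"
    by (intro Bochner_Integration.integrable_add integrable_mult_right L2_integrable L2_integrable_inner f g)
  ultimately show ?thesis using m by (simp add: L2_def)
qed

lemma L2_scaleR: "f \<in> L2 M \<Longrightarrow> (\<lambda>x. r *\<^sub>R f x) \<in> L2 M"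
  by (rule L2_linear[OF bounded_linear_scaleR_right])

lemma L2_minus: "f \<in> L2 M \<Longrightarrow> (\<lambda>x. - f x) \<in> L2 M"
  by (rule L2_linear[OF bounded_linear_minus[OF bounded_linear_ident]])

lemma L2_diff: "f \<in> L2 M \<Longrightarrow> g \<in> L2 M \<Longrightarrow> (\<lambda>x. f x - g x) \<in> L2 M"
  using L2_add[of f M "\<lambda>x. - g x"] L2_minus[of g M] by simp

lemma nn_integral_L2_finite:
  fixes f :: "'x \<Rightarrow> 'a::euclidean_space"
  assumes "f \<in> borel_measurable M"
  shows "f \<in> L2 M \<longleftrightarrow> (\<integral>\<^sup>+ x. ennreal ((norm (f x))\<^sup>2) \<partial>M) < \<infinity>"
  using assms by (simp add: L2_def integrable_iff_bounded)

lemma AE_fst: "AE u in unitI. P u \<Longrightarrow> AE z in unitI2. P (fst z)"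
proof -
  assume "AE u in unitI. P u"
  then obtain N where N: "N \<in> null_sets unitI" "{x\<in>space unitI. \<not> P x} \<subseteq> N"
    unfolding eventually_ae_filter by auto
  have "N \<times> space unitI \<in> null_sets unitI2"
    using N(1) by (intro null_setsI) (simp_all add: unitI.emeasure_pair_measure_Times null_setsD1 null_setsD2 del: space_lebesgue_on)
  then show ?thesis
    by (rule AE_I') (use N in \<open>auto simp: space_pair_measure\<close>)
qed

lemma AE_snd: "AE u in unitI. P u \<Longrightarrow> AE z in unitI2. P (snd z)"
proof -
  assume "AE u in unitI. P u"
  then obtain N where N: "N \<in> null_sets unitI" "{x\<in>space unitI. \<not> P x} \<subseteq> N"
    unfolding eventually_ae_filter by auto
  have "space unitI \<times> N \<in> null_sets unitI2"
    using N(1) by (intro null_setsI) (simp_all add: unitI.emeasure_pair_measure_Times null_setsD1 null_setsD2 del: space_lebesgue_on)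
  then show ?thesis
    by (rule AE_I') (use N in \<open>auto simp: space_pair_measure\<close>)
qed

lemma AE_swap: "AE z in unitI2. P z \<Longrightarrow> AE z in unitI2. P (snd z, fst z)"
proof -
  assume "AE z in unitI2. P z"
  then have "AE z in distr unitI2 unitI2 (\<lambda>(x, y). (y, x)). P z"
    using unitI2.distr_pair_swap by metis
  from AE_distrD[OF measurable_pair_swap' this] show ?thesis
    by (simp add: case_prod_beta')
qed

lemma L2_section_fst:
  assumes f: "f \<in> L2 unitI2"
  shows "AE u in unitI. (\<lambda>w. f (u, w)) \<in> L2 unitI"
proof -
  have "AE u in unitI. integrable unitI (\<lambda>w. (norm (f (u, w)))\<^sup>2)"
    by (rule unitI2.AE_integrable_fst'[OF L2_integrable[OF f]])
  then show ?thesis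
    using AE_space
  proof eventually_elim
    case (elim u)
    then show ?case
      using measurable_compose[OF measurable_Pair1'[OF elim(2)] L2_measurable[OF f]] by (simp add: L2_def)
  qed
qed

lemma L2_swap:
  assumes f: "f \<in> L2 unitI2"
  shows "(\<lambda>z. f (snd z, fst z)) \<in> L2 unitI2"
proof -
  have "(\<lambda>z. f (snd z, fst z)) \<in> borel_measurable unitI2"
    using measurable_compose[OF measurable_pair_swap' L2_measurable[OF f]] by (simp add: case_prod_beta')
  moreover have "integrable unitI2 (\<lambda>z. (norm (f (snd z, fst z)))\<^sup>2)"
    using unitI2.integrable_product_swap[OF L2_integrable[OF f]] by (simp add: case_prod_beta')
  ultimately show ?thesis by (simp add: L2_def)
qed

lemma L2_section_snd:
  assumes f: "f \<in> L2 unitI2"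
  shows "AE v in unitI. (\<lambda>w. f (w, v)) \<in> L2 unitI"
  using L2_section_fst[OF L2_swap[OF f]] by simp

lemma L2_tensor:
  fixes a b :: "real \<Rightarrow> 'a::euclidean_space"
  assumes a: "a \<in> L2 unitI" and b: "b \<in> L2 unitI"
  shows "(\<lambda>z. norm (a (fst z)) * norm (b (snd z))) \<in> L2 unitI2"
proof -
  note [measurable] = L2_measurable[OF a] L2_measurable[OF b]
  have m: "(\<lambda>z. norm (a (fst z)) * norm (b (snd z))) \<in> borel_measurable unitI2"
    by measurable
  have na: "(\<integral>\<^sup>+ u. ennreal ((norm (a u))\<^sup>2) \<partial>unitI) < \<infinity>"
    using nn_integral_L2_finite[of a unitI] L2_measurable[OF a] a by blast
  have nb: "(\<integral>\<^sup>+ u. ennreal ((norm (b u))\<^sup>2) \<partial>unitI) < \<infinity>"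
    using nn_integral_L2_finite[of b unitI] L2_measurable[OF b] b by blast
  have "(\<integral>\<^sup>+ z. ennreal ((norm (norm (a (fst z)) * norm (b (snd z))))\<^sup>2) \<partial>unitI2)
      = (\<integral>\<^sup>+ z. ennreal ((norm (a (fst z)))\<^sup>2) * ennreal ((norm (b (snd z)))\<^sup>2) \<partial>unitI2)"
    by (simp add: power_mult_distrib ennreal_mult)
  also have "\<dots> = (\<integral>\<^sup>+ u. \<integral>\<^sup>+ v. ennreal ((norm (a u))\<^sup>2) * ennreal ((norm (b v))\<^sup>2) \<partial>unitI \<partial>unitI)"
    by (subst unitI.nn_integral_fst[symmetric]) simp_all
  also have "\<dots> = (\<integral>\<^sup>+ u. ennreal ((norm (a u))\<^sup>2) \<partial>unitI) * (\<integral>\<^sup>+ v. ennreal ((norm (b v))\<^sup>2) \<partial>unitI)"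
    by (simp add: nn_integral_cmult nn_integral_multc)
  also have "\<dots> < \<infinity>" using na nb by (simp add: ennreal_mult_less_top)
  finally show ?thesis using nn_integral_L2_finite[OF m] by blast
qed

section \<open>Composition and adjoint of integral operators, on the level of kernels\<close>

definition kcomp :: "(real \<times> real \<Rightarrow> real^'b^'a) \<Rightarrow> (real \<times> real \<Rightarrow> real^'c^'b) \<Rightarrow> real \<times> real \<Rightarrow> real^'c^'a"
  where "kcomp f g = (\<lambda>(u, v). \<integral>w. f (u, w) ** g (w, v) \<partial>unitI)"

definition kadj :: "(real \<times> real \<Rightarrow> real^'b^'a) \<Rightarrow> real \<times> real \<Rightarrow> real^'a^'b"
  where "kadj f = (\<lambda>(u, v). transpose (f (v, u)))"

lemma kadj_L2: "f \<in> L2 unitI2 \<Longrightarrow> kadj f \<in> L2 unitI2"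
  using L2_linear[OF bounded_linear_transpose L2_swap[of f]] by (simp add: kadj_def case_prod_beta')

lemma kcomp_measurable:
  assumes f: "f \<in> borel_measurable unitI2" and g: "g \<in> borel_measurable unitI2"
  shows "kcomp f g \<in> borel_measurable unitI2"
proof -
  have 1: "(\<lambda>p. f (fst (fst p), snd p)) \<in> borel_measurable (unitI2 \<Otimes>\<^sub>M unitI)"
    by (rule measurable_compose[OF _ f]) measurable
  have 2: "(\<lambda>p. g (snd p, snd (fst p))) \<in> borel_measurable (unitI2 \<Otimes>\<^sub>M unitI)"
    by (rule measurable_compose[OF _ g]) measurable
  have "(\<lambda>p. f (fst (fst p), snd p) ** g (snd p, snd (fst p))) \<in> borel_measurable (unitI2 \<Otimes>\<^sub>M unitI)"
    by (rule L2_bilinear_measurable[OF bounded_bilinear_matrix_mult 1 2])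
  then have "(\<lambda>(z, w). f (fst z, w) ** g (w, snd z)) \<in> borel_measurable (unitI2 \<Otimes>\<^sub>M unitI)"
    by (simp add: case_prod_beta')
  from unitI.borel_measurable_lebesgue_integral[OF this] show ?thesis
    by (simp add: kcomp_def case_prod_beta')
qed

text \<open>The Hilbert-Schmidt bound, stated in \<open>ennreal\<close> because square integrability
  of the composition is to follow from it. Cauchy-Schwarz in \<open>w\<close> bounds the square at
  \<open>(u, v)\<close> by a function of \<open>u\<close> times a function of \<open>v\<close>, and
  Tonelli separates the two.\<close>

lemma kcomp_nn_bound:
  fixes f :: "real \<times> real \<Rightarrow> real^'b^'a" and g :: "real \<times> real \<Rightarrow> real^'c^'b"
  assumes f: "f \<in> borel_measurable unitI2" and g: "g \<in> borel_measurable unitI2"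
  shows "(\<integral>\<^sup>+ z. ennreal ((norm (kcomp f g z))\<^sup>2) \<partial>unitI2)
    \<le> (\<integral>\<^sup>+ z. ennreal ((norm (f z))\<^sup>2) \<partial>unitI2) * (\<integral>\<^sup>+ z. ennreal ((norm (g z))\<^sup>2) \<partial>unitI2)"
proof -
  note [measurable] = f g kcomp_measurable[OF f g]
  have pt: "ennreal ((norm (kcomp f g (u, v)))\<^sup>2)
      \<le> (\<integral>\<^sup>+ w. ennreal ((norm (f (u, w)))\<^sup>2) \<partial>unitI) * (\<integral>\<^sup>+ w. ennreal ((norm (g (w, v)))\<^sup>2) \<partial>unitI)"
    if u: "u \<in> space unitI" and v: "v \<in> space unitI" for u v
  proof -
    have fu: "(\<lambda>w. f (u, w)) \<in> borel_measurable unitI"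
      by (rule measurable_compose[OF measurable_Pair1'[OF u] f])
    have gv: "(\<lambda>w. g (w, v)) \<in> borel_measurable unitI"
      by (rule measurable_compose[OF measurable_Pair2'[OF v] g])
    have "ennreal (norm (kcomp f g (u, v))) \<le> (\<integral>\<^sup>+ w. ennreal (norm (f (u, w) ** g (w, v))) \<partial>unitI)"
    proof (cases "integrable unitI (\<lambda>w. f (u, w) ** g (w, v))")
      case True
      then show ?thesis unfolding kcomp_def by (simp add: integral_norm_bound_ennreal)
    next
      \<comment> \<open>Without integrability the integral has the default value 0, for which the
        bound is trivial.\<close>
      case False
      then show ?thesis unfolding kcomp_def by (simp add: not_integrable_integral_eq)
    qed
    also have "\<dots> \<le> (\<integral>\<^sup>+ w. ennreal (norm (f (u, w))) * ennreal (norm (g (w, v))) \<partial>unitI)"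
      by (intro nn_integral_mono) (simp add: norm_matrix_mult_le ennreal_mult[symmetric])
    finally have "(ennreal (norm (kcomp f g (u, v))))\<^sup>2
        \<le> (\<integral>\<^sup>+ w. ennreal (norm (f (u, w))) * ennreal (norm (g (w, v))) \<partial>unitI)\<^sup>2"
      by (rule power_mono) simp
    also have "\<dots> \<le> (\<integral>\<^sup>+ w. (ennreal (norm (f (u, w))))\<^sup>2 \<partial>unitI) * (\<integral>\<^sup>+ w. (ennreal (norm (g (w, v))))\<^sup>2 \<partial>unitI)"
      using fu gv by (intro Cauchy_Schwarz_nn_integral) simp_all
    finally show ?thesis by (simp add: ennreal_power)
  qed
  define F where "F u = (\<integral>\<^sup>+ w. ennreal ((norm (f (u, w)))\<^sup>2) \<partial>unitI)" for u
  define G where "G v = (\<integral>\<^sup>+ w. ennreal ((norm (g (w, v)))\<^sup>2) \<partial>unitI)" for v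
  have mf: "(\<lambda>z. ennreal ((norm (f z))\<^sup>2)) \<in> borel_measurable unitI2" by measurable
  have mg: "(\<lambda>z. ennreal ((norm (g z))\<^sup>2)) \<in> borel_measurable unitI2" by measurable
  have mF: "F \<in> borel_measurable unitI"
    unfolding F_def by (rule unitI.borel_measurable_nn_integral_fst[OF mf])
  have mg': "(\<lambda>z. ennreal ((norm (g (snd z, fst z)))\<^sup>2)) \<in> borel_measurable unitI2"
    using measurable_compose[OF measurable_pair_swap' mg] by (simp add: case_prod_beta')
  have mG: "G \<in> borel_measurable unitI"
    unfolding G_def using unitI.borel_measurable_nn_integral_fst[OF mg'] by simp
  have iF: "(\<integral>\<^sup>+ u. F u \<partial>unitI) = (\<integral>\<^sup>+ z. ennreal ((norm (f z))\<^sup>2) \<partial>unitI2)"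
    unfolding F_def by (rule unitI.nn_integral_fst[OF mf])
  have iG: "(\<integral>\<^sup>+ v. G v \<partial>unitI) = (\<integral>\<^sup>+ z. ennreal ((norm (g z))\<^sup>2) \<partial>unitI2)"
    unfolding G_def by (rule unitI2.nn_integral_snd[OF mg])
  have "(\<integral>\<^sup>+ z. ennreal ((norm (kcomp f g z))\<^sup>2) \<partial>unitI2)
      = (\<integral>\<^sup>+ u. \<integral>\<^sup>+ v. ennreal ((norm (kcomp f g (u, v)))\<^sup>2) \<partial>unitI \<partial>unitI)"
    by (rule unitI.nn_integral_fst[symmetric]) measurable
  also have "\<dots> \<le> (\<integral>\<^sup>+ u. \<integral>\<^sup>+ v. F u * G v \<partial>unitI \<partial>unitI)"
    using pt unfolding F_def G_def by (intro nn_integral_mono) blast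
  also have "\<dots> = (\<integral>\<^sup>+ u. F u * (\<integral>\<^sup>+ v. G v \<partial>unitI) \<partial>unitI)"
    by (simp add: nn_integral_cmult mG)
  also have "\<dots> = (\<integral>\<^sup>+ u. F u \<partial>unitI) * (\<integral>\<^sup>+ v. G v \<partial>unitI)"
    by (rule nn_integral_multc[OF mF])
  finally show ?thesis by (simp only: iF iG)
qed

lemma kcomp_L2:
  assumes f: "f \<in> L2 unitI2" and g: "g \<in> L2 unitI2"
  shows "kcomp f g \<in> L2 unitI2"
proof -
  note mf = L2_measurable[OF f] and mg = L2_measurable[OF g]
  have "(\<integral>\<^sup>+ z. ennreal ((norm (f z))\<^sup>2) \<partial>unitI2) < \<infinity>" "(\<integral>\<^sup>+ z. ennreal ((norm (g z))\<^sup>2) \<partial>unitI2) < \<infinity>"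
    using nn_integral_L2_finite[OF mf] nn_integral_L2_finite[OF mg] f g by auto
  then have "(\<integral>\<^sup>+ z. ennreal ((norm (f z))\<^sup>2) \<partial>unitI2) * (\<integral>\<^sup>+ z. ennreal ((norm (g z))\<^sup>2) \<partial>unitI2) < \<infinity>"
    by (simp add: ennreal_mult_less_top)
  then have "(\<integral>\<^sup>+ z. ennreal ((norm (kcomp f g z))\<^sup>2) \<partial>unitI2) < \<infinity>"
    using kcomp_nn_bound[OF mf mg] by (rule order.strict_trans1[rotated])
  then show ?thesis using nn_integral_L2_finite[OF kcomp_measurable[OF mf mg]] by blast
qed

lemma kcomp_norm:
  assumes f: "f \<in> L2 unitI2" and g: "g \<in> L2 unitI2"
  shows "(\<integral>z. (norm (kcomp f g z))\<^sup>2 \<partial>unitI2) \<le> (\<integral>z. (norm (f z))\<^sup>2 \<partial>unitI2) * (\<integral>z. (norm (g z))\<^sup>2 \<partial>unitI2)"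
proof -
  have e: "(\<integral>\<^sup>+ z. ennreal ((norm (h z))\<^sup>2) \<partial>unitI2) = ennreal (\<integral>z. (norm (h z))\<^sup>2 \<partial>unitI2)"
    if "h \<in> L2 unitI2" for h :: "real \<times> real \<Rightarrow> real^'y^'x"
    by (rule nn_integral_eq_integral[OF L2_integrable[OF that]]) simp
  have "ennreal (\<integral>z. (norm (kcomp f g z))\<^sup>2 \<partial>unitI2)
      \<le> ennreal ((\<integral>z. (norm (f z))\<^sup>2 \<partial>unitI2) * (\<integral>z. (norm (g z))\<^sup>2 \<partial>unitI2))"
    using kcomp_nn_bound[OF L2_measurable[OF f] L2_measurable[OF g]]
    unfolding e[OF f] e[OF g] e[OF kcomp_L2[OF f g]] by (simp add: ennreal_mult)
  then show ?thesis by (subst (asm) ennreal_le_iff) simp_all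
qed

text \<open>Outside a null set of pairs both sections are square integrable, so the integral
  defining \<open>kcomp\<close> converges there. This is what justifies the algebra of
  \<open>kcomp\<close> almost everywhere.\<close>

lemma kcomp_sections:
  assumes f: "f \<in> L2 unitI2" and g: "g \<in> L2 unitI2"
  shows "AE z in unitI2. (\<lambda>w. f (fst z, w)) \<in> L2 unitI \<and> (\<lambda>w. g (w, snd z)) \<in> L2 unitI"
  using AE_fst[OF L2_section_fst[OF f]] AE_snd[OF L2_section_snd[OF g]] by eventually_elim simp

lemma kcomp_cong:
  assumes f: "f \<in> L2 unitI2" "f' \<in> L2 unitI2" "AE z in unitI2. f z = f' z"
    and g: "g \<in> L2 unitI2" "g' \<in> L2 unitI2" "AE z in unitI2. g z = g' z"
  shows "AE z in unitI2. kcomp f g z = kcomp f' g' z"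
proof -
  have 1: "AE u in unitI. AE w in unitI. f (u, w) = f' (u, w)"
    by (rule unitI2.AE_pair[OF f(3)])
  have 2: "AE v in unitI. AE w in unitI. g (w, v) = g' (w, v)"
    using unitI2.AE_pair[OF AE_swap[OF g(3)]] by simp
  show ?thesis
    using AE_fst[OF 1] AE_snd[OF 2] kcomp_sections[OF f(1) g(1)] kcomp_sections[OF f(2) g(2)]
  proof eventually_elim
    case (elim z)
    have "(\<integral>w. f (fst z, w) ** g (w, snd z) \<partial>unitI) = (\<integral>w. f' (fst z, w) ** g' (w, snd z) \<partial>unitI)"
    proof (rule integral_cong_AE)
      show "(\<lambda>w. f (fst z, w) ** g (w, snd z)) \<in> borel_measurable unitI"
        using elim L2_integrable_mult borel_measurable_integrable by blast
      show "(\<lambda>w. f' (fst z, w) ** g' (w, snd z)) \<in> borel_measurable unitI"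
        using elim L2_integrable_mult borel_measurable_integrable by blast
      show "AE w in unitI. f (fst z, w) ** g (w, snd z) = f' (fst z, w) ** g' (w, snd z)"
        using elim(1,2) by eventually_elim simp
    qed
    then show ?case by (simp add: kcomp_def case_prod_beta')
  qed
qed

lemma kcomp_add_left:
  assumes f: "f \<in> L2 unitI2" and f': "f' \<in> L2 unitI2" and g: "g \<in> L2 unitI2"
  shows "AE z in unitI2. kcomp (\<lambda>z. f z + f' z) g z = kcomp f g z + kcomp f' g z"
  using kcomp_sections[OF f g] kcomp_sections[OF f' g]
proof eventually_elim
  case (elim z)
  have i: "integrable unitI (\<lambda>w. f (fst z, w) ** g (w, snd z))" "integrable unitI (\<lambda>w. f' (fst z, w) ** g (w, snd z))"
    using elim L2_integrable_mult by blast+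
  show ?case
    unfolding kcomp_def case_prod_beta' matrix_distribs by (rule Bochner_Integration.integral_add[OF i])
qed

lemma kcomp_add_right:
  assumes f: "f \<in> L2 unitI2" and g: "g \<in> L2 unitI2" and g': "g' \<in> L2 unitI2"
  shows "AE z in unitI2. kcomp f (\<lambda>z. g z + g' z) z = kcomp f g z + kcomp f g' z"
  using kcomp_sections[OF f g] kcomp_sections[OF f g']
proof eventually_elim
  case (elim z)
  have i: "integrable unitI (\<lambda>w. f (fst z, w) ** g (w, snd z))" "integrable unitI (\<lambda>w. f (fst z, w) ** g' (w, snd z))"
    using elim L2_integrable_mult by blast+
  show ?case
    unfolding kcomp_def case_prod_beta' matrix_distribs by (rule Bochner_Integration.integral_add[OF i])
qed

lemma kcomp_scaleR:
  "kcomp (\<lambda>z. r *\<^sub>R f z) g z = r *\<^sub>R kcomp f g z"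
  "kcomp f (\<lambda>z. r *\<^sub>R g z) z = r *\<^sub>R kcomp f g z"
  by (simp_all add: kcomp_def case_prod_beta matrix_distribs)

lemma inner_matrix_mult_left:
  fixes A :: "real^'b^'a" and B :: "real^'c^'b"
  shows "(A ** B) \<bullet> C = B \<bullet> (transpose A ** C)"
proof -
  have "(A ** B) \<bullet> C = (\<Sum>i\<in>UNIV. \<Sum>j\<in>UNIV. \<Sum>k\<in>UNIV. A $ i $ k * B $ k $ j * C $ i $ j)"
    by (simp add: inner_vec_def matrix_matrix_mult_def sum_distrib_right)
  also have "\<dots> = (\<Sum>i\<in>UNIV. \<Sum>k\<in>UNIV. \<Sum>j\<in>UNIV. A $ i $ k * B $ k $ j * C $ i $ j)"
    by (intro sum.cong refl sum.swap)
  also have "\<dots> = (\<Sum>k\<in>UNIV. \<Sum>i\<in>UNIV. \<Sum>j\<in>UNIV. A $ i $ k * B $ k $ j * C $ i $ j)"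
    by (rule sum.swap)
  also have "\<dots> = (\<Sum>k\<in>UNIV. \<Sum>j\<in>UNIV. \<Sum>i\<in>UNIV. A $ i $ k * B $ k $ j * C $ i $ j)"
    by (intro sum.cong refl sum.swap)
  also have "\<dots> = B \<bullet> (transpose A ** C)"
    by (simp add: inner_vec_def matrix_matrix_mult_def transpose_def sum_distrib_left algebra_simps)
  finally show ?thesis .
qed

text \<open>The product of a function of the first and one of the second variable is square
  integrable over the square, so it can be paired with \<open>k\<close> by Cauchy-Schwarz. The
  result is the dominating function for the exchanges of integrals below.\<close>

lemma triple_integrable:
  fixes a :: "real \<Rightarrow> 'a::euclidean_space" and b :: "real \<Rightarrow> 'b::euclidean_space"
    and k :: "real \<times> real \<Rightarrow> 'c::euclidean_space" and h :: "real \<times> real \<Rightarrow> 'd::{banach, second_countable_topology}"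
  assumes a: "a \<in> L2 unitI" and b: "b \<in> L2 unitI" and k: "k \<in> L2 unitI2"
    and h: "h \<in> borel_measurable unitI2"
    and bound: "\<And>z. norm (h z) \<le> norm (a (fst z)) * norm (b (snd z)) * norm (k z)"
  shows "integrable unitI2 h"
proof (rule Bochner_Integration.integrable_bound)
  have 1: "(\<lambda>x. norm (a x)) \<in> L2 unitI" "(\<lambda>x. norm (b x)) \<in> L2 unitI"
    by (rule L2_bound[OF measurable_compose[OF L2_measurable[OF a] borel_measurable_norm] a, of 1], simp)
      (rule L2_bound[OF measurable_compose[OF L2_measurable[OF b] borel_measurable_norm] b, of 1], simp)
  show "integrable unitI2 (\<lambda>z. norm (norm (norm (a (fst z))) * norm (norm (b (snd z)))) * norm (k z))"
    by (rule L2_integrable_prod[OF L2_tensor[OF 1] k])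
  show "AE x in unitI2. norm (h x) \<le> norm (norm (norm (norm (a (fst x))) * norm (norm (b (snd x)))) * norm (k x))"
    using bound by (auto intro!: AE_I2 simp: abs_mult)
qed (rule h)

text \<open>Fubini with the second variable \<open>v\<close> held fixed: the integrals over
  \<open>u\<close> and \<open>w\<close> are exchanged, justified by
  \<open>triple_integrable\<close>, and only then is \<open>v\<close> integrated out.\<close>

lemma kcomp_inner_adj:
  fixes k :: "real \<times> real \<Rightarrow> real^'b^'a" and l :: "real \<times> real \<Rightarrow> real^'c^'b"
  assumes k: "k \<in> L2 unitI2" and l: "l \<in> L2 unitI2" and m: "m \<in> L2 unitI2"
  shows "(\<integral>z. kcomp k l z \<bullet> m z \<partial>unitI2) = (\<integral>z. l z \<bullet> kcomp (kadj k) m z \<partial>unitI2)"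
proof -
  have i1: "integrable unitI2 (\<lambda>(u, v). kcomp k l (u, v) \<bullet> m (u, v))"
    using L2_integrable_inner[OF kcomp_L2[OF k l] m] by (simp add: case_prod_beta')
  have i2: "integrable unitI2 (\<lambda>(w, v). l (w, v) \<bullet> kcomp (kadj k) m (w, v))"
    using L2_integrable_inner[OF l kcomp_L2[OF kadj_L2[OF k] m]] by (simp add: case_prod_beta')
  have ks: "AE u in unitI. (\<lambda>w. k (u, w)) \<in> L2 unitI" "AE w in unitI. (\<lambda>u. k (u, w)) \<in> L2 unitI"
    by (rule L2_section_fst[OF k], rule L2_section_snd[OF k])
  have e: "AE v in unitI. (\<integral>u. kcomp k l (u, v) \<bullet> m (u, v) \<partial>unitI) = (\<integral>w. l (w, v) \<bullet> kcomp (kadj k) m (w, v) \<partial>unitI)"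
    using L2_section_snd[OF l] L2_section_snd[OF m] AE_space
  proof eventually_elim
    case (elim v)
    define h where "h u w = (k (u, w) ** l (w, v)) \<bullet> m (u, v)" for u w
    have mk: "(\<lambda>z. k z ** l (snd z, v)) \<in> borel_measurable unitI2"
      by (rule L2_bilinear_measurable[OF bounded_bilinear_matrix_mult L2_measurable[OF k]
            measurable_compose[OF measurable_snd L2_measurable[OF elim(1)]]])
    have "(\<lambda>z. (k z ** l (snd z, v)) \<bullet> m (fst z, v)) \<in> borel_measurable unitI2"
      by (rule L2_bilinear_measurable[OF bounded_bilinear_inner mk
            measurable_compose[OF measurable_fst L2_measurable[OF elim(2)]]])
    then have int: "integrable unitI2 (\<lambda>z. (k z ** l (snd z, v)) \<bullet> m (fst z, v))"
    proof (rule triple_integrable[OF elim(2) elim(1) k])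
      fix z
      have "norm ((k z ** l (snd z, v)) \<bullet> m (fst z, v)) \<le> norm (k z ** l (snd z, v)) * norm (m (fst z, v))"
        by (simp add: Cauchy_Schwarz_ineq2)
      also have "\<dots> \<le> (norm (k z) * norm (l (snd z, v))) * norm (m (fst z, v))"
        by (intro mult_right_mono norm_matrix_mult_le) simp
      finally show "norm ((k z ** l (snd z, v)) \<bullet> m (fst z, v))
          \<le> norm (m (fst z, v)) * norm (l (snd z, v)) * norm (k z)" by (simp add: ac_simps)
    qed
    then have int': "integrable unitI2 (case_prod h)"
      by (simp add: h_def case_prod_beta')
    have "(\<integral>u. kcomp k l (u, v) \<bullet> m (u, v) \<partial>unitI) = (\<integral>u. (\<integral>w. h u w \<partial>unitI) \<partial>unitI)"
    proof (rule integral_cong_AE)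
      show "(\<lambda>u. kcomp k l (u, v) \<bullet> m (u, v)) \<in> borel_measurable unitI"
        by (rule measurable_compose[OF measurable_Pair2'[OF \<open>v \<in> space unitI\<close>] borel_measurable_integrable[OF
              L2_integrable_inner[OF kcomp_L2[OF k l] m]]])
      show "(\<lambda>u. \<integral>w. h u w \<partial>unitI) \<in> borel_measurable unitI"
        using borel_measurable_integrable[OF unitI2.integrable_fst'[OF int']] by simp
      show "AE u in unitI. kcomp k l (u, v) \<bullet> m (u, v) = (\<integral>w. h u w \<partial>unitI)"
        using ks(1)
      proof eventually_elim
        case (elim u)
        have "integrable unitI (\<lambda>w. k (u, w) ** l (w, v))"
          by (rule L2_integrable_mult[OF elim \<open>(\<lambda>w. l (w, v)) \<in> L2 unitI\<close>])
        then show ?case by (simp add: h_def kcomp_def)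
      qed
    qed
    also have "\<dots> = (\<integral>w. (\<integral>u. h u w \<partial>unitI) \<partial>unitI)"
      by (rule unitI2.Fubini_integral[OF int', symmetric])
    also have "\<dots> = (\<integral>w. l (w, v) \<bullet> kcomp (kadj k) m (w, v) \<partial>unitI)"
    proof (rule integral_cong_AE)
      show "(\<lambda>w. l (w, v) \<bullet> kcomp (kadj k) m (w, v)) \<in> borel_measurable unitI"
        by (rule measurable_compose[OF measurable_Pair2'[OF \<open>v \<in> space unitI\<close>] borel_measurable_integrable[OF
              L2_integrable_inner[OF l kcomp_L2[OF kadj_L2[OF k] m]]]])
      show "(\<lambda>w. \<integral>u. h u w \<partial>unitI) \<in> borel_measurable unitI"
        by (rule borel_measurable_integrable[OF unitI2.integrable_snd[OF int']])
      show "AE w in unitI. (\<integral>u. h u w \<partial>unitI) = l (w, v) \<bullet> kcomp (kadj k) m (w, v)"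
        using ks(2)
      proof eventually_elim
        case (elim w)
        have "integrable unitI (\<lambda>u. transpose (k (u, w)) ** m (u, v))"
          by (rule L2_integrable_mult[OF L2_linear[OF bounded_linear_transpose elim] \<open>(\<lambda>w. m (w, v)) \<in> L2 unitI\<close>])
        then show ?case by (simp add: h_def kcomp_def kadj_def inner_matrix_mult_left)
      qed
    qed
    finally show ?case .
  qed
  have "(\<integral>z. kcomp k l z \<bullet> m z \<partial>unitI2) = (\<integral>v. \<integral>u. kcomp k l (u, v) \<bullet> m (u, v) \<partial>unitI \<partial>unitI)"
    using unitI2.integral_snd[OF i1] by (simp add: case_prod_beta')
  also have "\<dots> = (\<integral>v. \<integral>w. l (w, v) \<bullet> kcomp (kadj k) m (w, v) \<partial>unitI \<partial>unitI)"
    by (rule integral_cong_AE[OF borel_measurable_integrable[OF unitI2.integrable_snd[OF i1]]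
        borel_measurable_integrable[OF unitI2.integrable_snd[OF i2]] e])
  also have "\<dots> = (\<integral>z. l z \<bullet> kcomp (kadj k) m z \<partial>unitI2)"
    using unitI2.integral_snd[OF i2] by (simp add: case_prod_beta')
  finally show ?thesis .
qed

text \<open>Both sides are iterated integrals of one triple product. Fubini applies at every
  \<open>(u, v)\<close> for which the sections of \<open>k\<close> at \<open>u\<close> and of
  \<open>m\<close> at \<open>v\<close> are square integrable, hence almost everywhere.\<close>

lemma kcomp_assoc:
  fixes k :: "real \<times> real \<Rightarrow> real^'b^'a" and l :: "real \<times> real \<Rightarrow> real^'c^'b" and m :: "real \<times> real \<Rightarrow> real^'d^'c"
  assumes k: "k \<in> L2 unitI2" and l: "l \<in> L2 unitI2" and m: "m \<in> L2 unitI2"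
  shows "AE z in unitI2. kcomp (kcomp k l) m z = kcomp k (kcomp l m) z"
  using AE_fst[OF L2_section_fst[OF k]] AE_snd[OF L2_section_snd[OF m]] AE_space
proof eventually_elim
  case (elim z)
  obtain u v where z: "z = (u, v)" by (cases z)
  have uv: "u \<in> space unitI" "v \<in> space unitI" using elim(3) by (auto simp: z space_pair_measure)
  have ku: "(\<lambda>x. k (u, x)) \<in> L2 unitI" and mv: "(\<lambda>y. m (y, v)) \<in> L2 unitI" using elim by (auto simp: z)
  define h where "h x y = k (u, x) ** l (x, y) ** m (y, v)" for x y
  have mk: "(\<lambda>z. k (u, fst z) ** l z) \<in> borel_measurable unitI2"
    by (rule L2_bilinear_measurable[OF bounded_bilinear_matrix_mult
          measurable_compose[OF measurable_fst L2_measurable[OF ku]] L2_measurable[OF l]])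
  have "(\<lambda>z. k (u, fst z) ** l z ** m (snd z, v)) \<in> borel_measurable unitI2"
    by (rule L2_bilinear_measurable[OF bounded_bilinear_matrix_mult mk
          measurable_compose[OF measurable_snd L2_measurable[OF mv]]])
  then have "integrable unitI2 (\<lambda>z. k (u, fst z) ** l z ** m (snd z, v))"
  proof (rule triple_integrable[OF ku mv l])
    fix z
    have "norm (k (u, fst z) ** l z ** m (snd z, v)) \<le> norm (k (u, fst z) ** l z) * norm (m (snd z, v))"
      by (rule norm_matrix_mult_le)
    also have "\<dots> \<le> (norm (k (u, fst z)) * norm (l z)) * norm (m (snd z, v))"
      by (intro mult_right_mono norm_matrix_mult_le) simp
    finally show "norm (k (u, fst z) ** l z ** m (snd z, v))
        \<le> norm (k (u, fst z)) * norm (m (snd z, v)) * norm (l z)" by (simp add: ac_simps)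
  qed
  then have int: "integrable unitI2 (case_prod h)"
    by (simp add: h_def case_prod_beta')
  have kl: "kcomp k l \<in> L2 unitI2" and lm: "kcomp l m \<in> L2 unitI2" by (rule kcomp_L2[OF k l], rule kcomp_L2[OF l m])
  have "kcomp (kcomp k l) m (u, v) = (\<integral>y. (\<integral>x. h x y \<partial>unitI) \<partial>unitI)"
    unfolding kcomp_def[of "kcomp k l"] case_prod_conv
  proof (rule integral_cong_AE)
    show "(\<lambda>y. kcomp k l (u, y) ** m (y, v)) \<in> borel_measurable unitI"
      by (rule L2_bilinear_measurable[OF bounded_bilinear_matrix_mult
          measurable_compose[OF measurable_Pair1'[OF uv(1)] L2_measurable[OF kl]] L2_measurable[OF mv]])
    show "(\<lambda>y. \<integral>x. h x y \<partial>unitI) \<in> borel_measurable unitI"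
      by (rule borel_measurable_integrable[OF unitI2.integrable_snd[OF int]])
    show "AE y in unitI. kcomp k l (u, y) ** m (y, v) = (\<integral>x. h x y \<partial>unitI)"
      using L2_section_snd[OF l]
    proof eventually_elim
      case (elim y)
      have "integrable unitI (\<lambda>x. k (u, x) ** l (x, y))"
        by (rule L2_integrable_mult[OF ku elim])
      then show ?case
        unfolding h_def kcomp_def case_prod_conv
        by (rule integral_bounded_linear[OF bounded_bilinear.bounded_linear_left[OF bounded_bilinear_matrix_mult], symmetric])
    qed
  qed
  also have "\<dots> = (\<integral>x. (\<integral>y. h x y \<partial>unitI) \<partial>unitI)"
    by (rule unitI2.Fubini_integral[OF int])
  also have "\<dots> = kcomp k (kcomp l m) (u, v)"
    unfolding kcomp_def[of k] case_prod_conv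
  proof (rule integral_cong_AE)
    show "(\<lambda>x. k (u, x) ** kcomp l m (x, v)) \<in> borel_measurable unitI"
      by (rule L2_bilinear_measurable[OF bounded_bilinear_matrix_mult L2_measurable[OF ku]
          measurable_compose[OF measurable_Pair2'[OF uv(2)] L2_measurable[OF lm]]])
    show "(\<lambda>x. \<integral>y. h x y \<partial>unitI) \<in> borel_measurable unitI"
      by (rule borel_measurable_integrable[OF unitI2.integrable_fst[OF int]])
    show "AE x in unitI. (\<integral>y. h x y \<partial>unitI) = k (u, x) ** kcomp l m (x, v)"
      using L2_section_fst[OF l]
    proof eventually_elim
      case (elim x)
      have "integrable unitI (\<lambda>y. l (x, y) ** m (y, v))"
        by (rule L2_integrable_mult[OF elim mv])
      then show ?case
        unfolding h_def kcomp_def case_prod_conv matrix_mul_assoc[symmetric]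
        by (rule integral_bounded_linear[OF bounded_bilinear.bounded_linear_right[OF bounded_bilinear_matrix_mult]])
    qed
  qed
  finally show ?case by (simp add: z)
qed

lemma bounded_linear_column: "bounded_linear (column j :: real^'b^'a \<Rightarrow> real^'a)"
proof -
  have "column j A = A *v axis j 1" for A :: "real^'b^'a" by (simp add: matrix_vector_mul_component column_def matrix_vector_mult_basis)
  then have "column j = (\<lambda>A :: real^'b^'a. A *v axis j 1)" by blast
  then show ?thesis by (simp add: bounded_bilinear.bounded_linear_left[OF bounded_bilinear_matrix_vector_mult])
qed

lemma column_mult: "column j (A ** B) = A *v column j (B :: real^'c^'b)"
  by (simp add: vec_eq_iff column_def matrix_matrix_mult_def matrix_vector_mult_def)

lemma inner_columns: "A \<bullet> B = (\<Sum>j\<in>UNIV. column j A \<bullet> column j (B :: real^'b^'a))"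
  by (simp add: inner_vec_def column_def) (rule sum.swap)

text \<open>Each column of \<open>X(\<cdot>, v)\<close> is an admissible test function for the kernel.\<close>

lemma nonneg_kernel_kcomp:
  fixes k :: "real \<times> real \<Rightarrow> real^'d^'d" and X :: "real \<times> real \<Rightarrow> real^'c^'d"
  assumes k: "k \<in> L2 unitI2" and nn: "nonneg_kernel k" and X: "X \<in> L2 unitI2"
  shows "0 \<le> (\<integral>z. X z \<bullet> kcomp k X z \<partial>unitI2)"
proof -
  have i: "integrable unitI2 (\<lambda>(u, v). X (u, v) \<bullet> kcomp k X (u, v))"
    using L2_integrable_inner[OF X kcomp_L2[OF k X]] by (simp add: case_prod_beta')
  have "AE v in unitI. 0 \<le> (\<integral>u. X (u, v) \<bullet> kcomp k X (u, v) \<partial>unitI)"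
    using L2_section_snd[OF X] AE_space L2_section_snd[OF kcomp_L2[OF k X]]
  proof eventually_elim
    case (elim v)
    define \<phi> where "\<phi> j u = column j (X (u, v))" for j u
    have \<phi>: "\<phi> j \<in> L2 unitI" for j
      unfolding \<phi>_def by (rule L2_linear[OF bounded_linear_column elim(1)])
    have Kc: "(\<lambda>u. column j (kcomp k X (u, v))) \<in> L2 unitI" for j
      by (rule L2_linear[OF bounded_linear_column elim(3)])
    have ij: "integrable unitI (\<lambda>u. \<phi> j u \<bullet> column j (kcomp k X (u, v)))" for j
      by (rule L2_integrable_inner[OF \<phi> Kc])
    have "(\<integral>u. X (u, v) \<bullet> kcomp k X (u, v) \<partial>unitI)
        = (\<Sum>j\<in>UNIV. \<integral>u. \<phi> j u \<bullet> column j (kcomp k X (u, v)) \<partial>unitI)"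
      unfolding inner_columns \<phi>_def[symmetric] by (rule Bochner_Integration.integral_sum[OF ij])
    also have "\<dots> = (\<Sum>j\<in>UNIV. \<integral>u. (\<integral>w. \<phi> j u \<bullet> (k (u, w) *v \<phi> j w) \<partial>unitI) \<partial>unitI)"
    proof (intro sum.cong refl integral_cong_AE)
      fix j
      show "(\<lambda>u. \<phi> j u \<bullet> column j (kcomp k X (u, v))) \<in> borel_measurable unitI"
        by (rule borel_measurable_integrable[OF ij])
      have m1: "(\<lambda>z. k z *v \<phi> j (snd z)) \<in> borel_measurable unitI2"
        by (rule L2_bilinear_measurable[OF bounded_bilinear_matrix_vector_mult L2_measurable[OF k]
              measurable_compose[OF measurable_snd L2_measurable[OF \<phi>]]])
      have "(\<lambda>z. \<phi> j (fst z) \<bullet> (k z *v \<phi> j (snd z))) \<in> borel_measurable unitI2"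
        by (rule L2_bilinear_measurable[OF bounded_bilinear_inner
              measurable_compose[OF measurable_fst L2_measurable[OF \<phi>]] m1])
      then have "(\<lambda>(u, w). \<phi> j u \<bullet> (k (u, w) *v \<phi> j w)) \<in> borel_measurable unitI2"
        by (simp add: case_prod_beta')
      then show "(\<lambda>u. \<integral>w. \<phi> j u \<bullet> (k (u, w) *v \<phi> j w) \<partial>unitI) \<in> borel_measurable unitI"
        by (rule unitI.borel_measurable_lebesgue_integral)
      show "AE u in unitI. \<phi> j u \<bullet> column j (kcomp k X (u, v)) = (\<integral>w. \<phi> j u \<bullet> (k (u, w) *v \<phi> j w) \<partial>unitI)"
        using L2_section_fst[OF k]
      proof eventually_elim
        case (elim u)
        have "integrable unitI (\<lambda>w. k (u, w) ** X (w, v))"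
          by (rule L2_integrable_mult[OF elim \<open>(\<lambda>w. X (w, v)) \<in> L2 unitI\<close>])
        from integral_bounded_linear[OF bounded_linear_column this, symmetric]
        have "column j (kcomp k X (u, v)) = (\<integral>w. k (u, w) *v \<phi> j w \<partial>unitI)"
          by (simp add: kcomp_def column_mult \<phi>_def)
        moreover have "integrable unitI (\<lambda>w. k (u, w) *v \<phi> j w)"
          by (rule L2_integrable_mult_vec[OF elim \<phi>])
        ultimately show ?case by simp
      qed
    qed
    also have "\<dots> \<ge> 0"
      using nn \<phi> unfolding nonneg_kernel_def by (intro sum_nonneg) blast
    finally show ?case .
  qed
  then have "0 \<le> (\<integral>v. \<integral>u. X (u, v) \<bullet> kcomp k X (u, v) \<partial>unitI \<partial>unitI)"
    by (rule integral_nonneg_AE)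
  also have "\<dots> = (\<integral>z. X z \<bullet> kcomp k X z \<partial>unitI2)"
    using unitI2.integral_snd[OF i] by (simp add: case_prod_beta')
  finally show ?thesis .
qed


section \<open>The inner product space of kernels\<close>

text \<open>Membership in \<open>L2\<close> is part of the relation, which makes it a partial
  equivalence: other functions represent nothing. On the quotient, identities hold outright instead
  of almost everywhere, and derivatives of curves are those of a normed space.\<close>

definition ker_eq :: "(real \<times> real \<Rightarrow> 'e::euclidean_space) \<Rightarrow> (real \<times> real \<Rightarrow> 'e) \<Rightarrow> bool" where
  "ker_eq f g \<longleftrightarrow> f \<in> L2 unitI2 \<and> g \<in> L2 unitI2 \<and> (AE z in unitI2. f z = g z)"

lemma ker_eq_refl [simp]: "ker_eq f f \<longleftrightarrow> f \<in> L2 unitI2"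
  by (simp add: ker_eq_def)

quotient_type (overloaded) 'e kernel = "real \<times> real \<Rightarrow> 'e::euclidean_space" / partial: ker_eq
proof (rule part_equivpI)
  show "\<exists>x :: real \<times> real \<Rightarrow> 'e. ker_eq x x"
    by (rule exI[of _ "\<lambda>_. 0"]) (simp add: L2_zero)
  show "symp (ker_eq :: (real \<times> real \<Rightarrow> 'e) \<Rightarrow> _)"
    by (rule sympI) (auto simp: ker_eq_def elim: eventually_mono)
  show "transp (ker_eq :: (real \<times> real \<Rightarrow> 'e) \<Rightarrow> _)"
  proof (rule transpI)
    fix x y z :: "real \<times> real \<Rightarrow> 'e"
    assume a: "ker_eq x y" "ker_eq y z"
    have "AE p in unitI2. x p = y p" "AE p in unitI2. y p = z p"
      using a by (auto simp: ker_eq_def)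
    then have "AE p in unitI2. x p = z p" by eventually_elim simp
    then show "ker_eq x z" using a by (simp add: ker_eq_def)
  qed
qed

lemma ker_eq_inner_cong:
  assumes "ker_eq f f'" "ker_eq g g'"
  shows "(\<integral>z. f z \<bullet> g z \<partial>unitI2) = (\<integral>z. f' z \<bullet> g' z \<partial>unitI2)"
proof (rule integral_cong_AE)
  show "(\<lambda>z. f z \<bullet> g z) \<in> borel_measurable unitI2" "(\<lambda>z. f' z \<bullet> g' z) \<in> borel_measurable unitI2"
    using assms by (auto simp: ker_eq_def intro!: borel_measurable_integrable[OF L2_integrable_inner])
  have "AE p in unitI2. f p = f' p" "AE p in unitI2. g p = g' p"
    using assms by (auto simp: ker_eq_def)
  then show "AE p in unitI2. f p \<bullet> g p = f' p \<bullet> g' p" by eventually_elim simp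
qed

instantiation kernel :: (euclidean_space) real_vector
begin

lift_definition zero_kernel :: "'a kernel" is "\<lambda>_. 0" by (simp add: L2_zero)
lift_definition plus_kernel :: "'a kernel \<Rightarrow> 'a kernel \<Rightarrow> 'a kernel" is "\<lambda>f g z. f z + g z"
proof -
  fix f f' g g' :: "real \<times> real \<Rightarrow> 'a"
  assume a: "ker_eq f f'" "ker_eq g g'"
  have "AE p in unitI2. f p = f' p" "AE p in unitI2. g p = g' p" using a by (auto simp: ker_eq_def)
  then have "AE p in unitI2. f p + g p = f' p + g' p" by eventually_elim simp
  with a show "ker_eq (\<lambda>z. f z + g z) (\<lambda>z. f' z + g' z)" by (simp add: ker_eq_def L2_add)
qed
lift_definition minus_kernel :: "'a kernel \<Rightarrow> 'a kernel \<Rightarrow> 'a kernel" is "\<lambda>f g z. f z - g z"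
proof -
  fix f f' g g' :: "real \<times> real \<Rightarrow> 'a"
  assume a: "ker_eq f f'" "ker_eq g g'"
  have "AE p in unitI2. f p = f' p" "AE p in unitI2. g p = g' p" using a by (auto simp: ker_eq_def)
  then have "AE p in unitI2. f p - g p = f' p - g' p" by eventually_elim simp
  with a show "ker_eq (\<lambda>z. f z - g z) (\<lambda>z. f' z - g' z)" by (simp add: ker_eq_def L2_diff)
qed
lift_definition uminus_kernel :: "'a kernel \<Rightarrow> 'a kernel" is "\<lambda>f z. - f z"
  by (auto simp: ker_eq_def L2_minus elim: eventually_mono)
lift_definition scaleR_kernel :: "real \<Rightarrow> 'a kernel \<Rightarrow> 'a kernel" is "\<lambda>r f z. r *\<^sub>R f z"
  by (auto simp: ker_eq_def L2_scaleR elim: eventually_mono)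

instance
proof
  fix a b c :: "'a kernel" and r s :: real
  show "a + b + c = a + (b + c)" "a + b = b + a" "0 + a = a" "- a + a = 0" "a - b = a + - b"
    "r *\<^sub>R (a + b) = r *\<^sub>R a + r *\<^sub>R b" "(r + s) *\<^sub>R a = r *\<^sub>R a + s *\<^sub>R a"
    "r *\<^sub>R s *\<^sub>R a = (r * s) *\<^sub>R a" "1 *\<^sub>R a = a"
    by (transfer, simp add: ker_eq_def L2_add L2_scaleR L2_minus L2_diff L2_zero algebra_simps)+
qed

end

instantiation kernel :: (euclidean_space) real_inner
begin

lift_definition inner_kernel :: "'a kernel \<Rightarrow> 'a kernel \<Rightarrow> real" is "\<lambda>f g. \<integral>z. f z \<bullet> g z \<partial>unitI2"
  by (rule ker_eq_inner_cong)
definition norm_kernel :: "'a kernel \<Rightarrow> real" where "norm_kernel f = sqrt (f \<bullet> f)"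
definition sgn_kernel :: "'a kernel \<Rightarrow> 'a kernel" where "sgn_kernel f = f /\<^sub>R norm f"
definition dist_kernel :: "'a kernel \<Rightarrow> 'a kernel \<Rightarrow> real" where "dist_kernel f g = norm (f - g)"
definition uniformity_kernel :: "('a kernel \<times> 'a kernel) filter" where
  "uniformity_kernel = (INF e\<in>{0<..}. principal {(x, y). dist x y < e})"
definition open_kernel :: "'a kernel set \<Rightarrow> bool" where
  "open_kernel U \<longleftrightarrow> (\<forall>x\<in>U. eventually (\<lambda>(x', y). x' = x \<longrightarrow> y \<in> U) uniformity)"

instance
proof
  fix x y z :: "'a kernel" and r :: real and U :: "'a kernel set"
  show "dist x y = norm (x - y)" by (rule dist_kernel_def)
  show "sgn x = x /\<^sub>R norm x" by (rule sgn_kernel_def)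
  show "uniformity = (INF e\<in>{0<..}. principal {(x, y :: 'a kernel). dist x y < e})" by (rule uniformity_kernel_def)
  show "open U \<longleftrightarrow> (\<forall>x\<in>U. eventually (\<lambda>(x', y). x' = x \<longrightarrow> y \<in> U) uniformity)" by (rule open_kernel_def)
  show "norm x = sqrt (x \<bullet> x)" by (rule norm_kernel_def)
  show "x \<bullet> y = y \<bullet> x" by transfer (simp add: inner_commute)
  show "(x + y) \<bullet> z = x \<bullet> z + y \<bullet> z"
    by transfer (simp add: inner_add_left L2_integrable_inner)
  show "(r *\<^sub>R x) \<bullet> y = r * (x \<bullet> y)" by transfer simp
  show "0 \<le> x \<bullet> x" by transfer simp
  show "x \<bullet> x = 0 \<longleftrightarrow> x = 0"
  proof transfer
    fix f :: "real \<times> real \<Rightarrow> 'a"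
    assume "ker_eq f f"
    then have f: "f \<in> L2 unitI2" by simp
    have "(\<integral>z. f z \<bullet> f z \<partial>unitI2) = 0 \<longleftrightarrow> (AE z in unitI2. f z \<bullet> f z = 0)"
      by (rule integral_nonneg_eq_0_iff_AE[OF L2_integrable_inner[OF f f]]) simp
    then show "(\<integral>z. f z \<bullet> f z \<partial>unitI2) = 0 \<longleftrightarrow> ker_eq f (\<lambda>_. 0)"
      using f by (simp add: ker_eq_def L2_zero)
  qed
qed

end

section \<open>The algebra of kernels: matrix actions, adjoint and composition\<close>

lemma norm_abs_kernel:
  assumes "f \<in> L2 unitI2"
  shows "norm (abs_kernel f) = L2_norm unitI2 f"
  using assms by (simp add: norm_kernel_def inner_kernel.abs_eq L2_norm_def power2_norm_eq_inner)

lemma abs_kernel_eq_iff: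
  assumes "f \<in> L2 unitI2" "g \<in> L2 unitI2"
  shows "abs_kernel f = abs_kernel g \<longleftrightarrow> (AE z in unitI2. f z = g z)"
  using assms Quotient3_rel[OF Quotient3_kernel, of f g] by (simp add: ker_eq_def)

lemma abs_kernel_arith:
  assumes "f \<in> L2 unitI2" "g \<in> L2 unitI2"
  shows "abs_kernel f + abs_kernel g = abs_kernel (\<lambda>z. f z + g z)"
    "abs_kernel f - abs_kernel g = abs_kernel (\<lambda>z. f z - g z)"
    "- abs_kernel f = abs_kernel (\<lambda>z. - f z)"
    "r *\<^sub>R abs_kernel f = abs_kernel (\<lambda>z. r *\<^sub>R f z)"
  using assms by (simp_all add: plus_kernel.abs_eq minus_kernel.abs_eq uminus_kernel.abs_eq scaleR_kernel.abs_eq)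

lemma bounded_linear_mult_left_matrix: "bounded_linear (\<lambda>b. (a :: real^'b^'a) ** (b :: real^'c^'b))"
  by (rule bounded_bilinear.bounded_linear_right[OF bounded_bilinear_matrix_mult])
lemma bounded_linear_mult_right_matrix: "bounded_linear (\<lambda>a. (a :: real^'b^'a) ** (b :: real^'c^'b))"
  by (rule bounded_bilinear.bounded_linear_left[OF bounded_bilinear_matrix_mult])

text \<open>A nonzero constant matrix acts on L2(I) as a multiplication operator, which has no
  square-integrable kernel. Operators of the form matrix plus kernel are therefore handled through
  the separate left and right actions \<open>lmul\<close> and \<open>rmul\<close>.\<close>

lift_definition lmul :: "real^'b^'a \<Rightarrow> (real^'c^'b) kernel \<Rightarrow> (real^'c^'a) kernel" is "\<lambda>a f z. a ** f z"
  by (auto simp: ker_eq_def L2_linear[OF bounded_linear_mult_left_matrix] elim: eventually_mono)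
lift_definition rmul :: "(real^'b^'a) kernel \<Rightarrow> real^'c^'b \<Rightarrow> (real^'c^'a) kernel" is "\<lambda>f a z. f z ** a"
  by (auto simp: ker_eq_def L2_linear[OF bounded_linear_mult_right_matrix] elim: eventually_mono)
lift_definition adj :: "(real^'b^'a) kernel \<Rightarrow> (real^'a^'b) kernel" is kadj
proof -
  fix f g :: "real \<times> real \<Rightarrow> real^'b^'a"
  assume a: "ker_eq f g"
  then have "AE z in unitI2. f (snd z, fst z) = g (snd z, fst z)"
    using AE_swap[of "\<lambda>z. f z = g z"] by (simp add: ker_eq_def)
  then have "AE z in unitI2. kadj f z = kadj g z"
    by eventually_elim (simp add: kadj_def case_prod_beta')
  with a show "ker_eq (kadj f) (kadj g)" by (simp add: ker_eq_def kadj_L2)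
qed
lift_definition kmult :: "(real^'b^'a) kernel \<Rightarrow> (real^'c^'b) kernel \<Rightarrow> (real^'c^'a) kernel" is kcomp
  by (simp add: ker_eq_def kcomp_L2 kcomp_cong)
lift_definition smk :: "real kernel \<Rightarrow> real^'b^'a \<Rightarrow> (real^'b^'a) kernel" is "\<lambda>g a z. g z *\<^sub>R a"
  by (auto simp: ker_eq_def L2_linear[OF bounded_linear_scaleR_left] elim: eventually_mono)

lemma norm_kernel_le:
  assumes f: "f \<in> L2 unitI2" and g: "g \<in> L2 unitI2" and K: "K \<ge> 0" and le: "\<And>z. norm (f z) \<le> K * norm (g z)"
  shows "norm (abs_kernel f) \<le> K * norm (abs_kernel g)"
proof -
  have "(\<integral>z. (norm (f z))\<^sup>2 \<partial>unitI2) \<le> (\<integral>z. K\<^sup>2 * (norm (g z))\<^sup>2 \<partial>unitI2)"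
    using power_mono[OF le norm_ge_zero, of _ 2]
    by (intro integral_mono L2_integrable f g integrable_mult_right) (simp add: power_mult_distrib)
  then have "sqrt (\<integral>z. (norm (f z))\<^sup>2 \<partial>unitI2) \<le> sqrt (K\<^sup>2 * (\<integral>z. (norm (g z))\<^sup>2 \<partial>unitI2))"
    by simp
  then show ?thesis
    using K by (simp add: norm_abs_kernel f g L2_norm_def real_sqrt_mult)
qed

lemma kernel_cases:
  obtains f where "k = abs_kernel f" "f \<in> L2 unitI2"
  using kernel.abs_induct[of "\<lambda>k. \<exists>f. k = abs_kernel f \<and> f \<in> L2 unitI2" k] ker_eq_refl by blast

lemma norm_lmul: "norm (lmul a k) \<le> norm a * norm k"
proof -
  obtain f where f: "k = abs_kernel f" "f \<in> L2 unitI2" by (rule kernel_cases)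
  then show ?thesis
    using norm_kernel_le[OF L2_linear[OF bounded_linear_mult_left_matrix f(2), of a] f(2) norm_ge_zero[of a] norm_matrix_mult_le]
    by (simp add: lmul.abs_eq)
qed

lemma norm_rmul: "norm (rmul k a) \<le> norm k * norm a"
proof -
  obtain f where f: "k = abs_kernel f" "f \<in> L2 unitI2" by (rule kernel_cases)
  have "norm (f z ** a) \<le> norm a * norm (f z)" for z
    using norm_matrix_mult_le[of "f z" a] by (simp add: mult.commute)
  then show ?thesis
    using norm_kernel_le[OF L2_linear[OF bounded_linear_mult_right_matrix f(2), of a] f(2) norm_ge_zero[of a]] f
    by (simp add: rmul.abs_eq mult.commute)
qed

lemma norm_smk: "norm (smk k a) \<le> norm k * norm a"
proof -
  obtain f where f: "k = abs_kernel f" "f \<in> L2 unitI2" by (rule kernel_cases)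
  have "norm (f z *\<^sub>R a) \<le> norm a * norm (f z)" for z
    by (simp add: mult.commute)
  then show ?thesis
    using norm_kernel_le[OF L2_linear[OF bounded_linear_scaleR_left f(2), of a] f(2) norm_ge_zero[of a]] f
    by (simp add: smk.abs_eq mult.commute)
qed

lemma norm_comp: "norm (kmult k l) \<le> norm k * norm l"
proof -
  obtain f where f: "k = abs_kernel f" "f \<in> L2 unitI2" by (rule kernel_cases)
  obtain g where g: "l = abs_kernel g" "g \<in> L2 unitI2" by (rule kernel_cases)
  have "sqrt (\<integral>z. (norm (kcomp f g z))\<^sup>2 \<partial>unitI2) \<le> sqrt ((\<integral>z. (norm (f z))\<^sup>2 \<partial>unitI2) * (\<integral>z. (norm (g z))\<^sup>2 \<partial>unitI2))"
    using kcomp_norm[OF f(2) g(2)] by simp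
  then show ?thesis
    using f g by (simp add: kmult.abs_eq norm_abs_kernel kcomp_L2 L2_norm_def real_sqrt_mult)
qed

lemma inner_adj:
  fixes k :: "(real^'a^'b) kernel" and l :: "(real^'b^'a) kernel"
  shows "adj k \<bullet> l = k \<bullet> adj l"
proof transfer
  fix k :: "real \<times> real \<Rightarrow> real^'a^'b" and l :: "real \<times> real \<Rightarrow> real^'b^'a"
  assume "ker_eq k k" "ker_eq l l"
  then have k: "k \<in> L2 unitI2" and l: "l \<in> L2 unitI2" by simp_all
  have t: "transpose A \<bullet> B = A \<bullet> transpose B" for A :: "real^'a^'b" and B
    by (simp add: inner_vec_def transpose_def) (rule sum.swap)
  have "(\<lambda>z. kadj k z \<bullet> l z) \<in> borel_measurable unitI2"
    by (rule borel_measurable_integrable[OF L2_integrable_inner[OF kadj_L2[OF k] l]])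
  from unitI2.integral_product_swap[OF this]
  show "(\<integral>z. kadj k z \<bullet> l z \<partial>unitI2) = (\<integral>z. k z \<bullet> kadj l z \<partial>unitI2)"
    by (simp add: kadj_def case_prod_beta' t)
qed

lemma adj_adj [simp]: "adj (adj k) = k"
  by transfer (simp add: ker_eq_def kadj_def case_prod_beta')

lemma norm_adj [simp]: "norm (adj k) = norm k"
  by (simp add: norm_kernel_def inner_adj)

lemma adj_linear:
  "adj (k + l) = adj k + adj l" "adj (k - l) = adj k - adj l" "adj (- k) = - adj k" "adj (r *\<^sub>R k) = r *\<^sub>R adj k"
  by (transfer, simp add: ker_eq_def kadj_def case_prod_beta' transpose_distribs kadj_L2[unfolded kadj_def case_prod_beta'] L2_add L2_diff L2_scaleR L2_minus)+

lemma adj_lmul: "adj (lmul a k) = rmul (adj k) (transpose a)"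
  by transfer (simp add: ker_eq_def kadj_def case_prod_beta' matrix_transpose_mul
      kadj_L2[unfolded kadj_def case_prod_beta'] L2_linear[OF bounded_linear_mult_right_matrix])

lemma adj_rmul: "adj (rmul k a) = lmul (transpose a) (adj k)"
  by transfer (simp add: ker_eq_def kadj_def case_prod_beta' matrix_transpose_mul
      kadj_L2[unfolded kadj_def case_prod_beta'] L2_linear[OF bounded_linear_mult_left_matrix])

lemma adj_comp:
  fixes k :: "(real^'b^'c) kernel" and l :: "(real^'a^'b) kernel"
  shows "adj (kmult k l) = kmult (adj l) (adj k)"
proof transfer
  fix k :: "real \<times> real \<Rightarrow> real^'b^'c" and l :: "real \<times> real \<Rightarrow> real^'a^'b"
  assume "ker_eq k k" "ker_eq l l"
  then have k: "k \<in> L2 unitI2" and l: "l \<in> L2 unitI2" by simp_all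
  have "AE z in unitI2. kadj (kcomp k l) z = kcomp (kadj l) (kadj k) z"
    using AE_swap[OF kcomp_sections[OF k l]]
  proof eventually_elim
    case (elim z)
    then have "integrable unitI (\<lambda>w. k (snd z, w) ** l (w, fst z))"
      by (auto intro!: L2_integrable_mult)
    from integral_bounded_linear[OF bounded_linear_transpose this] show ?case
      by (simp add: kadj_def kcomp_def case_prod_beta' matrix_transpose_mul)
  qed
  then show "ker_eq (kadj (kcomp k l)) (kcomp (kadj l) (kadj k))"
    by (simp add: ker_eq_def kadj_L2 kcomp_L2 k l)
qed

lemma bounded_linear_adj: "bounded_linear adj"
  by (rule bounded_linear_intro[of _ 1]) (simp_all add: adj_linear)

lemma bounded_bilinear_lmul: "bounded_bilinear lmul"
proof
  show "\<exists>K. \<forall>a b. norm (lmul a b) \<le> norm a * norm b * K" by (rule exI[of _ 1]) (simp add: norm_lmul)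
qed (transfer, simp add: ker_eq_def matrix_distribs L2_add L2_scaleR L2_linear[OF bounded_linear_mult_left_matrix])+

lemma bounded_bilinear_rmul: "bounded_bilinear rmul"
proof
  show "\<exists>K. \<forall>a b. norm (rmul a b) \<le> norm a * norm b * K" by (rule exI[of _ 1]) (simp add: norm_rmul)
qed (transfer, simp add: ker_eq_def matrix_distribs L2_add L2_scaleR L2_linear[OF bounded_linear_mult_right_matrix])+

lemma bounded_bilinear_smk:
  "bounded_bilinear (smk :: real kernel \<Rightarrow> real^'b^'a \<Rightarrow> (real^'b^'a) kernel)"
proof
  show "\<exists>K. \<forall>a b. norm (smk a b) \<le> norm a * norm b * K" by (rule exI[of _ 1]) (simp add: norm_smk)
  fix k k' :: "real kernel" and a a' :: "real^'b^'a" and r :: real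
  obtain f where f: "k = abs_kernel f" "f \<in> L2 unitI2" by (rule kernel_cases)
  obtain f' where f': "k' = abs_kernel f'" "f' \<in> L2 unitI2" by (rule kernel_cases)
  note L = L2_linear[OF bounded_linear_scaleR_left]
  show "smk (k + k') a = smk k a + smk k' a"
    using f f' by (simp add: abs_kernel_arith smk.abs_eq L L2_add scaleR_add_left)
  show "smk k (a + a') = smk k a + smk k a'"
    using f by (simp add: abs_kernel_arith smk.abs_eq L scaleR_add_right)
  have c: "(\<lambda>z. (r *\<^sub>R f z) *\<^sub>R a) = (\<lambda>z. r *\<^sub>R (f z *\<^sub>R a))" "(\<lambda>z. f z *\<^sub>R (r *\<^sub>R a)) = (\<lambda>z. r *\<^sub>R (f z *\<^sub>R a))"
    by (simp_all add: fun_eq_iff)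
  have rk: "r *\<^sub>R smk k a = abs_kernel (\<lambda>z. r *\<^sub>R (f z *\<^sub>R a))"
    unfolding f(1) using f(2) by (simp only: smk.abs_eq ker_eq_refl abs_kernel_arith(4)[OF L[OF f(2)] L[OF f(2)]])
  show "smk (r *\<^sub>R k) a = r *\<^sub>R smk k a"
    unfolding rk unfolding f(1) abs_kernel_arith(4)[OF f(2) f(2)] using L2_scaleR[OF f(2)]
    by (simp only: smk.abs_eq ker_eq_refl c)
  show "smk k (r *\<^sub>R a) = r *\<^sub>R smk k a"
    unfolding rk unfolding f(1) using f(2) by (simp only: smk.abs_eq ker_eq_refl c)
qed

lemma bounded_bilinear_comp: "bounded_bilinear kmult"
proof
  show "\<exists>K. \<forall>a b. norm (kmult a b) \<le> norm a * norm b * K" by (rule exI[of _ 1]) (simp add: norm_comp)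
qed (transfer, simp add: ker_eq_def kcomp_L2 L2_add L2_scaleR kcomp_add_left kcomp_add_right kcomp_scaleR)+

lemmas kmult_add_left = bounded_bilinear.add_left[OF bounded_bilinear_comp]
lemmas kmult_add_right = bounded_bilinear.add_right[OF bounded_bilinear_comp]
lemmas kmult_diff_left = bounded_bilinear.diff_left[OF bounded_bilinear_comp]
lemmas kmult_diff_right = bounded_bilinear.diff_right[OF bounded_bilinear_comp]
lemmas kmult_zero_left = bounded_bilinear.zero_left[OF bounded_bilinear_comp]
lemmas lmul_add_left = bounded_bilinear.add_left[OF bounded_bilinear_lmul]
lemmas lmul_add_right = bounded_bilinear.add_right[OF bounded_bilinear_lmul]
lemmas lmul_diff_left = bounded_bilinear.diff_left[OF bounded_bilinear_lmul]
lemmas lmul_diff_right = bounded_bilinear.diff_right[OF bounded_bilinear_lmul]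
lemmas lmul_minus_right = bounded_bilinear.minus_right[OF bounded_bilinear_lmul]
lemmas lmul_zero_left = bounded_bilinear.zero_left[OF bounded_bilinear_lmul]
lemmas rmul_add_left = bounded_bilinear.add_left[OF bounded_bilinear_rmul]
lemmas rmul_add_right = bounded_bilinear.add_right[OF bounded_bilinear_rmul]
lemmas rmul_diff_left = bounded_bilinear.diff_left[OF bounded_bilinear_rmul]
lemmas rmul_diff_right = bounded_bilinear.diff_right[OF bounded_bilinear_rmul]
lemmas smk_add_right = bounded_bilinear.add_right[OF bounded_bilinear_smk]
lemmas smk_diff_right = bounded_bilinear.diff_right[OF bounded_bilinear_smk]

lemma kmult_assoc: "kmult (kmult k l) m = kmult k (kmult l m)"
  by transfer (simp add: ker_eq_def kcomp_L2 kcomp_assoc)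

lemma inner_comp: "kmult k l \<bullet> m = l \<bullet> kmult (adj k) m"
  by transfer (simp add: kcomp_inner_adj)

lemma inner_lmul: "lmul a k \<bullet> m = k \<bullet> lmul (transpose a) m"
  by transfer (simp add: inner_matrix_mult_left)

lemma lmul_lmul: "lmul a (lmul b k) = lmul (a ** b) k"
  by transfer (simp add: ker_eq_def matrix_mul_assoc L2_linear[OF bounded_linear_mult_left_matrix])

lemma rmul_lmul: "rmul (lmul a k) b = lmul a (rmul k b)"
  by transfer (simp add: ker_eq_def matrix_mul_assoc L2_linear[OF bounded_linear_mult_left_matrix] L2_linear[OF bounded_linear_mult_right_matrix])

lemma lmul_one [simp]: "lmul (mat 1) k = k"
  by transfer simp

lemma kmult_lmul:
  fixes a :: "real^'d^'a" and k :: "(real^'c^'d) kernel" and l :: "(real^'b^'c) kernel"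
  shows "kmult (lmul a k) l = lmul a (kmult k l)"
proof transfer
  fix a :: "real^'d^'a" and k :: "real \<times> real \<Rightarrow> real^'c^'d" and l :: "real \<times> real \<Rightarrow> real^'b^'c"
  assume "ker_eq k k" "ker_eq l l"
  then have k: "k \<in> L2 unitI2" and l: "l \<in> L2 unitI2" by simp_all
  note ak = L2_linear[OF bounded_linear_mult_left_matrix k]
  have "AE z in unitI2. kcomp (\<lambda>z. a ** k z) l z = a ** kcomp k l z"
    using kcomp_sections[OF k l]
  proof eventually_elim
    case (elim z)
    then have "integrable unitI (\<lambda>w. k (fst z, w) ** l (w, snd z))"
      by (auto intro!: L2_integrable_mult)
    from integral_bounded_linear[OF bounded_linear_mult_left_matrix this] show ?case
      by (simp add: kcomp_def case_prod_beta' matrix_mul_assoc)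
  qed
  then show "ker_eq (kcomp (\<lambda>z. a ** k z) l) (\<lambda>z. a ** kcomp k l z)"
    by (simp add: ker_eq_def kcomp_L2 ak l L2_linear[OF bounded_linear_mult_left_matrix kcomp_L2[OF k l]])
qed

lemma kmult_rmul_lmul:
  fixes k :: "(real^'b^'a) kernel" and a :: "real^'c^'b" and l :: "(real^'d^'c) kernel"
  shows "kmult (rmul k a) l = kmult k (lmul a l)"
proof -
  obtain f where f: "k = abs_kernel f" "f \<in> L2 unitI2" by (rule kernel_cases)
  obtain g where g: "l = abs_kernel g" "g \<in> L2 unitI2" by (rule kernel_cases)
  have "kcomp (\<lambda>z. f z ** a) g = kcomp f (\<lambda>z. a ** g z)"
    by (simp add: kcomp_def matrix_mul_assoc)
  then show ?thesis
    unfolding f(1) g(1) using f(2) g(2)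
    by (simp only: rmul.abs_eq lmul.abs_eq kmult.abs_eq ker_eq_refl
        L2_linear[OF bounded_linear_mult_left_matrix] L2_linear[OF bounded_linear_mult_right_matrix])
qed

lemma lmul_smk: "lmul a (smk g b) = smk g (a ** b)"
  by transfer (simp add: ker_eq_def matrix_distribs L2_linear[OF bounded_linear_scaleR_left])

lemma kmult_nonneg:
  assumes "k \<in> L2 unitI2" "nonneg_kernel k"
  shows "0 \<le> X \<bullet> kmult (abs_kernel k) X"
proof -
  obtain f where f: "X = abs_kernel f" "f \<in> L2 unitI2" by (rule kernel_cases)
  then show ?thesis
    using nonneg_kernel_kcomp[OF assms f(2)] assms by (simp add: kmult.abs_eq inner_kernel.abs_eq kcomp_L2)
qed

text \<open>The Frobenius pairing of \<open>B\<close> with \<open>a ** B\<close> is the sum of the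
  form of \<open>a\<close> over the columns of \<open>B\<close>, so a matrix inequality carries over
  to kernels with the same constant.\<close>

lemma inner_lmul_ge:
  fixes a :: "real^'d^'d"
  assumes "\<And>x. r * (norm x)\<^sup>2 \<le> x \<bullet> (a *v x)"
  shows "r * (norm X)\<^sup>2 \<le> X \<bullet> lmul a X"
proof -
  obtain f where f: "X = abs_kernel f" "f \<in> L2 unitI2" by (rule kernel_cases)
  have af: "(\<lambda>z. a ** f z) \<in> L2 unitI2" by (rule L2_linear[OF bounded_linear_mult_left_matrix f(2)])
  have pt: "r * (norm B)\<^sup>2 \<le> B \<bullet> (a ** B)" for B :: "real^'c^'d"
  proof -
    have "(norm B)\<^sup>2 = (\<Sum>j\<in>UNIV. (norm (column j B))\<^sup>2)"
      unfolding power2_norm_eq_inner by (rule inner_columns)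
    then have "r * (norm B)\<^sup>2 = (\<Sum>j\<in>UNIV. r * (norm (column j B))\<^sup>2)" by (simp add: sum_distrib_left)
    also have "\<dots> \<le> (\<Sum>j\<in>UNIV. column j B \<bullet> (a *v column j B))" by (intro sum_mono assms)
    also have "\<dots> = B \<bullet> (a ** B)" unfolding inner_columns[of B] column_mult ..
    finally show ?thesis .
  qed
  have "(\<integral>z. r * (norm (f z))\<^sup>2 \<partial>unitI2) \<le> (\<integral>z. f z \<bullet> (a ** f z) \<partial>unitI2)"
    by (intro integral_mono integrable_mult_right L2_integrable L2_integrable_inner f(2) af pt)
  then show ?thesis
    using f af by (simp add: lmul.abs_eq inner_kernel.abs_eq power2_norm_eq_inner)
qed


section \<open>Lyapunov forms without semigroups\<close>

text \<open>A discrete substitute for exponential stability of the flow of \<open>l\<close>: the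
  explicit Euler iterates with step \<open>h\<close> decay like \<open>exp (- c * h * n)\<close>,
  with \<open>C\<close> and \<open>c\<close> independent of the step. The condition
  \<open>c * h \<le> 1\<close> keeps the decay factor nonnegative.\<close>

definition power_stable :: "('k::real_inner \<Rightarrow> 'k) \<Rightarrow> bool" where
  "power_stable l \<longleftrightarrow> (\<exists>C c h0. C > 0 \<and> c > 0 \<and> h0 > 0 \<and> (\<forall>h\<in>{0<..h0}. c * h \<le> 1 \<and>
     (\<forall>n x. (norm (((\<lambda>x. x + h *\<^sub>R l x) ^^ n) x))\<^sup>2 \<le> C * (1 - c * h) ^ n * (norm x)\<^sup>2)))"

lemma power_stableE:
  assumes "power_stable l"
  obtains C c h0 where "C > 0" "c > 0" "h0 > 0" "\<And>h. h \<in> {0<..h0} \<Longrightarrow> c * h \<le> 1"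
    "\<And>h n x. h \<in> {0<..h0} \<Longrightarrow> (norm (((\<lambda>x. x + h *\<^sub>R l x) ^^ n) x))\<^sup>2 \<le> C * (1 - c * h) ^ n * (norm x)\<^sup>2"
proof -
  from assms obtain C c h0 where *: "C > 0" "c > 0" "h0 > 0" "\<forall>h\<in>{0<..h0}. c * h \<le> 1 \<and>
     (\<forall>n x. (norm (((\<lambda>x. x + h *\<^sub>R l x) ^^ n) x))\<^sup>2 \<le> C * (1 - c * h) ^ n * (norm x)\<^sup>2)"
    unfolding power_stable_def by (elim exE conjE) rule
  show thesis by (rule that[OF *(1-3)]) (use *(4) in blast)+
qed

lemma bounded_linear_pos_bound:
  assumes "bounded_linear l"
  obtains L where "L > 0" "\<And>x. norm (l x) \<le> L * norm x"
proof -
  obtain K where "K > 0" "\<And>x. norm (l x) \<le> norm x * K"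
    using bounded_linear.pos_bounded[OF assms] by blast
  then show thesis using that[of K] by (simp add: mult.commute)
qed

text \<open>Measured by the form of \<open>p\<close>, one Euler step contracts by
  \<open>1 - c * h\<close>; passing back to the given norm costs the factor \<open>C\<close>. For
  \<open>l'\<close> no contracting form is at hand, but its Euler powers are the adjoints of those
  of \<open>l\<close> and inherit their norm bound.\<close>

lemma coercive_power_stable:
  fixes l l' p :: "'k::real_inner \<Rightarrow> 'k"
  assumes l: "bounded_linear l" and p: "bounded_linear p"
    and adj: "\<And>x y. l x \<bullet> y = x \<bullet> l' y" and sa: "\<And>x y. p x \<bullet> y = x \<bullet> p y"
    and \<epsilon>: "\<epsilon> > 0" "\<And>x. \<epsilon> * (norm x)\<^sup>2 \<le> x \<bullet> p x"
    and \<delta>: "\<delta> > 0" "\<And>x. p x \<bullet> l x \<le> - \<delta> * (norm x)\<^sup>2"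
  shows "power_stable l" "power_stable l'"
proof -
  obtain L where L: "L > 0" "\<And>x. norm (l x) \<le> L * norm x" using bounded_linear_pos_bound[OF l] by blast
  obtain M where M: "M > 0" "\<And>x. norm (p x) \<le> M * norm x" using bounded_linear_pos_bound[OF p] by blast
  have qM: "x \<bullet> p x \<le> M * (norm x)\<^sup>2" for x
  proof -
    have "x \<bullet> p x \<le> norm x * norm (p x)" by (rule norm_cauchy_schwarz)
    also have "\<dots> \<le> norm x * (M * norm x)" by (intro mult_left_mono M) simp
    finally show ?thesis by (simp add: power2_eq_square algebra_simps)
  qed
  \<comment> \<open>The form of \<open>p\<close> is at most \<open>M\<close> times the squared norm,
    so dissipation \<open>\<delta>\<close> in the norm is dissipation \<open>c\<close> relative to
    the form.\<close>
  define c where "c = \<delta> / M"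
  \<comment> \<open>The first bound gives \<open>c * h \<le> 1\<close>. The second lets the term of
    order \<open>h\<^sup>2\<close> consume at most half of the first-order gain
    \<open>2 * h * \<delta>\<close>.\<close>
  define h0 where "h0 = min (M / \<delta>) (\<delta> / (M * L\<^sup>2))"
  define C where "C = M / \<epsilon>"
  have pos: "C > 0" "c > 0" "h0 > 0" using M L \<epsilon> \<delta> by (auto simp: c_def h0_def C_def)
  have main: "c * h \<le> 1 \<and>
      (\<forall>n x. (norm (((\<lambda>x. x + h *\<^sub>R l x) ^^ n) x))\<^sup>2 \<le> C * (1 - c * h) ^ n * (norm x)\<^sup>2) \<and>
      (\<forall>n x. (norm (((\<lambda>x. x + h *\<^sub>R l' x) ^^ n) x))\<^sup>2 \<le> C * (1 - c * h) ^ n * (norm x)\<^sup>2)"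
    if h: "h \<in> {0<..h0}" for h
  proof -
    have h1: "0 < h" "h \<le> M / \<delta>" "h \<le> \<delta> / (M * L\<^sup>2)" using h by (auto simp: h0_def)
    have ch: "c * h \<le> 1" using h1 M \<delta> by (simp add: c_def field_simps)
    have hML: "h * (M * L\<^sup>2) \<le> \<delta>" using h1 M L by (simp add: field_simps)
    define \<Phi> where "\<Phi> = (\<lambda>x. x + h *\<^sub>R l x)"
    define \<Phi>' where "\<Phi>' = (\<lambda>x. x + h *\<^sub>R l' x)"
    interpret l: bounded_linear l by (rule l)
    interpret p: bounded_linear p by (rule p)
    have step: "\<Phi> x \<bullet> p (\<Phi> x) \<le> (1 - c * h) * (x \<bullet> p x)" for x
    proof -
      have "l x \<bullet> p (l x) \<le> M * (L * norm x)\<^sup>2"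
        by (rule order_trans[OF qM mult_left_mono[OF power_mono[OF L(2)]]]) (use M in auto)
      then have 1: "h * (h * (l x \<bullet> p (l x))) \<le> h * (h * (M * (L * norm x)\<^sup>2))"
        using h1 by (intro mult_left_mono) auto
      have "h * (M * L\<^sup>2) * (norm x)\<^sup>2 \<le> \<delta> * (norm x)\<^sup>2" by (intro mult_right_mono hML) simp
      then have 2: "h * (h * (M * (L * norm x)\<^sup>2)) \<le> h * (\<delta> * (norm x)\<^sup>2)"
        using h1 by (intro mult_left_mono) (auto simp: power_mult_distrib algebra_simps)
      have 3: "h * (p x \<bullet> l x) \<le> h * (- \<delta> * (norm x)\<^sup>2)" using h1 by (intro mult_left_mono \<delta>) simp
      have 4: "c * h * (x \<bullet> p x) \<le> h * (\<delta> * (norm x)\<^sup>2)"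
      proof -
        have "c * h * (x \<bullet> p x) \<le> c * h * (M * (norm x)\<^sup>2)" using pos h1 by (intro mult_left_mono qM) auto
        also have "\<dots> = h * (\<delta> * (norm x)\<^sup>2)" using M by (simp add: c_def)
        finally show ?thesis .
      qed
      have "\<Phi> x \<bullet> p (\<Phi> x) = x \<bullet> p x + 2 * (h * (p x \<bullet> l x)) + h * (h * (l x \<bullet> p (l x)))"
        using sa[of x "l x"] by (simp add: \<Phi>_def p.add p.scaleR inner_add_left inner_add_right inner_commute)
      then have "\<Phi> x \<bullet> p (\<Phi> x) \<le> x \<bullet> p x - c * h * (x \<bullet> p x)"
        using 1 2 3 4 by simp
      then show ?thesis by (simp add: algebra_simps)
    qed
    have q: "(\<Phi> ^^ n) x \<bullet> p ((\<Phi> ^^ n) x) \<le> (1 - c * h) ^ n * (x \<bullet> p x)" for n x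
    proof (induction n)
      case (Suc n)
      have "(\<Phi> ^^ Suc n) x \<bullet> p ((\<Phi> ^^ Suc n) x) \<le> (1 - c * h) * ((\<Phi> ^^ n) x \<bullet> p ((\<Phi> ^^ n) x))"
        using step by simp
      also have "\<dots> \<le> (1 - c * h) * ((1 - c * h) ^ n * (x \<bullet> p x))"
        using ch by (intro mult_left_mono Suc.IH) simp
      finally show ?case by (simp add: algebra_simps)
    qed simp
    have n1: "(norm ((\<Phi> ^^ n) x))\<^sup>2 \<le> C * (1 - c * h) ^ n * (norm x)\<^sup>2" for n x
    proof -
      have "\<epsilon> * (norm ((\<Phi> ^^ n) x))\<^sup>2 \<le> (1 - c * h) ^ n * (x \<bullet> p x)"
        by (rule order_trans[OF \<epsilon>(2) q])
      also have "\<dots> \<le> (1 - c * h) ^ n * (M * (norm x)\<^sup>2)"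
        using ch by (intro mult_left_mono qM) simp
      finally show ?thesis using \<epsilon>(1) by (simp add: C_def field_simps)
    qed
    have adj\<Phi>: "\<Phi> x \<bullet> y = x \<bullet> \<Phi>' y" for x y
      by (simp add: \<Phi>_def \<Phi>'_def inner_add_left inner_add_right adj)
    have adjn: "(\<Phi> ^^ n) x \<bullet> y = x \<bullet> (\<Phi>' ^^ n) y" for n x y
    proof (induction n arbitrary: y)
      case (Suc n)
      have "(\<Phi> ^^ Suc n) x \<bullet> y = x \<bullet> (\<Phi>' ^^ n) (\<Phi>' y)" by (simp add: adj\<Phi> Suc.IH)
      then show ?case by (simp add: funpow_swap1)
    qed simp
    have n2: "(norm ((\<Phi>' ^^ n) x))\<^sup>2 \<le> C * (1 - c * h) ^ n * (norm x)\<^sup>2" for n x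
    proof (cases "(\<Phi>' ^^ n) x = 0")
      case True
      then show ?thesis using pos ch by simp
    next
      case False
      let ?y = "(\<Phi>' ^^ n) x" and ?K = "C * (1 - c * h) ^ n"
      \<comment> \<open>Duality: the power is moved to the other side, Cauchy-Schwarz brings in the
        known bound at \<open>?y\<close>, and one factor \<open>(norm ?y)\<^sup>2\<close> cancels in
        the end.\<close>
      have "(norm ?y)\<^sup>2 = (\<Phi> ^^ n) ?y \<bullet> x" by (simp add: adjn power2_norm_eq_inner)
      also have "\<dots> \<le> norm ((\<Phi> ^^ n) ?y) * norm x" by (rule norm_cauchy_schwarz)
      finally have "((norm ?y)\<^sup>2)\<^sup>2 \<le> (norm ((\<Phi> ^^ n) ?y) * norm x)\<^sup>2" by (rule power_mono) simp
      also have "\<dots> \<le> (?K * (norm ?y)\<^sup>2) * (norm x)\<^sup>2"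
        unfolding power_mult_distrib by (intro mult_right_mono n1) simp
      finally have "(norm ?y)\<^sup>2 * (norm ?y)\<^sup>2 \<le> (?K * (norm x)\<^sup>2) * (norm ?y)\<^sup>2"
        by (simp add: power2_eq_square algebra_simps)
      then show ?thesis by (rule mult_right_le_imp_le) (use False in simp)
    qed
    show ?thesis using ch n1 n2 unfolding \<Phi>_def \<Phi>'_def by blast
  qed
  show "power_stable l"
    unfolding power_stable_def using pos main by (intro exI[of _ C] exI[of _ c] exI[of _ h0]) blast
  show "power_stable l'"
    unfolding power_stable_def using pos main by (intro exI[of _ C] exI[of _ c] exI[of _ h0]) blast
qed

text \<open>With \<open>\<Phi> = (1 + h l1)(1 + h l2)\<close> the form \<open>W = h \<Sum>\<^sub>n\<^sub><\<^sub>N \<langle>\<Phi>\<^sup>n \<cdot>, \<Phi>\<^sup>n \<cdot>\<rangle>\<close> is a Lyapunov form of \<open>l1 + l2\<close>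
  for small \<open>h\<close> and large \<open>N\<close>; no semigroup is needed, hence no completeness.\<close>

lemma lyapunov_form_sum:
  fixes l1 l2 :: "'k::real_inner \<Rightarrow> 'k"
  assumes l1: "bounded_linear l1" and l2: "bounded_linear l2"
    and comm: "\<And>x. l1 (l2 x) = l2 (l1 x)"
    and st: "power_stable l1" "power_stable l2"
  obtains W \<kappa> where "bounded_bilinear W" "\<And>x y. W x y = (W y x :: real)" "\<kappa> > 0"
    "\<And>x. \<kappa> * (norm x)\<^sup>2 \<le> W x x" "\<And>x. W x (l1 x + l2 x) \<le> - \<kappa> * (norm x)\<^sup>2"
proof -
  interpret l1: bounded_linear l1 by (rule l1)
  interpret l2: bounded_linear l2 by (rule l2)
  obtain L1 where L1: "L1 > 0" "\<And>x. norm (l1 x) \<le> L1 * norm x" using bounded_linear_pos_bound[OF l1] by blast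
  obtain L2 where L2: "L2 > 0" "\<And>x. norm (l2 x) \<le> L2 * norm x" using bounded_linear_pos_bound[OF l2] by blast
  obtain C1 c1 h1 where s1: "C1 > 0" "c1 > 0" "h1 > 0"
    "\<And>h. h \<in> {0<..h1} \<Longrightarrow> c1 * h \<le> 1"
    "\<And>h n x. h \<in> {0<..h1} \<Longrightarrow> (norm (((\<lambda>x. x + h *\<^sub>R l1 x) ^^ n) x))\<^sup>2 \<le> C1 * (1 - c1 * h) ^ n * (norm x)\<^sup>2"
    using power_stableE[OF st(1)] by blast
  obtain C2 c2 h2 where s2: "C2 > 0" "c2 > 0" "h2 > 0"
    "\<And>h. h \<in> {0<..h2} \<Longrightarrow> c2 * h \<le> 1"
    "\<And>h n x. h \<in> {0<..h2} \<Longrightarrow> (norm (((\<lambda>x. x + h *\<^sub>R l2 x) ^^ n) x))\<^sup>2 \<le> C2 * (1 - c2 * h) ^ n * (norm x)\<^sup>2"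
    using power_stableE[OF st(2)] by blast
  define C where "C = C1 * C2"
  \<comment> \<open>The last bound makes \<open>h * W x (l1 (l2 x))\<close>, the contribution of the
    second-order part of the step, at most \<open>(norm x)\<^sup>2 / 8\<close>.\<close>
  define h where "h = min (min h1 h2) (c1 / (8 * C * L1 * L2))"
  have C: "C > 0" using s1 s2 by (simp add: C_def)
  have h: "h > 0" "h \<in> {0<..h1}" "h \<in> {0<..h2}" "h \<le> c1 / (8 * C * L1 * L2)"
    using s1 s2 C L1 L2 by (auto simp: h_def)
  have ch1: "c1 * h \<le> 1" and ch2: "c2 * h \<le> 1" using s1(4) s2(4) h by auto
  define \<Phi>1 where "\<Phi>1 = (\<lambda>x. x + h *\<^sub>R l1 x)"
  define \<Phi>2 where "\<Phi>2 = (\<lambda>x. x + h *\<^sub>R l2 x)"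
  define \<Phi> where "\<Phi> = (\<lambda>x. \<Phi>1 (\<Phi>2 x))"
  have commPhi: "\<Phi>1 (\<Phi>2 x) = \<Phi>2 (\<Phi>1 x)" for x
    by (simp add: \<Phi>1_def \<Phi>2_def l1.add l2.add l1.scaleR l2.scaleR comm algebra_simps)
  have commn: "\<Phi>2 ((\<Phi>1 ^^ n) x) = (\<Phi>1 ^^ n) (\<Phi>2 x)" for n x
    by (induction n) (simp_all add: commPhi[symmetric])
  \<comment> \<open>Commutation splits the powers of \<open>\<Phi>\<close>, so that the two power
    bounds multiply.\<close>
  have pow: "(\<Phi> ^^ n) x = (\<Phi>1 ^^ n) ((\<Phi>2 ^^ n) x)" for n x
    by (induction n) (simp_all add: \<Phi>_def commn)
  define \<rho> where "\<rho> = 1 - c1 * h"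
  have \<rho>: "0 \<le> \<rho>" "\<rho> < 1" using ch1 s1 h by (auto simp: \<rho>_def)
  have dec: "(norm ((\<Phi> ^^ n) x))\<^sup>2 \<le> C * \<rho> ^ n * (norm x)\<^sup>2" for n x
  proof -
    have "(norm ((\<Phi> ^^ n) x))\<^sup>2 \<le> C1 * \<rho> ^ n * (norm ((\<Phi>2 ^^ n) x))\<^sup>2"
      unfolding pow \<rho>_def using s1(5)[OF h(2)] by (simp add: \<Phi>1_def)
    also have "\<dots> \<le> C1 * \<rho> ^ n * (C2 * (1 - c2 * h) ^ n * (norm x)\<^sup>2)"
      using s2(5)[OF h(3)] s1 \<rho> by (intro mult_left_mono) (auto simp: \<Phi>2_def)
    also have "\<dots> \<le> C1 * \<rho> ^ n * (C2 * 1 * (norm x)\<^sup>2)"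
      using s1 s2 \<rho> ch2 h by (intro mult_left_mono mult_right_mono power_le_one) auto
    finally show ?thesis by (simp add: C_def algebra_simps)
  qed
  \<comment> \<open>After \<open>N\<close> steps at most half of the squared norm is left; a sum
    truncated there still telescopes to a definite loss.\<close>
  obtain N where N: "\<rho> ^ N < 1 / (2 * C)"
    using real_arch_pow_inv[of "1 / (2 * C)" \<rho>] \<rho> C by auto
  have CN: "C * \<rho> ^ N \<le> 1 / 2" using N C by (simp add: field_simps)
  \<comment> \<open>The factor \<open>h\<close> makes this a Riemann sum. Its bound
    \<open>C / c1\<close> does not involve \<open>h\<close>, which is why the step size could be
    fixed beforehand in terms of that bound.\<close>
  define W where "W x y = h * (\<Sum>n<Suc N. (\<Phi> ^^ n) x \<bullet> (\<Phi> ^^ n) y)" for x y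
  have CN': "C * \<rho> ^ Suc N \<le> 1 / 2"
  proof -
    have "\<rho> * (C * \<rho> ^ N) \<le> 1 * (C * \<rho> ^ N)" using \<rho> C by (intro mult_right_mono) auto
    then show ?thesis using CN by (simp add: mult.left_commute)
  qed
  have lin: "(\<Phi> ^^ n) (x + y) = (\<Phi> ^^ n) x + (\<Phi> ^^ n) y" "(\<Phi> ^^ n) (r *\<^sub>R x) = r *\<^sub>R (\<Phi> ^^ n) x" for n x y r
    by (induction n) (simp_all add: \<Phi>_def \<Phi>1_def \<Phi>2_def l1.add l2.add l1.scaleR l2.scaleR algebra_simps)
  have geo: "h * (\<Sum>n<Suc N. C * \<rho> ^ n) \<le> C / c1"
  proof -
    have "(\<Sum>n<Suc N. \<rho> ^ n) * (1 - \<rho>) = 1 - \<rho> ^ Suc N"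
      using one_diff_power_eq[of \<rho> "Suc N"] by (simp add: mult.commute)
    also have "\<dots> \<le> 1" using \<rho> by simp
    finally have "(\<Sum>n<Suc N. \<rho> ^ n) * (c1 * h) \<le> 1" by (simp add: \<rho>_def)
    then have "C * ((\<Sum>n<Suc N. \<rho> ^ n) * (c1 * h)) \<le> C * 1" using C by (intro mult_left_mono) auto
    then show ?thesis
      using s1 by (simp add: sum_distrib_left[symmetric] field_simps del: sum.lessThan_Suc)
  qed
  have Wb: "\<bar>W x y\<bar> \<le> C / c1 * (norm x * norm y)" for x y
  proof -
    have "\<bar>W x y\<bar> \<le> h * (\<Sum>n<Suc N. \<bar>(\<Phi> ^^ n) x \<bullet> (\<Phi> ^^ n) y\<bar>)"
      using h(1) unfolding W_def abs_mult by (simp add: sum_abs del: sum.lessThan_Suc)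
    also have "\<dots> \<le> h * (\<Sum>n<Suc N. C * \<rho> ^ n * (norm x * norm y))"
    proof (intro mult_left_mono sum_mono)
      fix n
      have "(norm ((\<Phi> ^^ n) x) * norm ((\<Phi> ^^ n) y))\<^sup>2 \<le> (C * \<rho> ^ n * (norm x)\<^sup>2) * (C * \<rho> ^ n * (norm y)\<^sup>2)"
        unfolding power_mult_distrib using C \<rho> by (intro mult_mono dec) auto
      also have "\<dots> = (C * \<rho> ^ n * (norm x * norm y))\<^sup>2" by (simp add: power2_eq_square algebra_simps)
      finally have "norm ((\<Phi> ^^ n) x) * norm ((\<Phi> ^^ n) y) \<le> C * \<rho> ^ n * (norm x * norm y)"
        by (rule power2_le_imp_le) (use C \<rho> in auto)
      then show "\<bar>(\<Phi> ^^ n) x \<bullet> (\<Phi> ^^ n) y\<bar> \<le> C * \<rho> ^ n * (norm x * norm y)"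
        using Cauchy_Schwarz_ineq2[of "(\<Phi> ^^ n) x" "(\<Phi> ^^ n) y"] by linarith
    qed (use h in simp)
    also have "\<dots> = h * (\<Sum>n<Suc N. C * \<rho> ^ n) * (norm x * norm y)"
      by (simp add: sum_distrib_right del: sum.lessThan_Suc)
    also have "\<dots> \<le> C / c1 * (norm x * norm y)" by (intro mult_right_mono geo) simp
    finally show ?thesis .
  qed
  have Wsym: "W x y = W y x" for x y by (simp add: W_def inner_commute del: sum.lessThan_Suc)
  have Wadd: "W (x + x') y = W x y + W x' y" for x x' y
    by (simp add: W_def lin inner_add_left sum.distrib algebra_simps del: sum.lessThan_Suc)
  have Wsc: "W (r *\<^sub>R x) y = r * W x y" for r x y
    by (simp add: W_def lin sum_distrib_left algebra_simps del: sum.lessThan_Suc)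
  have Wadd': "W y (x + x') = W y x + W y x'" for x x' y using Wadd[of x x' y] by (simp add: Wsym)
  have Wsc': "W y (r *\<^sub>R x) = r * W y x" for r x y using Wsc[of r x y] by (simp add: Wsym)
  have bil: "bounded_bilinear W"
  proof
    show "\<exists>K. \<forall>a b. norm (W a b) \<le> norm a * norm b * K"
      using Wb by (intro exI[of _ "C / c1"]) (simp add: mult.commute)
  qed (simp_all add: Wadd Wadd' Wsc Wsc')
  have Wpos: "h * (norm x)\<^sup>2 \<le> W x x" for x
  proof -
    have "(norm x)\<^sup>2 \<le> (\<Sum>n<Suc N. (\<Phi> ^^ n) x \<bullet> (\<Phi> ^^ n) x)"
      unfolding sum.lessThan_Suc_shift by (simp add: power2_norm_eq_inner sum_nonneg)
    then show ?thesis unfolding W_def using h(1) by (intro mult_left_mono) auto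
  qed
  \<comment> \<open>Replacing \<open>x\<close> by \<open>\<Phi> x\<close> shifts the sum by one
    index, so only its two end terms survive.\<close>
  have tele: "W (\<Phi> x) (\<Phi> x) - W x x \<le> - (h / 2) * (norm x)\<^sup>2" for x
  proof -
    have "(\<Sum>n<Suc N. (\<Phi> ^^ n) (\<Phi> x) \<bullet> (\<Phi> ^^ n) (\<Phi> x)) - (\<Sum>n<Suc N. (\<Phi> ^^ n) x \<bullet> (\<Phi> ^^ n) x)
        = (\<Sum>n<Suc N. (norm ((\<Phi> ^^ Suc n) x))\<^sup>2 - (norm ((\<Phi> ^^ n) x))\<^sup>2)"
      by (simp add: sum_subtractf power2_norm_eq_inner funpow_swap1 del: sum.lessThan_Suc)
    also have "\<dots> = (norm ((\<Phi> ^^ Suc N) x))\<^sup>2 - (norm x)\<^sup>2"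
      using sum_lessThan_telescope[of "\<lambda>n. (norm ((\<Phi> ^^ n) x))\<^sup>2" "Suc N"] by simp
    also have "\<dots> \<le> - (1 / 2) * (norm x)\<^sup>2"
      using dec[of "Suc N" x] mult_right_mono[OF CN', of "(norm x)\<^sup>2"] by simp
    finally have "h * ((\<Sum>n<Suc N. (\<Phi> ^^ n) (\<Phi> x) \<bullet> (\<Phi> ^^ n) (\<Phi> x)) - (\<Sum>n<Suc N. (\<Phi> ^^ n) x \<bullet> (\<Phi> ^^ n) x))
        \<le> h * (- (1 / 2) * (norm x)\<^sup>2)" using h by (intro mult_left_mono) auto
    then show ?thesis by (simp add: W_def algebra_simps del: sum.lessThan_Suc)
  qed
  have neg: "W x (l1 x + l2 x) \<le> - (1 / 8) * (norm x)\<^sup>2" for x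
  proof -
    let ?y = "h *\<^sub>R (l1 x + l2 x + h *\<^sub>R l1 (l2 x))"
    have \<Phi>x: "\<Phi> x = x + ?y"
      by (simp add: \<Phi>_def \<Phi>1_def \<Phi>2_def l1.add l1.scaleR algebra_simps)
    have "W (\<Phi> x) (\<Phi> x) = W x x + 2 * W x ?y + W ?y ?y"
      unfolding \<Phi>x Wadd Wadd' using Wsym[of ?y x] by linarith
    \<comment> \<open>Dropping this quadratic term leaves an upper bound on
      \<open>2 * W x ?y\<close>, and \<open>?y\<close> is \<open>h\<close> times the generator up to
      one further order in \<open>h\<close>.\<close>
    moreover have "0 \<le> W ?y ?y" using Wpos[of ?y] h(1) by (meson mult_nonneg_nonneg less_imp_le order_trans zero_le_power2)
    ultimately have "2 * W x ?y \<le> - (h / 2) * (norm x)\<^sup>2" using tele[of x] by linarith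
    then have "h * (2 * (W x (l1 x + l2 x) + h * W x (l1 (l2 x)))) \<le> h * (- (1/2) * (norm x)\<^sup>2)"
      by (simp add: Wsc' Wadd' algebra_simps)
    then have 1: "2 * (W x (l1 x + l2 x) + h * W x (l1 (l2 x))) \<le> - (1/2) * (norm x)\<^sup>2"
      using h(1) by (simp only: mult_le_cancel_left_pos)
    have "\<bar>W x (l1 (l2 x))\<bar> \<le> C / c1 * (norm x * norm (l1 (l2 x)))" by (rule Wb)
    also have "\<dots> \<le> C / c1 * (norm x * (L1 * (L2 * norm x)))"
      using C s1 L1 by (intro mult_left_mono order_trans[OF L1(2)] L2(2)) auto
    finally have "h * \<bar>W x (l1 (l2 x))\<bar> \<le> h * (C / c1 * (norm x * (L1 * (L2 * norm x))))"
      using h by (intro mult_left_mono) auto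
    also have "\<dots> = h * (8 * C * L1 * L2) / c1 * ((norm x)\<^sup>2 / 8)" by (simp add: power2_eq_square)
    also have "\<dots> \<le> 1 * ((norm x)\<^sup>2 / 8)"
      using h(4) C L1 L2 s1 by (intro mult_right_mono) (auto simp: field_simps)
    finally have "h * \<bar>W x (l1 (l2 x))\<bar> \<le> (norm x)\<^sup>2 / 8" by simp
    moreover have "- (h * W x (l1 (l2 x))) \<le> h * \<bar>W x (l1 (l2 x))\<bar>"
      using h(1) by (metis abs_ge_minus_self abs_mult abs_of_pos)
    ultimately show ?thesis using 1 by (simp add: algebra_simps)
  qed
  define \<kappa> where "\<kappa> = min h (1 / 8)"
  show thesis
  proof (rule that[OF bil Wsym])
    show "\<kappa> > 0" using h by (simp add: \<kappa>_def)
    show "\<kappa> * (norm x)\<^sup>2 \<le> W x x" for x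
      by (rule order_trans[OF mult_right_mono Wpos]) (simp_all add: \<kappa>_def)
    show "W x (l1 x + l2 x) \<le> - \<kappa> * (norm x)\<^sup>2" for x
    proof -
      have "\<kappa> * (norm x)\<^sup>2 \<le> 1 / 8 * (norm x)\<^sup>2" by (intro mult_right_mono) (simp_all add: \<kappa>_def)
      then show ?thesis using neg[of x] by simp
    qed
  qed
qed

section \<open>Gronwall and Lyapunov estimates for curves\<close>

lemma has_vector_derivative_interior:
  assumes "(f has_vector_derivative f') (at s within {a..b})" "a < s" "s < (b::real)"
  shows "(f has_vector_derivative f') (at s)"
  using assms at_within_interior[of s "{a..b}"] by (simp add: interior_atLeastAtMost_real)

text \<open>Gronwall's inequality: \<open>exp (- (2 * C) * s)\<close> times the squared norm is
  nonincreasing and starts at 0. It replaces the order argument used for matrices when two kernel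
  curves have to be shown equal.\<close>

lemma linear_growth_zero:
  fixes f f' :: "real \<Rightarrow> 'k::real_inner"
  assumes der: "\<And>s. s \<in> {0..T} \<Longrightarrow> (f has_vector_derivative f' s) (at s within {0..T})"
    and le: "\<And>s. s \<in> {0..T} \<Longrightarrow> norm (f' s) \<le> C * norm (f s)"
    and f0: "f 0 = 0" and t: "t \<in> {0..T}"
  shows "f t = 0"
proof (cases "t = 0")
  case False
  define g where "g s = exp (- (2 * C) * s) * (f s \<bullet> f s)" for s
  define g' where "g' s = exp (- (2 * C) * s) * (2 * (f s \<bullet> f' s)) - 2 * C * exp (- (2 * C) * s) * (f s \<bullet> f s)" for s
  have dg: "(g has_vector_derivative g' s) (at s within {0..T})" if s: "s \<in> {0..T}" for s
  proof -
    have "((\<lambda>s. f s \<bullet> f s) has_vector_derivative (f s \<bullet> f' s + f' s \<bullet> f s)) (at s within {0..T})"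
      by (rule bounded_bilinear.has_vector_derivative[OF bounded_bilinear_inner der[OF s] der[OF s]])
    then have "((\<lambda>s. f s \<bullet> f s) has_real_derivative 2 * (f s \<bullet> f' s)) (at s within {0..T})"
      by (simp add: has_real_derivative_iff_has_vector_derivative inner_commute)
    then have "(g has_real_derivative g' s) (at s within {0..T})"
      unfolding g_def g'_def by (auto intro!: derivative_eq_intros simp: algebra_simps)
    then show ?thesis by (simp add: has_real_derivative_iff_has_vector_derivative)
  qed
  have t': "0 < t" "t \<le> T" using t False by auto
  have "g t \<le> g 0"
  proof (rule DERIV_nonpos_imp_decreasing_open[OF less_imp_le[OF t'(1)]])
    fix s assume s: "0 < s" "s < t"
    then have s': "s \<in> {0..T}" using t' by auto
    have "(g has_vector_derivative g' s) (at s)"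
      using has_vector_derivative_interior[OF dg[OF s']] s t' by simp
    then have "(g has_real_derivative g' s) (at s)" by (simp add: has_real_derivative_iff_has_vector_derivative)
    moreover have "g' s \<le> 0"
    proof -
      have "f s \<bullet> f' s \<le> norm (f s) * norm (f' s)" by (rule norm_cauchy_schwarz)
      also have "\<dots> \<le> norm (f s) * (C * norm (f s))" by (intro mult_left_mono le s') simp
      also have "\<dots> = C * (f s \<bullet> f s)" by (simp add: power2_norm_eq_inner[symmetric] power2_eq_square)
      finally have "exp (- (2 * C) * s) * (2 * (f s \<bullet> f' s)) \<le> exp (- (2 * C) * s) * (2 * (C * (f s \<bullet> f s)))"
        by simp
      then show ?thesis by (simp add: g'_def algebra_simps)
    qed
    ultimately show "\<exists>y. (g has_real_derivative y) (at s) \<and> y \<le> 0" by blast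
  next
    have "continuous_on {0..T} g"
      unfolding continuous_on_eq_continuous_within using has_vector_derivative_continuous[OF dg] by blast
    then show "continuous_on {0..t} g" by (rule continuous_on_subset) (use t' in auto)
  qed
  then have "f t \<bullet> f t \<le> 0" by (simp add: g_def f0 mult_le_0_iff)
  then show ?thesis by (metis inner_eq_zero_iff inner_ge_zero order_antisym)
qed (simp add: f0)

text \<open>Once \<open>E\<close> is small, the quadratic perturbation takes at most half of the
  dissipation of \<open>W\<close>, and Young's inequality splits off the exponential one. The form
  \<open>W (E s) (E s)\<close> then satisfies a linear differential inequality with a decaying
  source. The preceding compact time interval only enlarges the constant.\<close>

lemma lyapunov_decay:
  fixes E E' :: "real \<Rightarrow> 'k::real_inner" and L :: "'k \<Rightarrow> 'k"
  assumes W: "bounded_bilinear W" and Wsym: "\<And>x y. W x y = (W y x :: real)" and \<kappa>: "\<kappa> > 0"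
    and Wpos: "\<And>x. \<kappa> * (norm x)\<^sup>2 \<le> W x x" and Wneg: "\<And>x. W x (L x) \<le> - \<kappa> * (norm x)\<^sup>2"
    and der: "\<And>s. s \<ge> 0 \<Longrightarrow> (E has_vector_derivative E' s) (at s within {0..})"
    and pert: "\<And>s. s \<ge> 0 \<Longrightarrow> norm (E' s - L (E s)) \<le> \<rho> * (norm (E s))\<^sup>2 + K * exp (- \<gamma> * s)"
    and \<gamma>: "\<gamma> > 0" and lim: "(E \<longlongrightarrow> 0) at_top"
  shows "expconv E 0"
proof -
  interpret W: bounded_bilinear W by (rule W)
  obtain B where B: "B > 0" "\<And>x y. norm (W x y) \<le> norm x * norm y * B" using W.pos_bounded by blast
  have Wle: "W x y \<le> B * (norm x * norm y)" for x y using B(2)[of x y] by (simp add: algebra_simps abs_le_iff)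
  \<comment> \<open>Majorants free of sign conditions on \<open>\<rho>\<close> and \<open>K\<close>;
    the \<open>+ 1\<close> permits division by \<open>\<rho>'\<close>.\<close>
  define \<rho>' where "\<rho>' = \<bar>\<rho>\<bar> + 1"
  define K' where "K' = \<bar>K\<bar>"
  have "\<rho>' > 0" by (simp add: \<rho>'_def)
  have "\<forall>\<^sub>F s in at_top. dist (E s) 0 < \<kappa> / (2 * B * \<rho>')"
    using \<kappa> B \<open>\<rho>' > 0\<close> by (intro tendstoD[OF lim]) simp
  then obtain s1 where s1: "\<And>s. s \<ge> s1 \<Longrightarrow> norm (E s) < \<kappa> / (2 * B * \<rho>')"
    unfolding eventually_at_top_linorder by auto
  define s0 where "s0 = max s1 0"
  have s0: "s0 \<ge> 0" and small: "\<And>s. s \<ge> s0 \<Longrightarrow> B * \<rho>' * norm (E s) \<le> \<kappa> / 2"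
  proof -
    fix s assume "s \<ge> s0"
    then have "norm (E s) < \<kappa> / (2 * B * \<rho>')" using s1 by (simp add: s0_def)
    then show "B * \<rho>' * norm (E s) \<le> \<kappa> / 2" using B \<open>\<rho>' > 0\<close> by (simp add: field_simps)
  qed (simp add: s0_def)
  define V where "V s = W (E s) (E s)" for s
  \<comment> \<open>The remainder of Young's inequality when \<open>\<kappa> / 2\<close> of the
    dissipation is spent on the term linear in \<open>norm (E s)\<close>.\<close>
  define D where "D = 2 * (B * K')\<^sup>2 / \<kappa>"
  \<comment> \<open>The first bound turns the remaining dissipation \<open>\<kappa> / 2\<close> into
    a multiple of the form. The second ensures that the source, of order
    \<open>exp (- (2 * \<gamma>) * s)\<close>, still decays like \<open>exp (- \<gamma> * s)\<close>
    after multiplication by \<open>exp (\<mu> * s)\<close>.\<close>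
  define \<mu> where "\<mu> = min (\<kappa> / (2 * B)) \<gamma>"
  have \<mu>: "\<mu> > 0" "\<mu> \<le> \<gamma>" using \<kappa> B \<gamma> by (auto simp: \<mu>_def)
  have D0: "D \<ge> 0" using \<kappa> by (simp add: D_def)
  have V': "2 * W (E s) (E' s) \<le> - \<mu> * V s + D * exp (- (2 * \<gamma>) * s)" if s: "s \<ge> s0" for s
  proof -
    have s': "s \<ge> 0" using s s0 by simp
    let ?n = "norm (E s)" and ?e = "exp (- \<gamma> * s)"
    have pe: "norm (E' s - L (E s)) \<le> \<rho>' * ?n\<^sup>2 + K' * ?e"
    proof -
      have "\<rho> * ?n\<^sup>2 \<le> \<rho>' * ?n\<^sup>2" "K * ?e \<le> K' * ?e"
        by (intro mult_right_mono; simp add: \<rho>'_def K'_def)+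
      then show ?thesis using pert[OF s'] by linarith
    qed
    have "W (E s) (E' s) = W (E s) (L (E s)) + W (E s) (E' s - L (E s))"
      by (simp add: W.diff_right)
    also have "\<dots> \<le> - \<kappa> * ?n\<^sup>2 + B * (?n * (\<rho>' * ?n\<^sup>2 + K' * ?e))"
      using B by (intro add_mono Wneg order_trans[OF Wle] mult_left_mono pe) auto
    also have "\<dots> = - \<kappa> * ?n\<^sup>2 + (B * \<rho>' * ?n) * ?n\<^sup>2 + B * K' * ?e * ?n"
      by (simp add: algebra_simps power2_eq_square)
    also have "\<dots> \<le> - \<kappa> * ?n\<^sup>2 + \<kappa> / 2 * ?n\<^sup>2 + B * K' * ?e * ?n"
      by (intro add_mono order_refl mult_right_mono small s) simp
    finally have 1: "2 * W (E s) (E' s) \<le> - \<kappa> * ?n\<^sup>2 + 2 * (B * K' * ?e) * ?n" by (simp add: algebra_simps)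
    have "0 \<le> (\<kappa> / 2) * (?n - 2 / \<kappa> * (B * K' * ?e))\<^sup>2" using \<kappa> by simp
    also have "\<dots> = \<kappa> / 2 * ?n\<^sup>2 - 2 * (B * K' * ?e) * ?n + 2 * (B * K' * ?e)\<^sup>2 / \<kappa>"
      using \<kappa> by (simp add: power2_diff power_mult_distrib power_divide field_simps power2_eq_square)
    also have "2 * (B * K' * ?e)\<^sup>2 / \<kappa> = D * exp (- (2 * \<gamma>) * s)"
    proof -
      have "?e\<^sup>2 = exp (- (2 * \<gamma>) * s)" by (simp add: power2_eq_square exp_add[symmetric])
      then show ?thesis by (simp add: D_def power_mult_distrib)
    qed
    finally have 2: "2 * (B * K' * ?e) * ?n \<le> \<kappa> / 2 * ?n\<^sup>2 + D * exp (- (2 * \<gamma>) * s)" by linarith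
    have "\<mu> * V s \<le> \<kappa> / (2 * B) * (B * (?n * ?n))"
    proof (rule mult_mono)
      show "V s \<le> B * (?n * ?n)" unfolding V_def by (rule Wle)
      show "0 \<le> V s" unfolding V_def by (rule order_trans[OF _ Wpos]) (use \<kappa> in simp)
    qed (use \<kappa> B in \<open>auto simp: \<mu>_def\<close>)
    then have "\<mu> * V s \<le> \<kappa> / 2 * ?n\<^sup>2" using B by (simp add: power2_eq_square)
    then show ?thesis using 1 2 by linarith
  qed
  \<comment> \<open>The derivative \<open>- D * exp (- \<gamma> * s)\<close> of the second summand
    cancels the source, so \<open>g\<close> is nonincreasing from \<open>s0\<close> on.\<close>
  define g where "g s = exp (\<mu> * s) * V s + D / \<gamma> * exp (- \<gamma> * s)" for s
  define g' where "g' s = exp (\<mu> * s) * (2 * W (E s) (E' s)) + \<mu> * exp (\<mu> * s) * V s - D * exp (- \<gamma> * s)" for s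
  have dg: "(g has_real_derivative g' s) (at s within {0..})" if s: "s \<ge> 0" for s
  proof -
    have "(V has_vector_derivative (W (E s) (E' s) + W (E' s) (E s))) (at s within {0..})"
      unfolding V_def by (rule W.has_vector_derivative[OF der[OF s] der[OF s]])
    then have "(V has_real_derivative 2 * W (E s) (E' s)) (at s within {0..})"
      using Wsym[of "E' s" "E s"] by (simp add: has_real_derivative_iff_has_vector_derivative)
    then show ?thesis
      unfolding g_def g'_def using \<gamma> by (auto intro!: derivative_eq_intros simp: algebra_simps)
  qed
  have g'0: "g' s \<le> 0" if s: "s \<ge> s0" for s
  proof -
    have "exp (\<mu> * s) * (2 * W (E s) (E' s)) \<le> exp (\<mu> * s) * (- \<mu> * V s + D * exp (- (2 * \<gamma>) * s))"
      by (intro mult_left_mono V' s) simp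
    moreover have "exp (\<mu> * s) * (D * exp (- (2 * \<gamma>) * s)) \<le> D * exp (- \<gamma> * s)"
    proof -
      have "exp (\<mu> * s) * exp (- (2 * \<gamma>) * s) \<le> exp (- \<gamma> * s)"
        unfolding exp_add[symmetric] using mult_right_mono[OF \<mu>(2), of s] s s0 by simp
      from mult_left_mono[OF this D0] show ?thesis by (simp only: mult.left_commute)
    qed
    ultimately show ?thesis by (simp add: g'_def algebra_simps)
  qed
  have contE: "continuous_on {0..} E"
    unfolding continuous_on_eq_continuous_within using has_vector_derivative_continuous[OF der] by auto
  have gdec: "g s \<le> g s0" if s: "s \<ge> s0" for s
  proof (cases "s = s0")
    case False
    then have lt: "s0 < s" using s by simp
    show ?thesis
    proof (rule DERIV_nonpos_imp_decreasing_open[OF s])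
      fix x assume x: "s0 < x" "x < s"
      then have x0: "x > 0" using s0 by simp
      have "at x within {0..} = at x" using x0 by (intro at_within_interior) simp
      then have "(g has_real_derivative g' x) (at x)" using dg[of x] x0 by simp
      then show "\<exists>y. (g has_real_derivative y) (at x) \<and> y \<le> 0" using g'0 x by auto
    next
      have "continuous_on {0..} g"
        unfolding continuous_on_eq_continuous_within using DERIV_continuous[OF dg] by auto
      then show "continuous_on {s0..s} g" by (rule continuous_on_subset) (use s0 in auto)
    qed
  qed simp
  have big: "norm (E s) \<le> sqrt (\<bar>g s0\<bar> / \<kappa>) * exp (- (\<mu> / 2) * s)" if s: "s \<ge> s0" for s
  proof -
    have "exp (\<mu> * s) * V s \<le> g s" using D0 \<gamma> by (simp add: g_def)
    also have "\<dots> \<le> \<bar>g s0\<bar>" using gdec[OF s] by simp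
    finally have "V s \<le> \<bar>g s0\<bar> * exp (- \<mu> * s)" by (simp add: exp_minus field_simps)
    then have "\<kappa> * (norm (E s))\<^sup>2 \<le> \<bar>g s0\<bar> * exp (- \<mu> * s)" using Wpos[of "E s"] by (simp add: V_def)
    then have "(norm (E s))\<^sup>2 \<le> \<bar>g s0\<bar> / \<kappa> * exp (- \<mu> * s)" using \<kappa> by (simp add: field_simps)
    also have "\<dots> = (sqrt (\<bar>g s0\<bar> / \<kappa>) * exp (- (\<mu> / 2) * s))\<^sup>2"
    proof -
      have "(exp (- (\<mu> / 2) * s))\<^sup>2 = exp (- \<mu> * s)" by (simp add: power2_eq_square exp_add[symmetric])
      then show ?thesis using \<kappa> by (simp add: power_mult_distrib)
    qed
    finally show ?thesis by (rule power2_le_imp_le) (use \<kappa> in simp)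
  qed
  have "continuous_on {0..s0} E" by (rule continuous_on_subset[OF contE]) auto
  then have "bounded (E ` {0..s0})"
    by (intro compact_imp_bounded compact_continuous_image compact_Icc)
  then obtain M where M: "\<And>s. s \<in> {0..s0} \<Longrightarrow> norm (E s) \<le> M"
    unfolding bounded_iff by blast
  show ?thesis
  \<comment> \<open>The rate is halved because \<open>V\<close> is quadratic in \<open>E\<close>.
    The summand with \<open>exp (\<mu> / 2 * s0)\<close> dominates \<open>M\<close> on the initial
    interval.\<close>
  proof (rule expconvI[of "\<mu> / 2" _ _ "sqrt (\<bar>g s0\<bar> / \<kappa>) + \<bar>M\<bar> * exp (\<mu> / 2 * s0)"])
    fix s :: real assume s: "s \<ge> 0"
    show "norm (E s - 0) \<le> (sqrt (\<bar>g s0\<bar> / \<kappa>) + \<bar>M\<bar> * exp (\<mu> / 2 * s0)) * exp (- (\<mu> / 2) * s)"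
    proof (cases "s \<ge> s0")
      case True
      have "norm (E s) \<le> sqrt (\<bar>g s0\<bar> / \<kappa>) * exp (- (\<mu> / 2) * s)" by (rule big[OF True])
      also have "\<dots> \<le> (sqrt (\<bar>g s0\<bar> / \<kappa>) + \<bar>M\<bar> * exp (\<mu> / 2 * s0)) * exp (- (\<mu> / 2) * s)"
        by (intro mult_right_mono) auto
      finally show ?thesis by simp
    next
      case False
      have "norm (E s) \<le> M" using s False by (intro M) simp
      then have "norm (E s) \<le> \<bar>M\<bar> * 1" by simp
      also have "\<dots> \<le> \<bar>M\<bar> * (exp (\<mu> / 2 * s0) * exp (- (\<mu> / 2) * s))"
      proof (rule mult_left_mono)
        have "0 \<le> \<mu> / 2 * (s0 - s)" using False \<mu> by simp
        then have "1 \<le> exp (\<mu> / 2 * (s0 - s))" by simp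
        also have "\<mu> / 2 * (s0 - s) = \<mu> / 2 * s0 + - (\<mu> / 2) * s" by (simp add: field_simps)
        finally show "1 \<le> exp (\<mu> / 2 * s0) * exp (- (\<mu> / 2) * s)" by (simp only: exp_add)
      qed simp
      also have "\<dots> \<le> sqrt (\<bar>g s0\<bar> / \<kappa>) * exp (- (\<mu> / 2) * s) + \<bar>M\<bar> * (exp (\<mu> / 2 * s0) * exp (- (\<mu> / 2) * s))"
        using \<kappa> by simp
      finally show ?thesis by (simp add: algebra_simps)
    qed
  qed (use \<mu> in simp)
qed


section \<open>The kernel Riccati equation\<close>

text \<open>Links a kernel class to a chosen representative, so that a representative of a compound
  expression can be assembled from representatives of its parts by introduction rules.\<close>

definition rep :: "'e::euclidean_space kernel \<Rightarrow> (real \<times> real \<Rightarrow> 'e) \<Rightarrow> bool" where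
  "rep k f \<longleftrightarrow> f \<in> L2 unitI2 \<and> k = abs_kernel f"

lemma rep_abs: "f \<in> L2 unitI2 \<Longrightarrow> rep (abs_kernel f) f"
  by (simp add: rep_def)

lemma rep_add: "rep k f \<Longrightarrow> rep l g \<Longrightarrow> rep (k + l) (\<lambda>z. f z + g z)"
  by (simp add: rep_def L2_add abs_kernel_arith)
lemma rep_diff: "rep k f \<Longrightarrow> rep l g \<Longrightarrow> rep (k - l) (\<lambda>z. f z - g z)"
  by (simp add: rep_def L2_diff abs_kernel_arith)
lemma rep_minus: "rep k f \<Longrightarrow> rep (- k) (\<lambda>z. - f z)"
  by (simp add: rep_def L2_minus uminus_kernel.abs_eq)
lemma rep_lmul: "rep k f \<Longrightarrow> rep (lmul a k) (\<lambda>z. a ** f z)"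
  by (simp add: rep_def lmul.abs_eq L2_linear[OF bounded_linear_mult_left_matrix])
lemma rep_rmul: "rep k f \<Longrightarrow> rep (rmul k a) (\<lambda>z. f z ** a)"
  by (simp add: rep_def rmul.abs_eq L2_linear[OF bounded_linear_mult_right_matrix])
lemma rep_smk: "rep k f \<Longrightarrow> rep (smk k a) (\<lambda>z. f z *\<^sub>R a)"
  unfolding rep_def using L2_linear[OF bounded_linear_scaleR_left, of f unitI2 a] by (simp only: smk.abs_eq ker_eq_refl simp_thms)
lemma rep_adj: "rep k f \<Longrightarrow> rep (adj k) (kadj f)"
  by (simp add: rep_def adj.abs_eq kadj_L2)
lemma rep_comp: "rep k f \<Longrightarrow> rep l g \<Longrightarrow> rep (kmult k l) (kcomp f g)"
  by (simp add: rep_def kmult.abs_eq kcomp_L2)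
lemma rep_cong: "rep k f \<Longrightarrow> f = g \<Longrightarrow> rep k g"
  by simp

lemmas rep_intros = rep_add rep_diff rep_minus rep_lmul rep_rmul rep_smk rep_adj rep_comp

lemma kmult_rmul: "kmult k (rmul l a) = rmul (kmult k l) a"
  using arg_cong[OF kmult_lmul[of "transpose a" "adj l" "adj k"], of adj]
  by (simp add: adj_comp adj_lmul adj_rmul)

lemmas kernel_add =
  lmul_add_left lmul_add_right
  rmul_add_left rmul_add_right
  kmult_add_left kmult_add_right
  smk_add_right
lemmas kernel_diff =
  lmul_diff_left lmul_diff_right
  rmul_diff_left rmul_diff_right
  kmult_diff_left kmult_diff_right
  smk_diff_right
text \<open>The vector inequality is applied to each pair of columns of \<open>X\<close> and
  \<open>\<Theta>\<close>, summed and integrated.\<close>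

lemma inner_cost_ge:
  fixes Q :: "real^'d^'d" and S :: "real^'d^'m" and R :: "real^'m^'m"
    and X :: "(real^'c^'d) kernel" and \<Theta> :: "(real^'c^'m) kernel"
  assumes cost: "\<And>x \<theta>. \<delta> * (norm x)\<^sup>2 \<le> x \<bullet> (Q *v x) + 2 * (\<theta> \<bullet> (S *v x)) + \<theta> \<bullet> (R *v \<theta>)"
  shows "\<delta> * (norm X)\<^sup>2 \<le> X \<bullet> lmul Q X + 2 * (\<Theta> \<bullet> lmul S X) + \<Theta> \<bullet> lmul R \<Theta>"
proof -
  obtain f where f: "X = abs_kernel f" "f \<in> L2 unitI2" by (rule kernel_cases)
  obtain h where h: "\<Theta> = abs_kernel h" "h \<in> L2 unitI2" by (rule kernel_cases)
  have Qf: "(\<lambda>z. Q ** f z) \<in> L2 unitI2" and Sf: "(\<lambda>z. S ** f z) \<in> L2 unitI2" and Rh: "(\<lambda>z. R ** h z) \<in> L2 unitI2"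
    using L2_linear[OF bounded_linear_mult_left_matrix f(2)] L2_linear[OF bounded_linear_mult_left_matrix h(2)] by blast+
  note i1 = L2_integrable_inner[OF f(2) Qf] and i2 = L2_integrable_inner[OF h(2) Sf] and i3 = L2_integrable_inner[OF h(2) Rh]
  have pt: "\<delta> * (norm B)\<^sup>2 \<le> B \<bullet> (Q ** B) + 2 * (H \<bullet> (S ** B)) + H \<bullet> (R ** H)"
    for B :: "real^'c^'d" and H :: "real^'c^'m"
  proof -
    have "(norm B)\<^sup>2 = (\<Sum>j\<in>UNIV. (norm (column j B))\<^sup>2)"
      unfolding power2_norm_eq_inner by (rule inner_columns)
    then have "\<delta> * (norm B)\<^sup>2 = (\<Sum>j\<in>UNIV. \<delta> * (norm (column j B))\<^sup>2)" by (simp add: sum_distrib_left)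
    also have "\<dots> \<le> (\<Sum>j\<in>UNIV. column j B \<bullet> (Q *v column j B) + 2 * (column j H \<bullet> (S *v column j B)) + column j H \<bullet> (R *v column j H))"
      by (intro sum_mono cost)
    also have "\<dots> = B \<bullet> (Q ** B) + 2 * (H \<bullet> (S ** B)) + H \<bullet> (R ** H)"
      unfolding inner_columns[of B] inner_columns[of H] column_mult sum.distrib sum_distrib_left[symmetric] ..
    finally show ?thesis .
  qed
  have "(\<integral>z. \<delta> * (norm (f z))\<^sup>2 \<partial>unitI2) \<le> (\<integral>z. f z \<bullet> (Q ** f z) + 2 * (h z \<bullet> (S ** f z)) + h z \<bullet> (R ** h z) \<partial>unitI2)"
    by (intro integral_mono integrable_mult_right Bochner_Integration.integrable_add L2_integrable f(2) i1 i2 i3 pt)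
  also have "\<dots> = (\<integral>z. f z \<bullet> (Q ** f z) \<partial>unitI2) + 2 * (\<integral>z. h z \<bullet> (S ** f z) \<partial>unitI2) + (\<integral>z. h z \<bullet> (R ** h z) \<partial>unitI2)"
    by (simp add: i1 i2 i3)
  finally show ?thesis
    using f h Qf Sf Rh by (simp add: lmul.abs_eq inner_kernel.abs_eq power2_norm_eq_inner)
qed

section \<open>The kernel Riccati field and its closed-loop operator\<close>

locale lq =
  fixes c :: "('d::finite, 'm::finite) lq_coeffs" and \<delta> r :: real
  assumes \<delta>: "0 < \<delta>" and r: "0 < r"
    and cost1: "\<And>x \<theta>. \<delta> * (norm x)\<^sup>2 \<le> x \<bullet> (cQ c *v x) + 2 * (\<theta> \<bullet> (cS c *v x)) + \<theta> \<bullet> (cR c *v \<theta>)"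
    and cost2: "\<And>x \<theta>. \<delta> * (norm x)\<^sup>2 \<le> x \<bullet> ((cQ c + cQbar c) *v x) + 2 * (\<theta> \<bullet> (cS c *v x)) + \<theta> \<bullet> (cR c *v \<theta>)"
    and R_coercive: "\<And>\<theta>. r * (norm \<theta>)\<^sup>2 \<le> \<theta> \<bullet> (cR c *v \<theta>)"
    and R_sym: "transpose (cR c) = cR c"
    and Qchk: "cQchk c \<in> psd_mats"
    and G: "cG c \<in> L2 unitI2"
    and Qtil: "nonneg_kernel (\<lambda>z. cG c z *\<^sub>R cQtil c)"
begin

sublocale I: riccati "cA c" "cC c" "cQ c" "cB c" "cD c" "cS c" "cR c" \<delta> r
  by unfold_locales (fact \<delta> r cost1 R_coercive R_sym)+

sublocale II: riccati "cA c + cAbar c" "cC c + cCbar c" "cQ c + cQbar c" "cB c" "cD c" "cS c" "cR c" \<delta> r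
  by unfold_locales (fact \<delta> r cost2 R_coercive R_sym)+

abbreviation Ah where "Ah \<equiv> cA c + cAbar c"
abbreviation Ch where "Ch \<equiv> cC c + cCbar c"
abbreviation Rinv where "Rinv P \<equiv> matrix_inv (Rmap c P)"

definition g where "g = abs_kernel (cG c)"
text \<open>The graphon as a matrix kernel, which makes it composable: \<open>smk g M\<close> is
  \<open>lmul M g1\<close>, and the integrals of \<open>G(w,u) G(w,v)\<close> become compositions
  with \<open>adj g1\<close>.\<close>

definition g1 :: "(real^'d^'d) kernel" where "g1 = smk g (mat 1)"

lemma I_N: "I.N Y = Rmap c Y" and II_N: "II.N Y = Rmap c Y"
  by (simp_all add: I.N_def II.N_def Rmap_def)

lemma I_ric: "I.ric X X = Qmap c X - transpose (Mmap c X) ** Rinv X ** Mmap c X"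
  by (simp add: I.ric_def I_N I.MM_def Qmap_def Mmap_def)

lemma II_ric: "II.ric X Y = Qhat c Y (X - Y) - transpose (Mhat c Y (X - Y)) ** Rinv Y ** Mhat c Y (X - Y)"
  by (simp add: II.ric_def II_N II.MM_def Qhat_def Mhat_def add.assoc)

definition Mh where "Mh P Pb = transpose (cB c) ** Pb + transpose (cD c) ** P ** Ch + cS c"

lemma Mhat_Mh: "Mhat c P (Pb - P) = Mh P Pb"
  by (simp add: Mhat_def Mh_def)

definition Ups :: "real^'d^'d \<Rightarrow> (real^'d^'d) kernel \<Rightarrow> (real^'d^'m) kernel" where
  "Ups P n = lmul (transpose (cB c)) n + smk g (transpose (cD c) ** P ** cCtil c)"

lemma rep_g: "rep g (cG c)" unfolding g_def by (rule rep_abs[OF G])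

lemma rep_Ups: "f \<in> L2 unitI2 \<Longrightarrow> rep (Ups P (abs_kernel f)) (Upsilon c P f)"
  unfolding Ups_def
  by (rule rep_cong, (rule rep_intros rep_g rep_abs | assumption)+) (simp add: Upsilon_def case_prod_beta')

text \<open>\<open>Fmap\<close> on kernel classes, with \<open>\<Pi>bar\<close> itself as second
  argument in place of \<open>\<Pi>\<close>. Since \<open>adj\<close> swaps the variables and also
  transposes the matrix, a term with \<open>G(v,u)\<close> appears as \<open>adj\<close> of a kernel
  whose matrix is transposed in advance.\<close>

definition Fk :: "real^'d^'d \<Rightarrow> real^'d^'d \<Rightarrow> (real^'d^'d) kernel \<Rightarrow> (real^'d^'d) kernel" where
  "Fk P Pb n = smk g (Pb ** cAtil c) + adj (smk g (transpose (transpose (cAtil c) ** Pb)))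
     + smk g (transpose Ch ** P ** cCtil c) + adj (smk g (transpose (transpose (cCtil c) ** P ** Ch)))
     + kmult (adj g1) (smk g (transpose (cCtil c) ** P ** cCtil c))
     + lmul (transpose Ah) n + rmul (adj n) Ah
     + kmult (adj n) (smk g (cAtil c)) + kmult (adj (smk g (cAtil c))) n
     + smk g (cQtil c) + kmult (adj g1) (smk g (cQchk c))
     - lmul (transpose (Mh P Pb) ** Rinv P) (Ups P n)
     - rmul (adj (Ups P n)) (Rinv P ** Mh P Pb)
     - kmult (adj (Ups P n)) (lmul (Rinv P) (Ups P n))"

lemma rep_Fk:
  assumes f: "f \<in> L2 unitI2"
  shows "rep (Fk P Pb (abs_kernel f)) (Fmap c P (Pb - P) f)"
  unfolding Fk_def g1_def
  apply (rule rep_cong)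
   apply (rule rep_add rep_diff rep_lmul rep_rmul rep_smk rep_adj rep_comp rep_g rep_Ups[OF f] rep_abs[OF f])+
  apply (simp add: fun_eq_iff Fmap_def Psi1_def Mhat_Mh kcomp_def kadj_def matrix_distribs transpose_distribs
      matrix_transpose_mul matrix_mul_assoc)
  apply (simp add: mult.commute)
  done

text \<open>Coefficients of the normal form \<open>Fk_std\<close>. The closed-loop operator at a
  kernel \<open>n\<close> is multiplication by \<open>af\<close> plus the integral operator of
  \<open>kf - \<rho>f n\<close>; \<open>\<rho>f\<close> weights the quadratic term, and
  \<open>hf\<close> collects the source terms other than the one with \<open>cQtil\<close>.\<close>

definition af where "af P Pb = Ah - cB c ** Rinv P ** Mh P Pb"
definition G1 where "G1 P = transpose (cD c) ** P ** cCtil c"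
definition kf :: "real^'d^'d \<Rightarrow> (real^'d^'d) kernel" where "kf P = smk g (cAtil c - cB c ** Rinv P ** G1 P)"
definition \<rho>f where "\<rho>f P = cB c ** Rinv P ** transpose (cB c)"
definition H1 where "H1 P Pb = Pb ** cAtil c + transpose Ch ** P ** cCtil c - transpose (Mh P Pb) ** Rinv P ** G1 P"
definition H2 where "H2 P = transpose (cCtil c) ** P ** cCtil c + cQchk c - transpose (G1 P) ** Rinv P ** G1 P"
definition hf :: "real^'d^'d \<Rightarrow> real^'d^'d \<Rightarrow> (real^'d^'d) kernel" where
  "hf P Pb = smk g (H1 P Pb) + adj (smk g (H1 P Pb)) + kmult (adj g1) (smk g (H2 P))"

lemma inv_sym: "P \<in> psd_mats \<Longrightarrow> transpose (Rinv P) = Rinv P"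
  using transpose_inverse[OF I.N_inv(1,2) I.N_sym] by (simp add: I_N)

text \<open>The product of the two \<open>Ups\<close> is expanded: its mixed terms change
  \<open>cAtil\<close> into the matrix of \<open>kf\<close>, its pure graphon term enters
  \<open>H2\<close>, and the linear terms with \<open>Mh\<close> turn \<open>Ah\<close> into
  \<open>af\<close>. Every \<open>adj n\<close> is kept, because self-adjointness of the flow is
  itself deduced from this form.\<close>

lemma Fk_std:
  assumes P: "P \<in> psd_mats" and Pb: "transpose Pb = Pb"
  shows "Fk P Pb n = hf P Pb + smk g (cQtil c) + (lmul (transpose (af P Pb)) n + rmul (adj n) (af P Pb))
    + (kmult (adj n) (kf P) + kmult (adj (kf P)) n) - kmult (adj n) (lmul (\<rho>f P) n)"
proof -
  have sP: "transpose P = P" using P by (simp add: psd_mats_def)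
  note isy = inv_sym[OF P]
  have 1: "kmult (adj (smk g (G1 P))) (lmul a n) = kmult (adj (lmul (transpose a) (smk g (G1 P)))) n" for a
    by (simp add: adj_lmul kmult_rmul_lmul)
  have 2: "kmult (adj (smk g (G1 P))) k = kmult (adj g1) (lmul (transpose (G1 P)) k)" for k :: "(real^'d^'m) kernel"
  proof -
    have "smk g (G1 P) = lmul (G1 P) g1" by (simp add: g1_def lmul_smk)
    then show ?thesis by (simp add: adj_lmul kmult_rmul_lmul)
  qed
  have U: "Ups P n = lmul (transpose (cB c)) n + smk g (G1 P)" by (simp add: Ups_def G1_def)
  have 3: "kmult (adj (Ups P n)) (lmul (Rinv P) (Ups P n)) = kmult (adj n) (lmul (\<rho>f P) n)
      + kmult (adj n) (smk g (cB c ** Rinv P ** G1 P)) + kmult (adj (smk g (cB c ** Rinv P ** G1 P))) n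
      + kmult (adj g1) (smk g (transpose (G1 P) ** Rinv P ** G1 P))"
  proof -
    have "kmult (adj (Ups P n)) (lmul (Rinv P) (Ups P n))
      = kmult (rmul (adj n) (cB c)) (lmul (Rinv P) (lmul (transpose (cB c)) n))
      + kmult (rmul (adj n) (cB c)) (lmul (Rinv P) (smk g (G1 P)))
      + kmult (adj (smk g (G1 P))) (lmul (Rinv P) (lmul (transpose (cB c)) n))
      + kmult (adj (smk g (G1 P))) (lmul (Rinv P) (smk g (G1 P)))"
      by (simp add: U adj_linear adj_lmul kernel_add)
    also have "kmult (adj (smk g (G1 P))) (lmul (Rinv P) (lmul (transpose (cB c)) n))
        = kmult (adj (smk g (cB c ** Rinv P ** G1 P))) n"
      unfolding lmul_lmul 1 by (simp add: matrix_transpose_mul isy lmul_smk)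
    also have "kmult (adj (smk g (G1 P))) (lmul (Rinv P) (smk g (G1 P)))
        = kmult (adj g1) (smk g (transpose (G1 P) ** Rinv P ** G1 P))"
      unfolding 2 by (simp add: lmul_smk lmul_lmul matrix_mul_assoc)
    finally show ?thesis
      by (simp add: kmult_rmul_lmul lmul_lmul lmul_smk matrix_mul_assoc \<rho>f_def)
  qed
  have 4: "lmul (transpose (Mh P Pb) ** Rinv P) (Ups P n) = lmul (transpose (Mh P Pb) ** Rinv P ** transpose (cB c)) n
      + smk g (transpose (Mh P Pb) ** Rinv P ** G1 P)"
    by (simp add: U kernel_add lmul_lmul lmul_smk)
  have 5: "rmul (adj (Ups P n)) (Rinv P ** Mh P Pb) = adj (lmul (transpose (Mh P Pb) ** Rinv P) (Ups P n))"
    by (simp add: adj_lmul matrix_transpose_mul isy)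
  have 6: "transpose (af P Pb) = transpose Ah - transpose (Mh P Pb) ** Rinv P ** transpose (cB c)"
    unfolding af_def transpose_distribs(2) matrix_transpose_mul isy by (simp add: matrix_mul_assoc)
  have 7: "transpose (transpose (cAtil c) ** Pb) = Pb ** cAtil c"
    "transpose (transpose (cCtil c) ** P ** Ch) = transpose Ch ** P ** cCtil c"
    by (simp_all add: matrix_transpose_mul sP Pb matrix_mul_assoc)
  have 8: "adj (lmul (transpose (Mh P Pb) ** Rinv P ** transpose (cB c)) n) = rmul (adj n) (cB c ** Rinv P ** Mh P Pb)"
    by (simp add: adj_lmul matrix_transpose_mul isy matrix_mul_assoc)
  show ?thesis
    unfolding Fk_def 3 5 4 6 7 hf_def kf_def H1_def H2_def adj_linear 8 kernel_add kernel_diff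
    unfolding af_def kernel_diff kernel_add
    by (simp add: algebra_simps)
qed

lemma kmult_smk: "kmult (smk g M) X = lmul M (kmult g1 X)"
proof -
  have "smk g M = lmul M g1" by (simp add: g1_def lmul_smk)
  then show ?thesis by (simp add: kmult_lmul)
qed

lemma inner_comp_adj: "X \<bullet> kmult (adj K) Y = kmult K X \<bullet> Y"
  by (simp add: inner_comp)

lemma inner_lmul_transpose: "X \<bullet> lmul (transpose a) Y = lmul a X \<bullet> Y"
  by (simp add: inner_lmul)

text \<open>The matrix equation and the kernel equation, both tested with \<open>X\<close>, add up
  to the Riccati equation of the operator \<open>Pb + n\<close>. With the optimal feedback inserted,
  twice the left side is minus a sum of nonnegative terms, one of which is the running cost and
  hence at least \<open>\<delta> * (norm X)\<^sup>2\<close>. Testing with kernels in place of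
  functions of one variable gives the estimate directly in the Hilbert-Schmidt space.\<close>

lemma closed_loop_dissipative:
  fixes X :: "(real^'d^'d) kernel"
  assumes P: "P \<in> psd_mats" and Pb: "transpose Pb = Pb" and ric: "II.ric Pb P = 0"
    and nn: "\<And>X :: (real^'d^'d) kernel. 0 \<le> X \<bullet> kmult n X" and F: "Fk P Pb n = 0" and sym: "adj n = n"
  shows "(lmul Pb X + kmult n X) \<bullet> (lmul (af P Pb) X + kmult (kf P - lmul (\<rho>f P) n) X) \<le> - (\<delta> / 2) * (norm X)\<^sup>2"
proof -
  have sP: "transpose P = P" using P by (simp add: psd_mats_def)
  note isy = inv_sym[OF P]
  define gX where "gX = kmult g1 X"
  define hX where "hX = kmult n X"
  define y where "y = lmul Pb X + hX"
  define AX where "AX = lmul Ah X + lmul (cAtil c) gX"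
  define CX where "CX = lmul Ch X + lmul (cCtil c) gX"
  define MX where "MX = lmul (Mh P Pb) X"
  define UX where "UX = kmult (Ups P n) X"
  define Z where "Z = MX + UX"
  \<comment> \<open>The optimal feedback belonging to \<open>Pb + n\<close>, applied to
    \<open>X\<close>; its two parts come from the matrix and from the kernel.\<close>
  define \<theta> where "\<theta> = - lmul (Rinv P) Z"
  have tP: "lmul P U \<bullet> V = U \<bullet> lmul P V" for U V :: "(real^'d^'d) kernel"
    using inner_lmul[of P U V] by (simp add: sP)
  have tPb: "lmul Pb U \<bullet> V = U \<bullet> lmul Pb V" for U V :: "(real^'d^'d) kernel"
    using inner_lmul[of Pb U V] by (simp add: Pb)
  have tI: "lmul (Rinv P) U \<bullet> V = U \<bullet> lmul (Rinv P) V" for U V :: "(real^'d^'m) kernel"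
    using inner_lmul[of "Rinv P" U V] by (simp add: isy)
  have tP': "U \<bullet> lmul P V = V \<bullet> lmul P U" for U V :: "(real^'d^'d) kernel"
    by (rule trans[OF tP[symmetric] inner_commute])
  have tPb': "U \<bullet> lmul Pb V = V \<bullet> lmul Pb U" for U V :: "(real^'d^'d) kernel"
    by (rule trans[OF tPb[symmetric] inner_commute])
  have tI': "U \<bullet> lmul (Rinv P) V = V \<bullet> lmul (Rinv P) U" for U V :: "(real^'d^'m) kernel"
    by (rule trans[OF tI[symmetric] inner_commute])
  have t1: "X \<bullet> kmult (smk g (Pb ** cAtil c)) X = lmul Pb X \<bullet> lmul (cAtil c) gX"
    by (simp add: kmult_smk gX_def lmul_lmul[symmetric] tPb)
  have t2: "X \<bullet> kmult (adj (smk g (transpose (transpose (cAtil c) ** Pb)))) X = lmul Pb X \<bullet> lmul (cAtil c) gX"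
    unfolding inner_comp_adj
    by (simp add: matrix_transpose_mul Pb kmult_smk gX_def lmul_lmul[symmetric] tPb inner_commute)
  have t3: "X \<bullet> kmult (smk g (transpose Ch ** P ** cCtil c)) X = lmul Ch X \<bullet> lmul P (lmul (cCtil c) gX)"
    by (simp only: kmult_smk gX_def lmul_lmul[symmetric] inner_lmul_transpose)
  have t4: "X \<bullet> kmult (adj (smk g (transpose (transpose (cCtil c) ** P ** Ch)))) X = lmul Ch X \<bullet> lmul P (lmul (cCtil c) gX)"
  proof -
    have "transpose (transpose (cCtil c) ** P ** Ch) = transpose Ch ** P ** cCtil c"
      by (simp add: matrix_transpose_mul sP matrix_mul_assoc)
    then show ?thesis using t3 by (simp add: inner_comp_adj inner_commute)
  qed
  have t5: "X \<bullet> kmult (kmult (adj g1) (smk g (transpose (cCtil c) ** P ** cCtil c))) X = lmul (cCtil c) gX \<bullet> lmul P (lmul (cCtil c) gX)"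
    by (simp only: kmult_assoc inner_comp_adj kmult_smk gX_def lmul_lmul[symmetric] inner_lmul_transpose)
  have t6: "X \<bullet> kmult (lmul (transpose Ah) n) X = lmul Ah X \<bullet> hX"
    by (simp only: kmult_lmul inner_lmul_transpose hX_def)
  have t7: "X \<bullet> kmult (rmul (adj n) Ah) X = lmul Ah X \<bullet> hX"
    by (simp only: kmult_rmul_lmul inner_comp_adj hX_def inner_commute)
  have t8: "X \<bullet> kmult (kmult (adj n) (smk g (cAtil c))) X = hX \<bullet> lmul (cAtil c) gX"
    by (simp only: kmult_assoc inner_comp_adj kmult_smk gX_def hX_def)
  have t9: "X \<bullet> kmult (kmult (adj (smk g (cAtil c))) n) X = hX \<bullet> lmul (cAtil c) gX"
    by (simp only: kmult_assoc inner_comp_adj kmult_smk gX_def hX_def inner_commute)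
  have t10: "0 \<le> X \<bullet> kmult (smk g (cQtil c)) X"
  proof -
    have "rep (smk g (cQtil c)) (\<lambda>z. cG c z *\<^sub>R cQtil c)" by (rule rep_smk[OF rep_g])
    then show ?thesis using kmult_nonneg[OF _ Qtil, of X] by (simp add: rep_def)
  qed
  have t11: "X \<bullet> kmult (kmult (adj g1) (smk g (cQchk c))) X = gX \<bullet> lmul (cQchk c) gX"
    by (simp only: kmult_assoc inner_comp_adj kmult_smk gX_def)
  have t12: "X \<bullet> kmult (lmul (transpose (Mh P Pb) ** Rinv P) (Ups P n)) X = MX \<bullet> lmul (Rinv P) UX"
    by (simp only: kmult_lmul lmul_lmul[symmetric] inner_lmul_transpose MX_def UX_def)
  have t13: "X \<bullet> kmult (rmul (adj (Ups P n)) (Rinv P ** Mh P Pb)) X = MX \<bullet> lmul (Rinv P) UX"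
    by (simp only: kmult_rmul_lmul inner_comp_adj lmul_lmul[symmetric] MX_def[symmetric] UX_def[symmetric]) (rule tI')
  have t14: "X \<bullet> kmult (kmult (adj (Ups P n)) (lmul (Rinv P) (Ups P n))) X = UX \<bullet> lmul (Rinv P) UX"
    by (simp only: kmult_assoc inner_comp_adj kmult_lmul UX_def)
  have E1: "0 = 2 * (lmul Pb X \<bullet> lmul (cAtil c) gX) + 2 * (lmul Ch X \<bullet> lmul P (lmul (cCtil c) gX))
      + lmul (cCtil c) gX \<bullet> lmul P (lmul (cCtil c) gX) + 2 * (lmul Ah X \<bullet> hX) + 2 * (hX \<bullet> lmul (cAtil c) gX)
      + X \<bullet> kmult (smk g (cQtil c)) X + gX \<bullet> lmul (cQchk c) gX - 2 * (MX \<bullet> lmul (Rinv P) UX) - UX \<bullet> lmul (Rinv P) UX"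
  proof -
    have "0 = X \<bullet> kmult (Fk P Pb n) X" by (simp add: F kmult_zero_left)
    also have "\<dots> = X \<bullet> kmult (smk g (Pb ** cAtil c)) X + X \<bullet> kmult (adj (smk g (transpose (transpose (cAtil c) ** Pb)))) X
      + X \<bullet> kmult (smk g (transpose Ch ** P ** cCtil c)) X + X \<bullet> kmult (adj (smk g (transpose (transpose (cCtil c) ** P ** Ch)))) X
      + X \<bullet> kmult (kmult (adj g1) (smk g (transpose (cCtil c) ** P ** cCtil c))) X
      + X \<bullet> kmult (lmul (transpose Ah) n) X + X \<bullet> kmult (rmul (adj n) Ah) X
      + X \<bullet> kmult (kmult (adj n) (smk g (cAtil c))) X + X \<bullet> kmult (kmult (adj (smk g (cAtil c))) n) X
      + X \<bullet> kmult (smk g (cQtil c)) X + X \<bullet> kmult (kmult (adj g1) (smk g (cQchk c))) X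
      - X \<bullet> kmult (lmul (transpose (Mh P Pb) ** Rinv P) (Ups P n)) X
      - X \<bullet> kmult (rmul (adj (Ups P n)) (Rinv P ** Mh P Pb)) X
      - X \<bullet> kmult (kmult (adj (Ups P n)) (lmul (Rinv P) (Ups P n))) X"
      unfolding Fk_def kmult_add_left
        kmult_diff_left inner_add_right inner_diff_right ..
    finally show ?thesis unfolding t1 t2 t3 t4 t5 t6 t7 t8 t9 t11 t12 t13 t14 by linarith
  qed
  have E2: "0 = 2 * (lmul Ah X \<bullet> lmul Pb X) + lmul Ch X \<bullet> lmul P (lmul Ch X) + X \<bullet> lmul (cQ c + cQbar c) X
      - MX \<bullet> lmul (Rinv P) MX"
  proof -
    have M: "II.MM Pb P = Mh P Pb" by (simp add: II.MM_def Mh_def)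
    have "0 = X \<bullet> lmul (II.ric Pb P) X" by (simp add: ric lmul_zero_left)
    also have "\<dots> = X \<bullet> lmul (transpose Ah ** Pb) X + X \<bullet> lmul (Pb ** Ah) X + X \<bullet> lmul (transpose Ch ** P ** Ch) X
        + X \<bullet> lmul (cQ c + cQbar c) X - X \<bullet> lmul (transpose (Mh P Pb) ** Rinv P ** Mh P Pb) X"
      unfolding II.ric_def II_N M
      by (simp only: lmul_add_left[of "_ + _"]
          lmul_add_left[of "_ ** _"]
          lmul_diff_left inner_add_right inner_diff_right)
    also have "X \<bullet> lmul (Pb ** Ah) X = lmul Ah X \<bullet> lmul Pb X"
      unfolding lmul_lmul[symmetric] by (rule tPb')
    finally show ?thesis
      by (simp only: lmul_lmul[symmetric] inner_lmul_transpose MX_def)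
  qed
  have symI: "UX \<bullet> lmul (Rinv P) MX = MX \<bullet> lmul (Rinv P) UX"
    by (rule tI')
  have symP: "lmul (cCtil c) gX \<bullet> lmul P (lmul Ch X) = lmul Ch X \<bullet> lmul P (lmul (cCtil c) gX)"
    by (rule tP')
  \<comment> \<open>Adding the two tested equations supplies the cross terms that complete the
    squares in \<open>CX\<close> and \<open>Z\<close>.\<close>
  have E3: "2 * (y \<bullet> AX) + CX \<bullet> lmul P CX + X \<bullet> lmul (cQ c + cQbar c) X + X \<bullet> kmult (smk g (cQtil c)) X
      + gX \<bullet> lmul (cQchk c) gX - Z \<bullet> lmul (Rinv P) Z = 0"
  proof -
    have a: "y \<bullet> AX = lmul Ah X \<bullet> lmul Pb X + lmul Pb X \<bullet> lmul (cAtil c) gX + lmul Ah X \<bullet> hX + hX \<bullet> lmul (cAtil c) gX"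
      unfolding y_def AX_def inner_add_left inner_add_right by (simp add: inner_commute)
    have b: "CX \<bullet> lmul P CX = lmul Ch X \<bullet> lmul P (lmul Ch X) + 2 * (lmul Ch X \<bullet> lmul P (lmul (cCtil c) gX))
        + lmul (cCtil c) gX \<bullet> lmul P (lmul (cCtil c) gX)"
      unfolding CX_def lmul_add_right inner_add_left inner_add_right symP by linarith
    have d: "Z \<bullet> lmul (Rinv P) Z = MX \<bullet> lmul (Rinv P) MX + 2 * (MX \<bullet> lmul (Rinv P) UX) + UX \<bullet> lmul (Rinv P) UX"
      unfolding Z_def lmul_add_right inner_add_left inner_add_right symI by linarith
    have arith: "2 * (x1 + x2 + x3 + x4) + (x5 + 2 * x6 + x7) + x8 + x9 + x10 - (x11 + 2 * x12 + x13) = 0"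
      if "0 = 2 * x2 + 2 * x6 + x7 + 2 * x3 + 2 * x4 + x9 + x10 - 2 * x12 - x13" "0 = 2 * x1 + x5 + x8 - x11"
      for x1 x2 x3 x4 x5 x6 x7 x8 x9 x10 x11 x12 x13 :: real
      using that by algebra
    show ?thesis unfolding a b d by (rule arith[OF E1 E2])
  qed
  have UX: "UX = lmul (transpose (cB c)) hX + lmul (G1 P) gX"
    unfolding UX_def Ups_def G1_def[symmetric] kmult_add_left kmult_lmul kmult_smk
    by (simp only: hX_def gX_def)
  have Zeq: "Z = lmul (transpose (cB c)) y + lmul (transpose (cD c)) (lmul P CX) + lmul (cS c) X"
    unfolding Z_def MX_def UX y_def CX_def Mh_def G1_def lmul_add_right lmul_lmul
    unfolding lmul_add_left[of "_ + _"]
      lmul_add_left[of "_ ** _"]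
    by (simp add: matrix_mul_assoc)
  have R\<theta>: "lmul (Rmap c P) \<theta> = - Z"
    using I.N_inv(1)[OF P]
    by (simp add: \<theta>_def lmul_minus_right lmul_lmul I_N)
  have e2: "y \<bullet> lmul (cB c) \<theta> = \<theta> \<bullet> Z - lmul (cD c) \<theta> \<bullet> lmul P CX - \<theta> \<bullet> lmul (cS c) X"
  proof -
    have "y \<bullet> lmul (cB c) \<theta> = \<theta> \<bullet> lmul (transpose (cB c)) y" by (simp only: inner_lmul_transpose inner_commute)
    then show ?thesis unfolding Zeq inner_add_right inner_lmul_transpose by linarith
  qed
  have e3: "\<theta> \<bullet> Z = - (\<theta> \<bullet> lmul (cR c) \<theta>) - lmul (cD c) \<theta> \<bullet> lmul P (lmul (cD c) \<theta>)"
  proof -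
    have "- (\<theta> \<bullet> Z) = \<theta> \<bullet> lmul (Rmap c P) \<theta>" by (simp add: R\<theta>)
    also have "\<dots> = \<theta> \<bullet> lmul (cR c) \<theta> + lmul (cD c) \<theta> \<bullet> lmul P (lmul (cD c) \<theta>)"
      unfolding Rmap_def lmul_add_left inner_add_right lmul_lmul[symmetric]
        inner_lmul_transpose ..
    finally show ?thesis by linarith
  qed
  have e4: "Z \<bullet> lmul (Rinv P) Z = - (\<theta> \<bullet> Z)" by (simp add: \<theta>_def inner_commute)
  \<comment> \<open>The closed-loop operator is the open-loop drift driven by the control
    \<open>\<theta>\<close>.\<close>
  have ll: "lmul (af P Pb) X + kmult (kf P - lmul (\<rho>f P) n) X = AX + lmul (cB c) \<theta>"
  proof -
    have "lmul (cB c) \<theta> = - lmul (cB c ** Rinv P) (MX + UX)"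
      by (simp add: \<theta>_def Z_def lmul_minus_right lmul_lmul)
    also have "\<dots> = - lmul (cB c ** Rinv P ** Mh P Pb) X - lmul (\<rho>f P) hX - lmul (cB c ** Rinv P ** G1 P) gX"
      unfolding MX_def UX \<rho>f_def
      by (simp add: lmul_add_right lmul_lmul matrix_mul_assoc)
    finally show ?thesis
      unfolding af_def kf_def kernel_diff kmult_smk kmult_lmul AX_def hX_def[symmetric] gX_def[symmetric] by simp
  qed
  \<comment> \<open>Nonnegativity of the form of \<open>P\<close> at
    \<open>CX + lmul (cD c) \<theta>\<close>, the diffusion under the feedback.\<close>
  have w: "0 \<le> CX \<bullet> lmul P CX + 2 * (lmul (cD c) \<theta> \<bullet> lmul P CX) + lmul (cD c) \<theta> \<bullet> lmul P (lmul (cD c) \<theta>)"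
  proof -
    have "0 * (norm (CX + lmul (cD c) \<theta>))\<^sup>2 \<le> (CX + lmul (cD c) \<theta>) \<bullet> lmul P (CX + lmul (cD c) \<theta>)"
      by (rule inner_lmul_ge) (use P in \<open>simp add: psd_mats_def\<close>)
    moreover have "CX \<bullet> lmul P (lmul (cD c) \<theta>) = lmul (cD c) \<theta> \<bullet> lmul P CX"
      by (rule tP')
    ultimately show ?thesis
      unfolding lmul_add_right inner_add_left inner_add_right by linarith
  qed
  have q: "0 \<le> gX \<bullet> lmul (cQchk c) gX"
    using inner_lmul_ge[of 0 "cQchk c" gX] Qchk by (simp add: psd_mats_def)
  have cost: "\<delta> * (norm X)\<^sup>2 \<le> X \<bullet> lmul (cQ c + cQbar c) X + 2 * (\<theta> \<bullet> lmul (cS c) X) + \<theta> \<bullet> lmul (cR c) \<theta>"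
    by (rule inner_cost_ge[OF cost2])
  have "2 * (y \<bullet> (AX + lmul (cB c) \<theta>)) \<le> - \<delta> * (norm X)\<^sup>2"
    unfolding inner_add_right e2 using E3 e3 e4 w q t10 cost by simp
  then show ?thesis unfolding ll y_def hX_def by simp
qed

end


section \<open>The closed loop\<close>

text \<open>In contrast to \<open>expconv_bilinear\<close> the second factor is only bounded. This
  suits products with the kernel flow, whose exponential convergence is still to be shown.\<close>

lemma expconv_zero_bounded:
  assumes h: "bounded_bilinear h" and f: "expconv f 0" and g: "\<And>s. s \<ge> 0 \<Longrightarrow> norm (g s) \<le> M"
  shows "expconv (\<lambda>s. h (f s) (g s)) 0"
proof -
  interpret bounded_bilinear h by (rule h)
  obtain B where B: "\<And>x y. norm (h x y) \<le> norm x * norm y * B" "B > 0" using pos_bounded by blast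
  obtain K a where K: "K > 0" "a > 0" "\<And>s. s \<ge> 0 \<Longrightarrow> norm (f s - 0) \<le> K * exp (- a * s)"
    using expconvE[OF f] by blast
  show ?thesis
  proof (rule expconvI[OF K(2), of _ _ "K * \<bar>M\<bar> * B"])
    fix s :: real assume s: "s \<ge> 0"
    have "norm (h (f s) (g s)) \<le> norm (f s) * norm (g s) * B" by (rule B)
    also have "\<dots> \<le> (K * exp (- a * s)) * \<bar>M\<bar> * B"
      using K(3)[OF s] g[OF s] B(2) K(1) by (intro mult_right_mono mult_mono) auto
    finally show "norm (h (f s) (g s) - 0) \<le> K * \<bar>M\<bar> * B * exp (- a * s)" by (simp add: algebra_simps)
  qed
qed

text \<open>\<open>adj\<close> is a linear isometric involution, so conjugation by it preserves all
  power bounds; it exchanges left and right multiplications.\<close>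

lemma power_stable_adj:
  fixes l :: "(real^'d^'d) kernel \<Rightarrow> (real^'d^'d) kernel"
  assumes "power_stable l"
  shows "power_stable (\<lambda>E. adj (l (adj E)))"
proof -
  have eq: "((\<lambda>x. x + h *\<^sub>R adj (l (adj x))) ^^ n) x = adj (((\<lambda>x. x + h *\<^sub>R l x) ^^ n) (adj x))" for h n x
    by (induction n) (simp_all add: adj_linear)
  obtain C c h0 where *: "C > 0" "c > 0" "h0 > 0" "\<And>h. h \<in> {0<..h0} \<Longrightarrow> c * h \<le> 1"
    "\<And>h n x. h \<in> {0<..h0} \<Longrightarrow> (norm (((\<lambda>x. x + h *\<^sub>R l x) ^^ n) x))\<^sup>2 \<le> C * (1 - c * h) ^ n * (norm x)\<^sup>2"
    using power_stableE[OF assms] by blast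
  have "(norm (adj (((\<lambda>x. x + h *\<^sub>R l x) ^^ n) (adj x))))\<^sup>2 \<le> C * (1 - c * h) ^ n * (norm x)\<^sup>2"
    if "h \<in> {0<..h0}" for h n x
    using *(5)[OF that, of n "adj x"] by simp
  then show ?thesis
    unfolding power_stable_def eq using *(1-4) by (intro exI[of _ C] exI[of _ c] exI[of _ h0]) simp
qed

section \<open>Time reversal and gluing of horizons\<close>

lemma has_vector_derivative_reverse:
  assumes "(f has_vector_derivative f') (at (T - s) within {0..T})" "s \<in> {0..T}"
  shows "((\<lambda>s. f (T - s)) has_vector_derivative - f') (at s within {0..T})"
proof -
  have im: "(\<lambda>s. T - s) ` {0..T} = {0..T}"
  proof
    show "{0..T} \<subseteq> (\<lambda>s. T - s) ` {0..T}"
    proof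
      fix x assume "x \<in> {0..T}"
      then show "x \<in> (\<lambda>s. T - s) ` {0..T}" by (intro image_eqI[of _ _ "T - x"]) auto
    qed
  qed auto
  have "((\<lambda>s. T - s) has_vector_derivative (- 1)) (at s within {0..T})"
    by (auto intro!: derivative_eq_intros)
  from vector_diff_chain_within[OF this, of f f'] assms(1)
  have "(f \<circ> (\<lambda>s. T - s) has_vector_derivative (- 1) *\<^sub>R f') (at s within {0..T})"
    by (simp only: im)
  then show ?thesis by (simp add: o_def)
qed

text \<open>Differentiability at \<open>s\<close> is local, so it can be read off from any horizon
  containing a neighbourhood of \<open>s\<close> in the half-line; \<open>s + 1\<close> is such a
  horizon.\<close>

lemma flow_glue:
  fixes F :: "real \<Rightarrow> real \<Rightarrow> 'a::real_normed_vector"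
  assumes der: "\<And>T s. T > 0 \<Longrightarrow> s \<in> {0..T} \<Longrightarrow> ((\<lambda>s. F T (T - s)) has_vector_derivative v s) (at s within {0..T})"
    and eq: "\<And>T s. T > 0 \<Longrightarrow> s \<in> {0..T} \<Longrightarrow> F T (T - s) = f s" and s: "s \<ge> 0"
  shows "(f has_vector_derivative v s) (at s within {0..})"
proof -
  have "((\<lambda>x. F (s + 1) (s + 1 - x)) has_vector_derivative v s) (at s within {0..s+1})"
    using s by (intro der) auto
  then have "(f has_vector_derivative v s) (at s within {0..s+1})"
    by (rule has_vector_derivative_transform[rotated 2]) (use eq s in auto)
  moreover have "at s within {0..s+1} = at s within {0..}"
    by (rule at_within_nhd[of _ "{..<s+1}"]) auto
  ultimately show ?thesis by simp
qed

lemma L2_C1_vector_derivative: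
  assumes C1: "L2_C1 unitI2 J f f'" and t: "t \<in> J"
  shows "((\<lambda>t. abs_kernel (f t)) has_vector_derivative abs_kernel (f' t)) (at t within J)"
proof -
  have L: "f s \<in> L2 unitI2" "f' s \<in> L2 unitI2" if "s \<in> J" for s using C1 that by (auto simp: L2_C1_def)
  have lim: "((\<lambda>s. L2_norm unitI2 (\<lambda>x. (f s x - f t x) /\<^sub>R (s - t) - f' t x)) \<longlongrightarrow> 0) (at t within J)"
    using C1 t by (auto simp: L2_C1_def)
  let ?a = "\<lambda>t. abs_kernel (f t)"
  \<comment> \<open>The derivative of a vector-valued curve is defined with the divisor
    \<open>norm (s - t)\<close>, the hypothesis with \<open>s - t\<close>; under the norm the sign
    disappears.\<close>
  have e: "L2_norm unitI2 (\<lambda>x. (f s x - f t x) /\<^sub>R (s - t) - f' t x)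
      = norm ((1 / norm (s - t)) *\<^sub>R (?a s - (?a t + (s - t) *\<^sub>R abs_kernel (f' t))))"
    if s: "s \<in> J" "s \<noteq> t" for s
  proof -
    have "rep ((?a s - ?a t) /\<^sub>R (s - t) - abs_kernel (f' t)) (\<lambda>x. (f s x - f t x) /\<^sub>R (s - t) - f' t x)"
    proof -
      have 1: "rep (?a s - ?a t) (\<lambda>x. f s x - f t x)" by (intro rep_diff rep_abs L s t)
      have "rep ((?a s - ?a t) /\<^sub>R (s - t)) (\<lambda>x. (f s x - f t x) /\<^sub>R (s - t))"
        using 1 unfolding rep_def by (simp add: L2_scaleR scaleR_kernel.abs_eq)
      then show ?thesis by (intro rep_diff rep_abs L t)
    qed
    then have "L2_norm unitI2 (\<lambda>x. (f s x - f t x) /\<^sub>R (s - t) - f' t x)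
        = norm ((?a s - ?a t) /\<^sub>R (s - t) - abs_kernel (f' t))"
      unfolding rep_def using norm_abs_kernel by metis
    also have "(?a s - ?a t) /\<^sub>R (s - t) - abs_kernel (f' t)
        = (1 / (s - t)) *\<^sub>R (?a s - (?a t + (s - t) *\<^sub>R abs_kernel (f' t)))"
      using s by (simp add: diff_diff_eq[symmetric] scaleR_diff_right divide_inverse)
    finally show ?thesis by simp
  qed
  have "((\<lambda>s. norm ((1 / norm (s - t)) *\<^sub>R (?a s - (?a t + (s - t) *\<^sub>R abs_kernel (f' t))))) \<longlongrightarrow> 0) (at t within J)"
    by (rule Lim_transform_eventually[OF lim]) (use e in \<open>simp add: eventually_at_filter\<close>)
  then have "((\<lambda>s. (1 / norm (s - t)) *\<^sub>R (?a s - (?a t + (s - t) *\<^sub>R abs_kernel (f' t)))) \<longlongrightarrow> 0) (at t within J)"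
    by (rule tendsto_norm_zero_cancel)
  then show ?thesis
    unfolding has_vector_derivative_def has_derivative_within
    by (simp add: bounded_linear_scaleR_left)
qed

lemma continuous_bounded_Icc:
  fixes f :: "real \<Rightarrow> 'a::real_normed_vector"
  assumes "\<And>s. s \<in> {0..T} \<Longrightarrow> (f has_vector_derivative f' s) (at s within {0..T})"
  obtains K where "\<And>s. s \<in> {0..T} \<Longrightarrow> norm (f s) \<le> K"
proof -
  have "continuous_on {0..T} f"
    unfolding continuous_on_eq_continuous_within using has_vector_derivative_continuous[OF assms] by blast
  then have "bounded (f ` {0..T})" by (intro compact_imp_bounded compact_continuous_image compact_Icc)
  then show thesis unfolding bounded_iff using that by blast
qed

text \<open>The difference has a form that is both nonnegative and nonpositive, so
  \<open>psd_norm_le\<close> applies with the bound 0.\<close>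

lemma sym_quadratic_eq:
  fixes X Y :: "real^'n^'n"
  assumes "transpose X = X" "transpose Y = Y"
    and "\<And>x. x \<bullet> (X *v x) \<le> x \<bullet> (Y *v x)" "\<And>x. x \<bullet> (Y *v x) \<le> x \<bullet> (X *v x)"
  shows "X = Y"
proof -
  have "norm (X - Y) \<le> real (CARD('n) * CARD('n)) * 0"
    using assms by (intro psd_norm_le) (auto simp: transpose_distribs matrix_vector_distribs inner_diff_right)
  then show ?thesis by simp
qed

context lq
begin

text \<open>Definiteness of \<open>Pb\<close> and nonnegativity of \<open>n\<close> make the form of
  \<open>Pb + n\<close> coercive, and the closed-loop operator is dissipative for it. This gives
  power bounds for left multiplication by the adjoint of that operator, and conjugation by
  \<open>adj\<close> gives them for right multiplication by the operator. The two commute by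
  associativity, so a Lyapunov form of their sum exists.\<close>

lemma closed_loop_lyapunov:
  assumes P: "P \<in> psd_mats" and Pb: "Pb \<in> pd_mats" and ric: "II.ric Pb P = 0"
    and nn: "\<And>X :: (real^'d^'d) kernel. 0 \<le> X \<bullet> kmult n X" and F: "Fk P Pb n = 0" and sym: "adj n = n"
  defines "\<alpha> \<equiv> af P Pb" and "K \<equiv> kf P - lmul (\<rho>f P) n"
  obtains W \<kappa> where "bounded_bilinear W" "\<And>x y. W x y = (W y x :: real)" "\<kappa> > 0"
    "\<And>x. \<kappa> * (norm x)\<^sup>2 \<le> W x x"
    "\<And>E. W E (lmul (transpose \<alpha>) E + kmult (adj K) E + (rmul E \<alpha> + kmult E K)) \<le> - \<kappa> * (norm E)\<^sup>2"
proof -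
  have sPb: "transpose Pb = Pb" using Pb by (simp add: pd_mats_def)
  obtain \<epsilon> where \<epsilon>: "\<epsilon> > 0" "\<And>x. \<epsilon> * (norm x)\<^sup>2 \<le> x \<bullet> (Pb *v x)" using pd_coercive[OF Pb] by blast
  define l where "l = (\<lambda>E :: (real^'d^'d) kernel. lmul \<alpha> E + kmult K E)"
  define l' where "l' = (\<lambda>E :: (real^'d^'d) kernel. lmul (transpose \<alpha>) E + kmult (adj K) E)"
  define pp where "pp = (\<lambda>E :: (real^'d^'d) kernel. lmul Pb E + kmult n E)"
  define l2 where "l2 = (\<lambda>E :: (real^'d^'d) kernel. rmul E \<alpha> + kmult E K)"
  have l2: "l2 = (\<lambda>E. adj (l' (adj E)))"
    by (simp add: fun_eq_iff l2_def l'_def adj_linear adj_lmul adj_comp)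
  have blin: "bounded_linear (\<lambda>E. lmul a E + kmult k E)" for a :: "real^'d^'d" and k :: "(real^'d^'d) kernel"
    by (intro bounded_linear_add bounded_bilinear.bounded_linear_right[OF bounded_bilinear_lmul]
        bounded_bilinear.bounded_linear_right[OF bounded_bilinear_comp])
  have bl2: "bounded_linear l2"
    unfolding l2_def by (intro bounded_linear_add bounded_bilinear.bounded_linear_left[OF bounded_bilinear_rmul]
        bounded_bilinear.bounded_linear_left[OF bounded_bilinear_comp])
  have st: "power_stable l'"
  proof (rule coercive_power_stable(2)[where l = l and p = pp and \<epsilon> = \<epsilon> and \<delta> = "\<delta> / 2"])
    show "bounded_linear l" "bounded_linear pp" unfolding l_def pp_def by (rule blin)+
    show "l x \<bullet> y = x \<bullet> l' y" for x y
      unfolding l_def l'_def inner_add_left inner_add_right inner_lmul inner_comp ..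
    show "pp x \<bullet> y = x \<bullet> pp y" for x y
      unfolding pp_def inner_add_left inner_add_right inner_lmul inner_comp sPb sym ..
    show "\<epsilon> * (norm x)\<^sup>2 \<le> x \<bullet> pp x" for x
      using inner_lmul_ge[OF \<epsilon>(2), of x] nn[of x] by (simp add: pp_def inner_add_right)
    show "pp x \<bullet> l x \<le> - (\<delta> / 2) * (norm x)\<^sup>2" for x
      unfolding pp_def l_def \<alpha>_def K_def by (rule closed_loop_dissipative[OF P sPb ric nn F sym])
  qed (use \<epsilon> \<delta> in auto)
  have bl': "bounded_linear l'" unfolding l'_def by (rule blin)
  have st2: "power_stable l2" unfolding l2 by (rule power_stable_adj[OF st])
  have comm: "l' (l2 E) = l2 (l' E)" for E
    unfolding l'_def l2_def kernel_add rmul_lmul kmult_lmul kmult_assoc kmult_rmul by simp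
  show thesis
  proof (rule lyapunov_form_sum[OF bl' bl2 comm st st2])
    fix W and \<kappa> :: real
    assume W: "bounded_bilinear W" "\<And>x y. W x y = (W y x :: real)" "\<kappa> > 0"
      "\<And>x. \<kappa> * (norm x)\<^sup>2 \<le> W x x" "\<And>x. W x (l' x + l2 x) \<le> - \<kappa> * (norm x)\<^sup>2"
    show thesis
      by (rule that[OF W(1-4)]) (use W(5) in \<open>simp_all add: l'_def l2_def\<close>)
  qed
qed

text \<open>The difference of two inverses is the product of one inverse, the difference of the
  matrices and the other inverse. Both inverses are bounded uniformly by coercivity with the
  constant \<open>r\<close>, since \<open>p s\<close> and \<open>P\<close> are positive
  semidefinite.\<close>

lemma expconv_inv:
  assumes p: "\<And>s. s \<ge> 0 \<Longrightarrow> p s \<in> psd_mats" and P: "P \<in> psd_mats" and e: "expconv p P"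
  shows "expconv (\<lambda>s. Rinv (p s)) (Rinv P)"
proof -
  define k where "k = real (CARD('m) * CARD('m)) * (1 / r)"
  have bd: "norm (Rinv Y) \<le> k" if Y: "Y \<in> psd_mats" for Y
    unfolding k_def
  proof (rule norm_le_matrix_entries)
    fix i j :: 'm
    have "\<bar>Rinv Y $ i $ j\<bar> = \<bar>(Rinv Y *v axis j 1) $ i\<bar>" by (simp add: matrix_vector_mult_basis column_def)
    also have "\<dots> \<le> norm (Rinv Y *v axis j 1)" by (rule component_le_norm_cart)
    also have "\<dots> \<le> 1 / r" using I.N_inv(3)[OF Y, of "axis j 1"] by (simp add: I_N)
    finally show "\<bar>Rinv Y $ i $ j\<bar> \<le> 1 / r" .
  qed
  have "expconv (\<lambda>s. cR c + transpose (cD c) ** p s ** cD c) (cR c + transpose (cD c) ** P ** cD c)"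
    by (intro expconv_add expconv_const expconv_matrix_mult e)
  then have "expconv (\<lambda>s. Rmap c (p s)) (Rmap c P)" by (simp add: Rmap_def)
  then obtain K \<gamma> where K: "K > 0" "\<gamma> > 0" "\<And>s. s \<ge> 0 \<Longrightarrow> norm (Rmap c (p s) - Rmap c P) \<le> K * exp (- \<gamma> * s)"
    using expconvE by blast
  have k0: "k \<ge> 0" using r by (simp add: k_def)
  show ?thesis
  proof (rule expconvI[OF K(2), of _ _ "k * K * k"])
    fix s :: real assume s: "s \<ge> 0"
    note i1 = I.N_inv[OF p[OF s], unfolded I_N] and i2 = I.N_inv[OF P, unfolded I_N]
    have "Rinv (p s) - Rinv P = Rinv (p s) ** (Rmap c P - Rmap c (p s)) ** Rinv P"
      by (simp add: matrix_distribs i1 matrix_mul_assoc[symmetric] i2)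
    then have "norm (Rinv (p s) - Rinv P) \<le> norm (Rinv (p s) ** (Rmap c P - Rmap c (p s))) * norm (Rinv P)"
      by (simp add: norm_matrix_mult_le)
    also have "\<dots> \<le> (norm (Rinv (p s)) * norm (Rmap c P - Rmap c (p s))) * norm (Rinv P)"
      by (intro mult_right_mono norm_matrix_mult_le) simp
    also have "\<dots> \<le> (k * (K * exp (- \<gamma> * s))) * k"
      using K(3)[OF s] bd[OF P] bd[OF p[OF s]] k0 K(1)
      by (intro mult_mono) (auto simp: norm_minus_commute)
    finally show "norm (Rinv (p s) - Rinv P) \<le> k * K * k * exp (- \<gamma> * s)" by (simp add: algebra_simps)
  qed
qed

lemmas expconv_smk = expconv_linear[OF bounded_bilinear.bounded_linear_right[OF bounded_bilinear_smk]]
lemmas expconv_adj = expconv_linear[OF bounded_linear_adj]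
lemmas expconv_comp_right = expconv_linear[OF bounded_bilinear.bounded_linear_right[OF bounded_bilinear_comp]]

lemma expconv_coeffs:
  assumes p: "\<And>s. s \<ge> 0 \<Longrightarrow> p s \<in> psd_mats" and P: "P \<in> psd_mats" and e: "expconv p P" and eb: "expconv pb Pb"
  shows "expconv (\<lambda>s. af (p s) (pb s)) (af P Pb)" "expconv (\<lambda>s. kf (p s)) (kf P)"
    "expconv (\<lambda>s. \<rho>f (p s)) (\<rho>f P)" "expconv (\<lambda>s. hf (p s) (pb s)) (hf P Pb)"
    "expconv (\<lambda>s. G1 (p s)) (G1 P)"
proof -
  note i = expconv_inv[OF p P e]
  have Mh: "expconv (\<lambda>s. Mh (p s) (pb s)) (Mh P Pb)"
    unfolding Mh_def by (intro expconv_add expconv_const expconv_matrix_mult e eb)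
  show G: "expconv (\<lambda>s. G1 (p s)) (G1 P)"
    unfolding G1_def by (intro expconv_const expconv_matrix_mult e)
  show "expconv (\<lambda>s. af (p s) (pb s)) (af P Pb)"
    unfolding af_def by (intro expconv_diff expconv_const expconv_matrix_mult i Mh)
  show "expconv (\<lambda>s. kf (p s)) (kf P)"
    unfolding kf_def by (intro expconv_smk expconv_diff expconv_const expconv_matrix_mult i G)
  show "expconv (\<lambda>s. \<rho>f (p s)) (\<rho>f P)"
    unfolding \<rho>f_def by (intro expconv_const expconv_matrix_mult i)
  have H1: "expconv (\<lambda>s. H1 (p s) (pb s)) (H1 P Pb)"
    unfolding H1_def by (intro expconv_diff expconv_add expconv_const expconv_matrix_mult expconv_transpose i G Mh e eb)
  have H2: "expconv (\<lambda>s. H2 (p s)) (H2 P)"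
    unfolding H2_def by (intro expconv_diff expconv_add expconv_const expconv_matrix_mult expconv_transpose i G e)
  show "expconv (\<lambda>s. hf (p s) (pb s)) (hf P Pb)"
    unfolding hf_def by (intro expconv_add expconv_smk expconv_adj expconv_comp_right H1 H2)
qed

end


section \<open>Flows and convergence\<close>

lemma norm_sum6:
  fixes a :: "'a::real_normed_vector"
  shows "norm (a + b + c + d - e - f) \<le> norm a + norm b + norm c + norm d + norm e + norm f"
  using norm_triangle_ineq4[of "a + b + c + d - e" f] norm_triangle_ineq4[of "a + b + c + d" e]
    norm_triangle_ineq[of "a + b + c" d] norm_triangle_ineq[of "a + b" c] norm_triangle_ineq[of a b]
  by linarith

lemma expconv_bounded_ex:
  assumes "expconv f l"
  shows "\<exists>K>0. \<forall>s\<ge>0. norm (f s) \<le> K"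
  by (rule expconv_bounded[OF assms]) auto

lemma rep_norm: "rep k f \<Longrightarrow> norm k = L2_norm unitI2 f"
  by (simp add: rep_def norm_abs_kernel)

text \<open>Time \<open>t\<close> with horizon \<open>T\<close> is the reversed time
  \<open>s = T - t\<close>. Thus \<open>LamT T 0\<close> is the reversed kernel flow at time
  \<open>T\<close>, and \<open>conv\<close> says that this flow tends to
  \<open>\<Lambda>\<close>.\<close>

locale lq_flow = lq c \<delta> r for c :: "('d::finite, 'm::finite) lq_coeffs" and \<delta> r +
  fixes P Pibar :: "real^'d^'d" and PT PibarT :: "real \<Rightarrow> real \<Rightarrow> real^'d^'d"
    and LamT :: "real \<Rightarrow> real \<Rightarrow> real \<times> real \<Rightarrow> real^'d^'d" and \<Lambda> :: "real \<times> real \<Rightarrow> real^'d^'d"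
  assumes fhP: "\<And>T. T > 0 \<Longrightarrow> finite_horizon_P c T (PT T)"
    and fhPb: "\<And>T. T > 0 \<Longrightarrow> finite_horizon_Pibar c T (PT T) (PibarT T)"
    and fhL: "\<And>T. T > 0 \<Longrightarrow> finite_horizon_Lambda c T (PT T) (PibarT T) (LamT T)"
    and are: "algebraic_Riccati c P Pibar"
    and alg: "algebraic_Lambda c P (Pibar - P) \<Lambda>"
    and nn: "nonneg_kernel \<Lambda>"
    and conv: "((\<lambda>T. L2_norm unitI2 (\<lambda>z. LamT T 0 z - \<Lambda> z)) \<longlongrightarrow> 0) at_top"
begin

section \<open>The matrix flows of \<open>P\<close> and \<open>\<Pi>bar\<close>\<close>

lemma P_psd: "P \<in> psd_mats" "Pibar \<in> psd_mats"
  using are unfolding algebraic_Riccati_def pd_mats_def psd_mats_def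
  by (auto, (metis inner_zero_left less_imp_le order_refl)+)

lemma ric_P: "I.ric P P = 0" "II.ric Pibar P = 0"
  using are by (auto simp: algebraic_Riccati_def I_ric II_ric)

lemma PT_reverse:
  assumes "T > 0" "s \<in> {0..T}"
  shows "((\<lambda>s. PT T (T - s)) has_vector_derivative I.ric (PT T (T - s)) (PT T (T - s))) (at s within {0..T})"
    and "PT T (T - s) \<in> psd_mats"
proof -
  have t: "T - s \<in> {0..T}" using assms by auto
  obtain P' where P': "C1_curve {0..T} (PT T) P'" "\<forall>t\<in>{0..T}.
      P' t + Qmap c (PT T t) - transpose (Mmap c (PT T t)) ** Rinv (PT T t) ** Mmap c (PT T t) = 0"
    using fhP[OF assms(1)] unfolding finite_horizon_P_def by blast
  have e: "- P' (T - s) = I.ric (PT T (T - s)) (PT T (T - s))"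
    using bspec[OF P'(2) t] unfolding I_ric by (simp add: eq_neg_iff_add_eq_0 algebra_simps)
  have "(PT T has_vector_derivative P' (T - s)) (at (T - s) within {0..T})"
    using P'(1) t by (simp add: C1_curve_def)
  from has_vector_derivative_reverse[OF this assms(2)]
  show "((\<lambda>s. PT T (T - s)) has_vector_derivative I.ric (PT T (T - s)) (PT T (T - s))) (at s within {0..T})"
    by (simp add: e)
  show "PT T (T - s) \<in> psd_mats"
    using fhP[OF assms(1)] t by (simp add: finite_horizon_P_def)
qed

lemma PT_end: "T > 0 \<Longrightarrow> PT T T = 0"
  using fhP by (simp add: finite_horizon_P_def)

text \<open>On the common interval of reversed time both curves solve the same equation from the
  value 0, so \<open>ric_mono\<close> compares them. Exchanging the horizons gives the opposite
  inequality: the value depends only on the distance \<open>s\<close> from the terminal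
  time.\<close>

lemma PT_le:
  assumes T: "T1 > 0" "T2 > 0" and s: "s \<in> {0..T1}" "s \<in> {0..T2}"
  shows "x \<bullet> (PT T1 (T1 - s) *v x) \<le> x \<bullet> (PT T2 (T2 - s) *v x)"
proof -
  define T where "T = min T1 T2"
  have sub: "u \<in> {0..T} \<Longrightarrow> u \<in> {0..T1} \<and> u \<in> {0..T2}" for u by (auto simp: T_def)
  have d1: "((\<lambda>s. PT T1 (T1 - s)) has_vector_derivative I.ric (PT T1 (T1 - u)) (PT T1 (T1 - u))) (at u within {0..T})"
    if "u \<in> {0..T}" for u
    by (rule has_vector_derivative_within_subset[OF PT_reverse(1)[OF T(1)]]) (use sub[OF that] in \<open>auto simp: T_def\<close>)
  have d2: "((\<lambda>s. PT T2 (T2 - s)) has_vector_derivative I.ric (PT T2 (T2 - u)) (PT T2 (T2 - u))) (at u within {0..T})"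
    if "u \<in> {0..T}" for u
    by (rule has_vector_derivative_within_subset[OF PT_reverse(1)[OF T(2)]]) (use sub[OF that] in \<open>auto simp: T_def\<close>)
  obtain k where k: "\<And>u. u \<in> {0..T} \<Longrightarrow> norm (PT T2 (T2 - u)) \<le> k"
    using continuous_bounded_Icc[OF d2] by blast
  have psd: "PT T1 (T1 - u) \<in> psd_mats" "PT T2 (T2 - u) \<in> psd_mats" if "u \<in> {0..T}" for u
    using PT_reverse(2) T sub[OF that] by auto
  have sym: "transpose (PT T1 (T1 - u)) = PT T1 (T1 - u)" "transpose (PT T2 (T2 - u)) = PT T2 (T2 - u)" if "u \<in> {0..T}" for u
    using psd[OF that] by (auto simp: psd_mats_def)
  have t: "s \<in> {0..T}" using s by (auto simp: T_def)
  show ?thesis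
    by (rule I.ric_mono[OF d1 d2 sym psd k k _ _ t]) (simp_all add: PT_end T)
qed

lemma PT_unique:
  assumes "T1 > 0" "T2 > 0" "s \<in> {0..T1}" "s \<in> {0..T2}"
  shows "PT T1 (T1 - s) = PT T2 (T2 - s)"
proof (rule sym_quadratic_eq)
  show "transpose (PT T1 (T1 - s)) = PT T1 (T1 - s)" "transpose (PT T2 (T2 - s)) = PT T2 (T2 - s)"
    using PT_reverse(2)[OF assms(1,3)] PT_reverse(2)[OF assms(2,4)] by (auto simp: psd_mats_def)
qed (use PT_le assms in blast)+

text \<open>The common value of all horizons at reversed time \<open>s\<close>. The horizon
  \<open>s + 1\<close> is positive also for \<open>s = 0\<close>.\<close>

definition p where "p s = PT (s + 1) 1"

lemma PT_p: "T > 0 \<Longrightarrow> s \<in> {0..T} \<Longrightarrow> PT T (T - s) = p s"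
  using PT_unique[of T "s + 1" s] by (simp add: p_def)

lemma p_psd: "s \<ge> 0 \<Longrightarrow> p s \<in> psd_mats"
  using PT_reverse(2)[of "s + 1" s] by (simp add: p_def)

lemma p_der: "s \<ge> 0 \<Longrightarrow> (p has_vector_derivative I.ric (p s) (p s)) (at s within {0..})"
proof (rule flow_glue)
  fix T s :: real assume "T > 0" "s \<in> {0..T}"
  then show "((\<lambda>s. PT T (T - s)) has_vector_derivative I.ric (p s) (p s)) (at s within {0..T})"
    using PT_reverse(1)[of T s] by (simp add: PT_p)
qed (use PT_p in auto)

lemma p_zero: "p 0 = 0"
  using PT_end[of 1] by (simp add: p_def)

lemma expconv_p: "expconv p P" and p_le: "s \<ge> 0 \<Longrightarrow> x \<bullet> (p s *v x) \<le> x \<bullet> (P *v x)"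
proof -
  have alt: "(\<forall>s\<ge>0. p s = p s) \<and> P = P \<or> (\<forall>s\<ge>0. \<forall>x. x \<bullet> (p s *v x) \<le> x \<bullet> (P *v x)) \<and> expconv p P"
    by simp
  show "expconv p P" by (rule I.ric_decay(1)[OF p_der p_psd p_zero p_psd P_psd(1) P_psd(1) ric_P(1) alt])
  show "s \<ge> 0 \<Longrightarrow> x \<bullet> (p s *v x) \<le> x \<bullet> (P *v x)"
    by (rule I.ric_decay(2)[OF p_der p_psd p_zero p_psd P_psd(1) P_psd(1) ric_P(1) alt])
qed

text \<open>As \<open>PT T (T - s)\<close> is \<open>p s\<close> for every horizon, the equation of
  \<open>\<Pi>bar\<close> has the same time-dependent coefficient for all horizons.\<close>

lemma PibarT_reverse:
  assumes "T > 0" "s \<in> {0..T}"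
  shows "((\<lambda>s. PibarT T (T - s)) has_vector_derivative II.ric (PibarT T (T - s)) (p s)) (at s within {0..T})"
    and "PibarT T (T - s) \<in> psd_mats"
proof -
  have t: "T - s \<in> {0..T}" using assms by auto
  obtain P' where P': "C1_curve {0..T} (PibarT T) P'" "\<forall>t\<in>{0..T}.
      P' t + Qhat c (PT T t) (PibarT T t - PT T t)
       - transpose (Mhat c (PT T t) (PibarT T t - PT T t)) ** Rinv (PT T t) ** Mhat c (PT T t) (PibarT T t - PT T t) = 0"
    using fhPb[OF assms(1)] unfolding finite_horizon_Pibar_def by blast
  have e: "- P' (T - s) = II.ric (PibarT T (T - s)) (p s)"
    using bspec[OF P'(2) t] unfolding II_ric PT_p[OF assms] by (simp add: eq_neg_iff_add_eq_0 algebra_simps)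
  have "(PibarT T has_vector_derivative P' (T - s)) (at (T - s) within {0..T})"
    using P'(1) t by (simp add: C1_curve_def)
  from has_vector_derivative_reverse[OF this assms(2)]
  show "((\<lambda>s. PibarT T (T - s)) has_vector_derivative II.ric (PibarT T (T - s)) (p s)) (at s within {0..T})"
    by (simp add: e)
  show "PibarT T (T - s) \<in> psd_mats"
    using fhPb[OF assms(1)] t by (simp add: finite_horizon_Pibar_def)
qed

lemma PibarT_end: "T > 0 \<Longrightarrow> PibarT T T = 0"
  using fhPb by (simp add: finite_horizon_Pibar_def)

lemma PibarT_le:
  assumes T: "T1 > 0" "T2 > 0" and s: "s \<in> {0..T1}" "s \<in> {0..T2}"
  shows "x \<bullet> (PibarT T1 (T1 - s) *v x) \<le> x \<bullet> (PibarT T2 (T2 - s) *v x)"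
proof -
  define T where "T = min T1 T2"
  have sub: "u \<in> {0..T} \<Longrightarrow> u \<in> {0..T1} \<and> u \<in> {0..T2}" for u by (auto simp: T_def)
  have d1: "((\<lambda>s. PibarT T1 (T1 - s)) has_vector_derivative II.ric (PibarT T1 (T1 - u)) (p u)) (at u within {0..T})"
    if "u \<in> {0..T}" for u
    by (rule has_vector_derivative_within_subset[OF PibarT_reverse(1)[OF T(1)]]) (use sub[OF that] in \<open>auto simp: T_def\<close>)
  have d2: "((\<lambda>s. PibarT T2 (T2 - s)) has_vector_derivative II.ric (PibarT T2 (T2 - u)) (p u)) (at u within {0..T})"
    if "u \<in> {0..T}" for u
    by (rule has_vector_derivative_within_subset[OF PibarT_reverse(1)[OF T(2)]]) (use sub[OF that] in \<open>auto simp: T_def\<close>)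
  obtain k1 where k1: "\<And>u. u \<in> {0..T} \<Longrightarrow> norm (PibarT T2 (T2 - u)) \<le> k1"
    using continuous_bounded_Icc[OF d2] by blast
  obtain k2 where k2: "\<And>u. u \<ge> 0 \<Longrightarrow> norm (p u) \<le> k2"
    using expconv_bounded[OF expconv_p] by blast
  have k: "norm (PibarT T2 (T2 - u)) \<le> max k1 k2" "norm (p u) \<le> max k1 k2" if "u \<in> {0..T}" for u
    using k1[OF that] k2[of u] that by auto
  have sym: "transpose (PibarT T1 (T1 - u)) = PibarT T1 (T1 - u)" "transpose (PibarT T2 (T2 - u)) = PibarT T2 (T2 - u)"
    if "u \<in> {0..T}" for u
    using PibarT_reverse(2) T sub[OF that] by (auto simp: psd_mats_def)
  have psd: "p u \<in> psd_mats" if "u \<in> {0..T}" for u using p_psd that by simp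
  have t: "s \<in> {0..T}" using s by (auto simp: T_def)
  show ?thesis
    by (rule II.ric_mono[OF d1 d2 sym psd psd k _ _ t]) (simp_all add: PibarT_end T)
qed

lemma PibarT_unique:
  assumes "T1 > 0" "T2 > 0" "s \<in> {0..T1}" "s \<in> {0..T2}"
  shows "PibarT T1 (T1 - s) = PibarT T2 (T2 - s)"
proof (rule sym_quadratic_eq)
  show "transpose (PibarT T1 (T1 - s)) = PibarT T1 (T1 - s)" "transpose (PibarT T2 (T2 - s)) = PibarT T2 (T2 - s)"
    using PibarT_reverse(2)[OF assms(1,3)] PibarT_reverse(2)[OF assms(2,4)] by (auto simp: psd_mats_def)
qed (use PibarT_le assms in blast)+

definition pb where "pb s = PibarT (s + 1) 1"

lemma PibarT_pb: "T > 0 \<Longrightarrow> s \<in> {0..T} \<Longrightarrow> PibarT T (T - s) = pb s"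
  using PibarT_unique[of T "s + 1" s] by (simp add: pb_def)

lemma pb_psd: "s \<ge> 0 \<Longrightarrow> pb s \<in> psd_mats"
  using PibarT_reverse(2)[of "s + 1" s] by (simp add: pb_def)

lemma pb_der: "s \<ge> 0 \<Longrightarrow> (pb has_vector_derivative II.ric (pb s) (p s)) (at s within {0..})"
proof (rule flow_glue)
  fix T s :: real assume "T > 0" "s \<in> {0..T}"
  then show "((\<lambda>s. PibarT T (T - s)) has_vector_derivative II.ric (pb s) (p s)) (at s within {0..T})"
    using PibarT_reverse(1)[of T s] by (simp add: PibarT_pb)
qed (use PibarT_pb in auto)

text \<open>Here \<open>p\<close> enters as data that stays below \<open>P\<close> and converges
  exponentially, which is the second alternative of \<open>ric_decay\<close>; the matrix flow
  \<open>p\<close> itself was treated by the first.\<close>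

lemma expconv_pb: "expconv pb Pibar"
proof (rule II.ric_decay(1)[OF pb_der pb_psd _ p_psd P_psd(2) P_psd(1) ric_P(2)])
  show "pb 0 = 0" using PibarT_end[of 1] by (simp add: pb_def)
  show "(\<forall>s\<ge>0. p s = pb s) \<and> P = Pibar \<or> (\<forall>s\<ge>0. \<forall>x. x \<bullet> (p s *v x) \<le> x \<bullet> (P *v x)) \<and> expconv p P"
    using p_le expconv_p by blast
qed

lemmas coeffs = expconv_coeffs[OF p_psd P_psd(1) expconv_p expconv_pb]

section \<open>The kernel flow\<close>

definition F where "F s N = Fk (p s) (pb s) N"

lemma F_std:
  assumes "s \<ge> 0"
  shows "F s N = hf (p s) (pb s) + smk g (cQtil c) + (lmul (transpose (af (p s) (pb s))) N + rmul (adj N) (af (p s) (pb s)))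
    + (kmult (adj N) (kf (p s)) + kmult (adj (kf (p s))) N) - kmult (adj N) (lmul (\<rho>f (p s)) N)"
  unfolding F_def by (rule Fk_std[OF p_psd[OF assms]]) (use pb_psd[OF assms] in \<open>simp add: psd_mats_def\<close>)

definition nT where "nT T s = abs_kernel (LamT T (T - s))"

lemma nT_der:
  assumes T: "T > 0" and s: "s \<in> {0..T}"
  shows "LamT T (T - s) \<in> L2 unitI2"
    "(nT T has_vector_derivative F s (nT T s)) (at s within {0..T})" "nT T 0 = 0"
proof -
  have t: "T - s \<in> {0..T}" using s by auto
  obtain L' where L': "L2_C1 unitI2 {0..T} (LamT T) L'"
    "\<And>t. t \<in> {0..T} \<Longrightarrow> AE z in unitI2. L' t z + Fmap c (PT T t) (PibarT T t - PT T t) (LamT T t) z = 0"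
    using fhL[OF T] unfolding finite_horizon_Lambda_def by blast
  have L2: "LamT T u \<in> L2 unitI2" "L' u \<in> L2 unitI2" if "u \<in> {0..T}" for u
    using L'(1) that by (auto simp: L2_C1_def)
  show "LamT T (T - s) \<in> L2 unitI2" by (rule L2[OF t])
  have r: "rep (F s (nT T s)) (Fmap c (PT T (T - s)) (PibarT T (T - s) - PT T (T - s)) (LamT T (T - s)))"
    unfolding F_def nT_def PT_p[OF T s] PibarT_pb[OF T s] by (rule rep_Fk[OF L2(1)[OF t]])
  have "AE z in unitI2. - L' (T - s) z = Fmap c (PT T (T - s)) (PibarT T (T - s) - PT T (T - s)) (LamT T (T - s)) z"
    using L'(2)[OF t] by eventually_elim (simp add: neg_eq_iff_add_eq_0)
  then have "abs_kernel (\<lambda>z. - L' (T - s) z) = F s (nT T s)"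
    unfolding r[unfolded rep_def, THEN conjunct2]
    by (rule iffD2[OF abs_kernel_eq_iff[OF L2_minus[OF L2(2)[OF t]] r[unfolded rep_def, THEN conjunct1]]])
  then have e: "- abs_kernel (L' (T - s)) = F s (nT T s)"
    using uminus_kernel.abs_eq[of "L' (T - s)"] L2(2)[OF t] by simp
  show "(nT T has_vector_derivative F s (nT T s)) (at s within {0..T})"
    using has_vector_derivative_reverse[OF L2_C1_vector_derivative[OF L'(1) t] s]
    unfolding e nT_def[symmetric] .
  have TT: "T \<in> {0..T}" using T by simp
  have "AE z in unitI2. LamT T T z = 0" using fhL[OF T] by (simp add: finite_horizon_Lambda_def)
  then have "abs_kernel (LamT T T) = abs_kernel (\<lambda>_. 0)"
    by (rule iffD2[OF abs_kernel_eq_iff[OF L2(1)[OF TT] L2_zero]])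
  then show "nT T 0 = 0" by (simp add: nT_def zero_kernel_def)
qed

text \<open>On a compact interval both solutions are bounded, so the quadratic field is Lipschitz
  along them and Gronwall's inequality shows that their difference vanishes.\<close>

lemma nT_unique:
  assumes T: "T1 > 0" "T2 > 0" and s: "s \<in> {0..T1}" "s \<in> {0..T2}"
  shows "nT T1 s = nT T2 s"
proof -
  define T where "T = min T1 T2"
  have sub: "u \<in> {0..T} \<Longrightarrow> u \<in> {0..T1} \<and> u \<in> {0..T2}" for u by (auto simp: T_def)
  have d1: "(nT T1 has_vector_derivative F u (nT T1 u)) (at u within {0..T})" if "u \<in> {0..T}" for u
    by (rule has_vector_derivative_within_subset[OF nT_der(2)[OF T(1)]]) (use sub[OF that] in \<open>auto simp: T_def\<close>)
  have d2: "(nT T2 has_vector_derivative F u (nT T2 u)) (at u within {0..T})" if "u \<in> {0..T}" for u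
    by (rule has_vector_derivative_within_subset[OF nT_der(2)[OF T(2)]]) (use sub[OF that] in \<open>auto simp: T_def\<close>)
  obtain K1 where K1: "\<And>u. u \<in> {0..T} \<Longrightarrow> norm (nT T1 u) \<le> K1" using continuous_bounded_Icc[OF d1] by blast
  obtain K2 where K2: "\<And>u. u \<in> {0..T} \<Longrightarrow> norm (nT T2 u) \<le> K2" using continuous_bounded_Icc[OF d2] by blast
  obtain Ka where "Ka > 0" and Ka: "\<And>u. u \<ge> 0 \<Longrightarrow> norm (af (p u) (pb u)) \<le> Ka" using expconv_bounded_ex[OF coeffs(1)] by blast
  obtain Kk where "Kk > 0" and Kk: "\<And>u. u \<ge> 0 \<Longrightarrow> norm (kf (p u)) \<le> Kk" using expconv_bounded_ex[OF coeffs(2)] by blast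
  obtain Kr where Kr: "Kr > 0" "\<And>u. u \<ge> 0 \<Longrightarrow> norm (\<rho>f (p u)) \<le> Kr" using expconv_bounded_ex[OF coeffs(3)] by blast
  \<comment> \<open>One summand for each of the six terms of \<open>eq\<close>. The last two arise
    from changing one factor at a time in the quadratic term, hence one bound from each
    solution.\<close>
  define C where "C = Ka + Ka + Kk + Kk + Kr * K1 + K2 * Kr"
  have t: "s \<in> {0..T}" using s by (auto simp: T_def)
  have "nT T1 s - nT T2 s = 0"
  proof (rule linear_growth_zero[where T = T and f = "\<lambda>s. nT T1 s - nT T2 s" and f' = "\<lambda>u. F u (nT T1 u) - F u (nT T2 u)" and C = C])
    fix u assume u: "u \<in> {0..T}"
    show "((\<lambda>s. nT T1 s - nT T2 s) has_vector_derivative F u (nT T1 u) - F u (nT T2 u)) (at u within {0..T})"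
      by (intro has_vector_derivative_diff d1 d2 u)
    have u0: "u \<ge> 0" using u by simp
    let ?D = "nT T1 u - nT T2 u" and ?a = "af (p u) (pb u)" and ?k = "kf (p u)" and ?r = "\<rho>f (p u)"
    have eq: "F u (nT T1 u) - F u (nT T2 u) = lmul (transpose ?a) ?D + rmul (adj ?D) ?a + kmult (adj ?D) ?k
        + kmult (adj ?k) ?D - kmult (adj ?D) (lmul ?r (nT T1 u)) - kmult (adj (nT T2 u)) (lmul ?r ?D)"
      unfolding F_std[OF u0] adj_linear kernel_diff by simp
    have "norm (F u (nT T1 u) - F u (nT T2 u)) \<le> norm (lmul (transpose ?a) ?D) + norm (rmul (adj ?D) ?a) + norm (kmult (adj ?D) ?k)
        + norm (kmult (adj ?k) ?D) + norm (kmult (adj ?D) (lmul ?r (nT T1 u))) + norm (kmult (adj (nT T2 u)) (lmul ?r ?D))"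
      unfolding eq by (rule norm_sum6)
    also have "\<dots> \<le> Ka * norm ?D + norm ?D * Ka + norm ?D * Kk + Kk * norm ?D
        + norm ?D * (Kr * K1) + K2 * (Kr * norm ?D)"
    proof (intro add_mono)
      show "norm (lmul (transpose ?a) ?D) \<le> Ka * norm ?D"
        using mult_right_mono[OF Ka[OF u0] norm_ge_zero[of ?D]] norm_lmul[of "transpose ?a" ?D] by simp
      show "norm (rmul (adj ?D) ?a) \<le> norm ?D * Ka"
        using mult_left_mono[OF Ka[OF u0] norm_ge_zero[of ?D]] norm_rmul[of "adj ?D" ?a] by simp
      show "norm (kmult (adj ?D) ?k) \<le> norm ?D * Kk"
        using mult_left_mono[OF Kk[OF u0] norm_ge_zero[of ?D]] norm_comp[of "adj ?D" ?k] by simp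
      show "norm (kmult (adj ?k) ?D) \<le> Kk * norm ?D"
        using mult_right_mono[OF Kk[OF u0] norm_ge_zero[of ?D]] norm_comp[of "adj ?k" ?D] by simp
      have n5: "norm (lmul ?r (nT T1 u)) \<le> Kr * K1"
        by (rule order_trans[OF norm_lmul mult_mono[OF Kr(2)[OF u0] K1[OF u]]]) (use Kr in auto)
      show "norm (kmult (adj ?D) (lmul ?r (nT T1 u))) \<le> norm ?D * (Kr * K1)"
        by (rule order_trans[OF norm_comp]) (simp add: mult_left_mono[OF n5])
      have "norm (lmul ?r ?D) \<le> Kr * norm ?D"
        by (rule order_trans[OF norm_lmul mult_right_mono[OF Kr(2)[OF u0]]]) simp
      moreover have "0 \<le> K2" using K2[OF u] by (rule order_trans[OF norm_ge_zero])
      ultimately have "norm (nT T2 u) * norm (lmul ?r ?D) \<le> K2 * (Kr * norm ?D)"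
        using K2[OF u] by (intro mult_mono) auto
      then show "norm (kmult (adj (nT T2 u)) (lmul ?r ?D)) \<le> K2 * (Kr * norm ?D)"
        using norm_comp[of "adj (nT T2 u)" "lmul ?r ?D"] by simp
    qed
    also have "\<dots> = C * norm ?D" by (simp add: C_def algebra_simps)
    finally show "norm (F u (nT T1 u) - F u (nT T2 u)) \<le> C * norm ?D" .
  next
    have "0 \<in> {0..T1}" "0 \<in> {0..T2}" using T by auto
    then show "nT T1 0 - nT T2 0 = 0" by (simp only: nT_der(3)[OF T(1)] nT_der(3)[OF T(2)] diff_self)
    show "s \<in> {0..T}" by (rule t)
  qed
  then show ?thesis by simp
qed

definition n where "n s = nT (s + 1) s"

lemma nT_n: "T > 0 \<Longrightarrow> s \<in> {0..T} \<Longrightarrow> nT T s = n s"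
  unfolding n_def by (rule nT_unique) auto

lemma n_der: "s \<ge> 0 \<Longrightarrow> (n has_vector_derivative F s (n s)) (at s within {0..})"
proof (rule flow_glue[where F = "\<lambda>T t. nT T (T - t)"])
  fix T s :: real assume "T > 0" "s \<in> {0..T}"
  then show "((\<lambda>s. nT T (T - (T - s))) has_vector_derivative F s (n s)) (at s within {0..T})"
    using nT_der(2)[of T s] by (simp add: nT_n)
qed (use nT_n in auto)

lemma n_zero: "n 0 = 0"
  using nT_der(3)[of 1 0] by (simp add: n_def)

definition L where "L = abs_kernel \<Lambda>"

lemma L2_Lam: "\<Lambda> \<in> L2 unitI2"
  using alg by (simp add: algebraic_Lambda_def)

lemma n_lim: "(n \<longlongrightarrow> L) at_top"
proof -
  have eq: "L2_norm unitI2 (\<lambda>z. LamT T 0 z - \<Lambda> z) = dist (n T) L" if T: "T > 0" for T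
  proof -
    have TT: "T \<in> {0..T}" using T by simp
    have LL: "LamT T 0 \<in> L2 unitI2" using nT_der(1)[OF T TT] by (simp only: diff_self)
    have e: "n T = abs_kernel (LamT T 0)" unfolding nT_n[OF T TT, symmetric] nT_def by (simp only: diff_self)
    have "rep (n T - L) (\<lambda>z. LamT T 0 z - \<Lambda> z)"
      unfolding e L_def by (rule rep_diff[OF rep_abs[OF LL] rep_abs[OF L2_Lam]])
    then show ?thesis unfolding dist_norm by (rule rep_norm[symmetric])
  qed
  have "\<forall>\<^sub>F T in at_top. L2_norm unitI2 (\<lambda>z. LamT T 0 z - \<Lambda> z) = dist (n T) L"
    using eventually_gt_at_top[of 0] by eventually_elim (rule eq)
  then have "((\<lambda>T. dist (n T) L) \<longlongrightarrow> 0) at_top"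
    by (rule Lim_transform_eventually[OF conv])
  then show ?thesis by (rule iffD2[OF tendsto_dist_iff])
qed

lemma F_inf: "Fk P Pibar L = 0"
proof -
  have r: "rep (Fk P Pibar L) (Fmap c P (Pibar - P) \<Lambda>)" unfolding L_def by (rule rep_Fk[OF L2_Lam])
  have "AE z in unitI2. Fmap c P (Pibar - P) \<Lambda> z = 0" using alg by (simp add: algebraic_Lambda_def)
  then have "abs_kernel (Fmap c P (Pibar - P) \<Lambda>) = abs_kernel (\<lambda>_. 0)"
    by (rule iffD2[OF abs_kernel_eq_iff[OF r[unfolded rep_def, THEN conjunct1] L2_zero]])
  then show ?thesis using r by (simp add: rep_def zero_kernel_def)
qed

lemma Pibar_sym: "transpose Pibar = Pibar"
  using P_psd(2) by (simp add: psd_mats_def)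

lemmas F_inf_std = Fk_std[OF P_psd(1) Pibar_sym]

lemma hf_sym: "Q \<in> psd_mats \<Longrightarrow> adj (hf Q Qb) = hf Q Qb"
proof -
  assume Q: "Q \<in> psd_mats"
  have sQ: "transpose Q = Q" using Q by (simp add: psd_mats_def)
  have "transpose (H2 Q) = H2 Q"
    unfolding H2_def using Qchk
    by (simp add: transpose_distribs matrix_transpose_mul sQ inv_sym[OF Q] matrix_mul_assoc psd_mats_def)
  moreover have "smk g (H2 Q) = lmul (H2 Q) g1" by (simp add: g1_def lmul_smk)
  ultimately have "adj (kmult (adj g1) (smk g (H2 Q))) = kmult (adj g1) (smk g (H2 Q))"
    by (simp add: adj_comp adj_lmul kmult_rmul_lmul)
  then show ?thesis by (simp add: hf_def adj_linear add.commute)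
qed

lemma \<rho>f_sym: "Q \<in> psd_mats \<Longrightarrow> transpose (\<rho>f Q) = \<rho>f Q"
  by (simp add: \<rho>f_def matrix_transpose_mul inv_sym matrix_mul_assoc)

text \<open>\<open>F\<close> is self-adjoint up to the source term \<open>Qtil G\<close>, whose antisymmetric part is killed by the existence
  of an algebraic solution.\<close>

lemma Fk_antisym:
  assumes Q: "Q \<in> psd_mats" and Qb: "transpose Qb = Qb"
  shows "Fk Q Qb N - adj (Fk Q Qb N) = smk g (cQtil c) - adj (smk g (cQtil c))"
  unfolding Fk_std[OF assms] adj_linear hf_sym[OF Q] adj_lmul adj_rmul adj_comp \<rho>f_sym[OF Q] adj_adj transpose_transpose kmult_rmul_lmul
  by simp

text \<open>The antisymmetric part of \<open>Fk\<close> does not depend on its arguments. At the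
  algebraic solution \<open>Fk\<close> vanishes, so this part is 0; then \<open>n - adj n\<close>
  has derivative 0 and starts at 0.\<close>

lemma n_sym: "s \<ge> 0 \<Longrightarrow> adj (n s) = n s"
proof -
  assume s: "s \<ge> 0"
  have J: "smk g (cQtil c) - adj (smk g (cQtil c)) = 0"
    using Fk_antisym[OF P_psd(1) Pibar_sym, of L] by (simp add: F_inf linear_0[OF bounded_linear.linear[OF bounded_linear_adj]])
  have "n s - adj (n s) = 0"
  proof (rule linear_growth_zero[where T = s and f = "\<lambda>s. n s - adj (n s)" and C = 0 and f' = "\<lambda>u. F u (n u) - adj (F u (n u))"])
    fix u assume u: "u \<in> {0..s}"
    have d: "(n has_vector_derivative F u (n u)) (at u within {0..s})"
      by (rule has_vector_derivative_within_subset[OF n_der]) (use u in auto)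
    show "((\<lambda>s. n s - adj (n s)) has_vector_derivative F u (n u) - adj (F u (n u))) (at u within {0..s})"
      by (intro has_vector_derivative_diff d bounded_linear.has_vector_derivative[OF bounded_linear_adj])
    have "transpose (pb u) = pb u" using pb_psd[of u] u by (simp add: psd_mats_def)
    then have "F u (n u) - adj (F u (n u)) = 0"
      unfolding F_def using Fk_antisym[OF p_psd[of u], of "pb u" "n u"] u J by simp
    then show "norm (F u (n u) - adj (F u (n u))) \<le> 0 * norm (n u - adj (n u))" by simp
  qed (use s in \<open>simp_all add: n_zero linear_0[OF bounded_linear.linear[OF bounded_linear_adj]]\<close>)
  then show ?thesis by simp
qed

lemma L_sym: "adj L = L"
proof (rule tendsto_unique[OF _ _ n_lim])
  have "((\<lambda>s. adj (n s)) \<longlongrightarrow> adj L) at_top"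
    by (rule bounded_linear.tendsto[OF bounded_linear_adj n_lim])
  moreover have "\<forall>\<^sub>F s in at_top. adj (n s) = n s"
    using eventually_ge_at_top[of 0] by eventually_elim (rule n_sym)
  ultimately show "(n \<longlongrightarrow> adj L) at_top" by (rule Lim_transform_eventually)
qed simp

lemma n_bounded:
  obtains M where "\<And>s. s \<ge> 0 \<Longrightarrow> norm (n s) \<le> M"
proof -
  have "\<forall>\<^sub>F s in at_top. dist (n s) L < 1" by (rule tendstoD[OF n_lim]) simp
  then obtain s1 where s1: "\<And>s. s \<ge> s1 \<Longrightarrow> dist (n s) L < 1" unfolding eventually_at_top_linorder by blast
  obtain M where M: "\<And>s. s \<in> {0..s1} \<Longrightarrow> norm (n s) \<le> M"
  proof (rule continuous_bounded_Icc)
    fix s assume "s \<in> {0..s1}"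
    then show "(n has_vector_derivative F s (n s)) (at s within {0..s1})"
      by (intro has_vector_derivative_within_subset[OF n_der]) auto
  qed blast
  have "norm (n s) \<le> max M (norm L + 1)" if "s \<ge> 0" for s
  proof (cases "s \<ge> s1")
    case True
    then show ?thesis using s1[OF True] norm_triangle_sub[of "n s" L] by (simp add: dist_norm)
  next
    case False
    then show ?thesis using M[of s] that by simp
  qed
  then show thesis by (rule that)
qed

lemma L_nonneg: "0 \<le> X \<bullet> kmult L X"
  unfolding L_def by (rule kmult_nonneg[OF L2_Lam nn])

lemma Pibar_pd: "Pibar \<in> pd_mats"
  using are by (simp add: algebraic_Riccati_def)

text \<open>Replacing the coefficients along the flow by their limits leaves the defect
  \<open>R\<close>, exponentially small because the coefficients converge exponentially and
  \<open>n\<close>, being convergent, is bounded. The limit field is a quadratic polynomial with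
  linear part \<open>LE\<close> at \<open>L\<close>, so the rest of the error equation is exactly
  \<open>kmult (E s) (lmul (\<rho>f P) (E s))\<close>, and \<open>lyapunov_decay\<close>
  applies.\<close>

lemma expconv_n: "expconv n L"
proof (rule closed_loop_lyapunov[OF P_psd(1) Pibar_pd ric_P(2) L_nonneg F_inf L_sym])
  define \<alpha> where "\<alpha> = af P Pibar"
  define K where "K = kf P - lmul (\<rho>f P) L"
  fix W :: "(real^'d^'d) kernel \<Rightarrow> (real^'d^'d) kernel \<Rightarrow> real" and \<kappa> :: real
  assume W: "bounded_bilinear W" "\<And>x y. W x y = W y x" "\<kappa> > 0" "\<And>x. \<kappa> * (norm x)\<^sup>2 \<le> W x x"
    and W': "\<And>E. W E (lmul (transpose (af P Pibar)) E + kmult (adj (kf P - lmul (\<rho>f P) L)) E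
      + (rmul E (af P Pibar) + kmult E (kf P - lmul (\<rho>f P) L))) \<le> - \<kappa> * (norm E)\<^sup>2"
  define E where "E s = L - n s" for s
  define LE where "LE = (\<lambda>E. lmul (transpose \<alpha>) E + kmult (adj K) E + (rmul E \<alpha> + kmult E K))"
  have W5: "W E (LE E) \<le> - \<kappa> * (norm E)\<^sup>2" for E
    unfolding LE_def \<alpha>_def K_def by (rule W')
  obtain M where M: "\<And>s. s \<ge> 0 \<Longrightarrow> norm (n s) \<le> M" using n_bounded by blast
  define R where "R s = Fk P Pibar (n s) - F s (n s)" for s
  have R: "expconv R 0"
  proof -
    have e: "expconv (\<lambda>s. l - f s) 0" if "expconv f l" for f :: "real \<Rightarrow> 'z::real_normed_vector" and l
      using expconv_diff[OF expconv_const[of l] that] by simp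
    define S where "S s = (hf P Pibar - hf (p s) (pb s))
        + (lmul (transpose (af P Pibar - af (p s) (pb s))) (n s) + rmul (n s) (af P Pibar - af (p s) (pb s)))
        + (kmult (n s) (kf P - kf (p s)) + kmult (adj (kf P - kf (p s))) (n s))
        - kmult (n s) (lmul (\<rho>f P - \<rho>f (p s)) (n s))" for s
    \<comment> \<open>The source \<open>smk g (cQtil c)\<close> is the same in both fields and
      cancels.\<close>
    have RS: "R s = S s" if s: "s \<ge> 0" for s
      unfolding R_def S_def F_std[OF s] F_inf_std n_sym[OF s] kernel_diff adj_linear transpose_distribs by simp
    have bl: "bounded_bilinear (\<lambda>a b. h b a)" if "bounded_bilinear h"
      for h :: "(real^'d^'d) kernel \<Rightarrow> 'z::real_normed_vector \<Rightarrow> (real^'d^'d) kernel"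
      by (rule bounded_bilinear.flip[OF that])
    note ra = e[OF coeffs(1)] and rk = e[OF coeffs(2)] and rr = e[OF coeffs(3)] and rh = e[OF coeffs(4)]
    have ta: "expconv (\<lambda>s. transpose (af P Pibar - af (p s) (pb s))) 0"
      using expconv_transpose[OF ra] by (simp add: linear_0[OF bounded_linear.linear[OF bounded_linear_transpose]])
    have tk: "expconv (\<lambda>s. adj (kf P - kf (p s))) 0"
      using expconv_adj[OF rk] by (simp add: linear_0[OF bounded_linear.linear[OF bounded_linear_adj]])
    have "expconv (\<lambda>s. lmul (\<rho>f P - \<rho>f (p s)) (n s)) 0"
      by (rule expconv_zero_bounded[OF bounded_bilinear_lmul rr M])
    then have q: "expconv (\<lambda>s. kmult (n s) (lmul (\<rho>f P - \<rho>f (p s)) (n s))) 0"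
      by (rule expconv_zero_bounded[OF bounded_bilinear.flip[OF bounded_bilinear_comp] _ M])
    have "expconv S (0 + (0 + 0) + (0 + 0) - 0)"
      unfolding S_def
      by (intro expconv_add expconv_diff rh q
          expconv_zero_bounded[OF bounded_bilinear_lmul ta M]
          expconv_zero_bounded[OF bounded_bilinear.flip[OF bounded_bilinear_rmul] ra M]
          expconv_zero_bounded[OF bounded_bilinear.flip[OF bounded_bilinear_comp] rk M]
          expconv_zero_bounded[OF bounded_bilinear_comp tk M])
    then show ?thesis using RS unfolding expconv_def by simp
  qed
  obtain K0 \<gamma> where K0: "K0 > 0" "\<gamma> > 0" "\<And>s. s \<ge> 0 \<Longrightarrow> norm (R s - 0) \<le> K0 * exp (- \<gamma> * s)"
    using expconvE[OF R] by blast
  have "expconv E 0"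
  proof (rule lyapunov_decay[OF W W5])
    show "(E has_vector_derivative - F s (n s)) (at s within {0..})" if "s \<ge> 0" for s
      unfolding E_def using has_vector_derivative_diff[OF has_vector_derivative_const n_der[OF that]] by simp
    show "norm (- F s (n s) - LE (E s)) \<le> norm (\<rho>f P) * (norm (E s))\<^sup>2 + K0 * exp (- \<gamma> * s)" if s: "s \<ge> 0" for s
    proof -
      have adjK: "adj K = adj (kf P) - rmul L (\<rho>f P)"
        unfolding K_def adj_linear adj_lmul \<rho>f_sym[OF P_psd(1)] L_sym ..
      have e1: "- F s (n s) - LE (E s) = R s + (Fk P Pibar L - Fk P Pibar (n s) - LE (E s))"
        by (simp add: R_def F_inf)
      have e2: "Fk P Pibar L - Fk P Pibar (n s) - LE (E s) = kmult (E s) (lmul (\<rho>f P) (E s))"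
        unfolding F_inf_std LE_def adjK unfolding K_def \<alpha>_def E_def L_sym n_sym[OF s] kernel_diff kmult_rmul_lmul
        by simp
      have "norm (- F s (n s) - LE (E s)) \<le> norm (R s) + norm (kmult (E s) (lmul (\<rho>f P) (E s)))"
        unfolding e1 e2 by (rule norm_triangle_ineq)
      moreover have "norm (kmult (E s) (lmul (\<rho>f P) (E s))) \<le> norm (\<rho>f P) * (norm (E s))\<^sup>2"
      proof -
        have "norm (kmult (E s) (lmul (\<rho>f P) (E s))) \<le> norm (E s) * (norm (\<rho>f P) * norm (E s))"
          by (rule order_trans[OF norm_comp mult_left_mono[OF norm_lmul]]) simp
        then show ?thesis by (simp add: power2_eq_square algebra_simps)
      qed
      ultimately show ?thesis using K0(3)[OF s] by simp
    qed
    show "\<gamma> > 0" by (rule K0)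
    show "(E \<longlongrightarrow> 0) at_top"
      unfolding E_def using tendsto_diff[OF tendsto_const[of L] n_lim] by simp
  qed
  from expconv_diff[OF expconv_const[of L] this] show ?thesis by (simp add: E_def)
qed

section \<open>Exponential estimates for \<open>\<Lambda>\<close> and for the feedback
  kernel\<close>

lemma Lambda_turnpike:
  "\<exists>K \<gamma>. K > 0 \<and> \<gamma> > 0 \<and> (\<forall>T>0. \<forall>t\<in>{0..T}. L2_norm unitI2 (\<lambda>z. \<Lambda> z - LamT T t z) \<le> K * exp (- \<gamma> * (T - t)))"
proof -
  obtain K \<gamma> where K: "K > 0" "\<gamma> > 0" "\<And>s. s \<ge> 0 \<Longrightarrow> norm (n s - L) \<le> K * exp (- \<gamma> * s)"
    using expconvE[OF expconv_n] by blast
  have "L2_norm unitI2 (\<lambda>z. \<Lambda> z - LamT T t z) \<le> K * exp (- \<gamma> * (T - t))" if T: "T > 0" and t: "t \<in> {0..T}" for T t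
  proof -
    have s: "T - t \<in> {0..T}" using t by auto
    have "LamT T t \<in> L2 unitI2" using nT_der(1)[OF T s] by simp
    then have r: "rep (abs_kernel \<Lambda> - abs_kernel (LamT T t)) (\<lambda>z. \<Lambda> z - LamT T t z)"
      by (intro rep_diff rep_abs L2_Lam)
    have e: "n (T - t) = abs_kernel (LamT T t)" using nT_n[OF T s] by (simp add: nT_def)
    have r: "rep (L - n (T - t)) (\<lambda>z. \<Lambda> z - LamT T t z)"
      unfolding e L_def by (rule r)
    then have "L2_norm unitI2 (\<lambda>z. \<Lambda> z - LamT T t z) = norm (L - n (T - t))"
      by (rule rep_norm[symmetric])
    then show ?thesis using K(3)[of "T - t"] t by (simp add: norm_minus_commute)
  qed
  then show ?thesis using K(1,2) by blast
qed

lemma rep_Theta: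
  assumes "f \<in> L2 unitI2"
  shows "rep (- lmul (Rinv Q) (Ups Q (abs_kernel f))) (Theta_til c Q f)"
  by (rule rep_cong[OF rep_minus[OF rep_lmul[OF rep_Ups[OF assms]]]]) (simp add: fun_eq_iff Theta_til_def)

text \<open>The feedback kernel is bilinear in \<open>Rinv\<close> and \<open>Ups\<close>, both of
  which converge exponentially along the flow. Its constants need not be those of the estimate for
  \<open>\<Lambda>\<close>.\<close>

lemma Theta_turnpike:
  "\<exists>K \<gamma>. K > 0 \<and> \<gamma> > 0 \<and> (\<forall>T>0. \<forall>t\<in>{0..T}.
     L2_norm unitI2 (\<lambda>z. Theta_til c P \<Lambda> z - Theta_til c (PT T t) (LamT T t) z) \<le> K * exp (- \<gamma> * (T - t)))"
proof -
  define \<theta> where "\<theta> Q N = - lmul (Rinv Q) (Ups Q N)" for Q N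
  have "expconv (\<lambda>s. \<theta> (p s) (n s)) (\<theta> P L)"
    unfolding \<theta>_def Ups_def G1_def[symmetric]
    by (intro expconv_minus expconv_bilinear[OF bounded_bilinear_lmul] expconv_add expconv_smk expconv_const
        expconv_inv p_psd P_psd expconv_p expconv_n coeffs(5))
  then obtain K \<gamma> where K: "K > 0" "\<gamma> > 0" "\<And>s. s \<ge> 0 \<Longrightarrow> norm (\<theta> (p s) (n s) - \<theta> P L) \<le> K * exp (- \<gamma> * s)"
    using expconvE by blast
  have "L2_norm unitI2 (\<lambda>z. Theta_til c P \<Lambda> z - Theta_til c (PT T t) (LamT T t) z) \<le> K * exp (- \<gamma> * (T - t))"
    if T: "T > 0" and t: "t \<in> {0..T}" for T t
  proof -
    have s: "T - t \<in> {0..T}" using t by auto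
    have PTp: "PT T t = p (T - t)" using PT_p[OF T s] by simp
    have nn: "n (T - t) = abs_kernel (LamT T t)" using nT_n[OF T s] by (simp add: nT_def)
    have LL: "LamT T t \<in> L2 unitI2" using nT_der(1)[OF T s] by simp
    have "rep (\<theta> P L - \<theta> (p (T - t)) (n (T - t))) (\<lambda>z. Theta_til c P \<Lambda> z - Theta_til c (PT T t) (LamT T t) z)"
      unfolding \<theta>_def L_def nn PTp by (intro rep_diff rep_Theta L2_Lam LL)
    then have "L2_norm unitI2 (\<lambda>z. Theta_til c P \<Lambda> z - Theta_til c (PT T t) (LamT T t) z)
        = norm (\<theta> P L - \<theta> (p (T - t)) (n (T - t)))"
      by (rule rep_norm[symmetric])
    then show ?thesis using K(3)[of "T - t"] t by (simp add: norm_minus_commute)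
  qed
  then show ?thesis using K(1,2) by blast
qed

end

text \<open>Completing the square in \<open>\<theta>\<close>: the joint form is that of the Schur
  complement at \<open>x\<close> plus that of \<open>R\<close> at \<open>\<theta> + \<phi>\<close>.
  The second is nonnegative and the first is coercive by assumption.\<close>

lemma positivity_cost:
  fixes Q :: "real^'d^'d" and S :: "real^'d^'m" and R :: "real^'m^'m"
  assumes R: "R \<in> pd_mats" and Q: "Q - transpose S ** matrix_inv R ** S \<in> pd_mats"
  obtains \<delta> where "\<delta> > 0" "\<And>x \<theta>. \<delta> * (norm x)\<^sup>2 \<le> x \<bullet> (Q *v x) + 2 * (\<theta> \<bullet> (S *v x)) + \<theta> \<bullet> (R *v \<theta>)"
proof -
  obtain \<delta> where \<delta>: "\<delta> > 0" "\<And>x. \<delta> * (norm x)\<^sup>2 \<le> x \<bullet> ((Q - transpose S ** matrix_inv R ** S) *v x)"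
    using pd_coercive[OF Q] by blast
  obtain r where r: "r > 0" "\<And>x. r * (norm x)\<^sup>2 \<le> x \<bullet> (R *v x)" using pd_coercive[OF R] by blast
  have sR: "transpose R = R" using R by (simp add: pd_mats_def)
  have "\<delta> * (norm x)\<^sup>2 \<le> x \<bullet> (Q *v x) + 2 * (\<theta> \<bullet> (S *v x)) + \<theta> \<bullet> (R *v \<theta>)" for x \<theta>
  proof -
    define m where "m = S *v x"
    define \<phi> where "\<phi> = matrix_inv R *v m"
    have R\<phi>: "R *v \<phi> = m" by (simp add: \<phi>_def matrix_vector_mul_assoc coercive_inverse(1)[OF r])
    have "0 \<le> (\<theta> + \<phi>) \<bullet> (R *v (\<theta> + \<phi>))"
      by (rule order_trans[OF _ r(2)]) (use r in simp)
    also have "\<dots> = \<theta> \<bullet> (R *v \<theta>) + 2 * (\<theta> \<bullet> m) + m \<bullet> \<phi>"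
      using symmetric_inner(2)[OF sR, of \<phi> \<theta>] R\<phi>
      by (simp add: matrix_vector_distribs inner_add_left inner_add_right inner_commute)
    finally have 1: "0 \<le> \<theta> \<bullet> (R *v \<theta>) + 2 * (\<theta> \<bullet> m) + m \<bullet> \<phi>" .
    have "x \<bullet> ((Q - transpose S ** matrix_inv R ** S) *v x) = x \<bullet> (Q *v x) - m \<bullet> \<phi>"
      by (simp add: matrix_vector_distribs inner_diff_right inner_matrix_transpose
          matrix_vector_mul_assoc[symmetric] m_def \<phi>_def del: transpose_matrix_vector)
    then show ?thesis using 1 \<delta>(2)[of x] by (simp add: m_def)
  qed
  then show thesis using that \<delta>(1) by blast
qed

theorem proposition4p2:
  fixes c :: "('d::finite, 'm::finite) lq_coeffs"
    and M :: "'w measure"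
    and W :: "real \<Rightarrow> real \<Rightarrow> 'w \<Rightarrow> real"
    and \<zeta> :: "real \<Rightarrow> 'w \<Rightarrow> real"
    and P Pibar :: "real^'d^'d"
    and PT PibarT :: "real \<Rightarrow> real \<Rightarrow> real^'d^'d"
    and LamT :: "real \<Rightarrow> real \<Rightarrow> real \<times> real \<Rightarrow> real^'d^'d"
    and \<Lambda> :: "real \<times> real \<Rightarrow> real^'d^'d"
    and p :: "real \<Rightarrow> real^'d"
  assumes "noise_setup M W \<zeta>"
    and "admissible_coeffs c"
    and "positivity_condition c"
    and "stabilizability_condition c M W \<zeta>"
    and "\<And>T. T > 0 \<Longrightarrow> finite_horizon_P c T (PT T)"
    and "\<And>T. T > 0 \<Longrightarrow> finite_horizon_Pibar c T (PT T) (PibarT T)"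
    and "\<And>T. T > 0 \<Longrightarrow> finite_horizon_Lambda c T (PT T) (PibarT T) (LamT T)"
    and "algebraic_Riccati c P Pibar"
    and "algebraic_solvability_condition c P (Pibar - P) LamT \<Lambda> p"
  shows "(\<exists>K \<gamma>. K > 0 \<and> \<gamma> > 0 \<and>
            (\<forall>T>0. \<forall>t\<in>{0..T}.
               L2_norm unitI2 (\<lambda>z. \<Lambda> z - LamT T t z) \<le> K * exp (- \<gamma> * (T - t)))) \<and>
         (\<exists>K \<gamma>. K > 0 \<and> \<gamma> > 0 \<and>
            (\<forall>T>0. \<forall>t\<in>{0..T}.
               L2_norm unitI2 (\<lambda>z. Theta_til c P \<Lambda> z - Theta_til c (PT T t) (LamT T t) z)
                 \<le> K * exp (- \<gamma> * (T - t))))"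
proof -
  have adm: "cR c \<in> pd_mats" "cQchk c \<in> psd_mats" "cG c \<in> L2 unitI2"
    using assms(2) by (simp_all add: admissible_coeffs_def)
  have pos: "cQ c - transpose (cS c) ** matrix_inv (cR c) ** cS c \<in> pd_mats"
    "cQ c + cQbar c - transpose (cS c) ** matrix_inv (cR c) ** cS c \<in> pd_mats"
    "nonneg_kernel (\<lambda>z. cG c z *\<^sub>R cQtil c)"
    using assms(3) by (simp_all add: positivity_condition_def)
  obtain \<delta>1 where \<delta>1: "\<delta>1 > 0"
    "\<And>x \<theta>. \<delta>1 * (norm x)\<^sup>2 \<le> x \<bullet> (cQ c *v x) + 2 * (\<theta> \<bullet> (cS c *v x)) + \<theta> \<bullet> (cR c *v \<theta>)"
    using positivity_cost[OF adm(1) pos(1)] by blast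
  obtain \<delta>2 where \<delta>2: "\<delta>2 > 0"
    "\<And>x \<theta>. \<delta>2 * (norm x)\<^sup>2 \<le> x \<bullet> ((cQ c + cQbar c) *v x) + 2 * (\<theta> \<bullet> (cS c *v x)) + \<theta> \<bullet> (cR c *v \<theta>)"
    using positivity_cost[OF adm(1) pos(2)] by blast
  obtain r where r: "r > 0" "\<And>x. r * (norm x)\<^sup>2 \<le> x \<bullet> (cR c *v x)" using pd_coercive[OF adm(1)] by blast
  \<comment> \<open>One coercivity constant serves both Riccati equations.\<close>
  define \<delta> where "\<delta> = min \<delta>1 \<delta>2"
  have \<delta>: "\<delta> * (norm x)\<^sup>2 \<le> \<delta>1 * (norm x)\<^sup>2" "\<delta> * (norm x)\<^sup>2 \<le> \<delta>2 * (norm x)\<^sup>2" for x :: "real^'d"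
    by (intro mult_right_mono; simp add: \<delta>_def)+
  have alg: "algebraic_Lambda c P (Pibar - P) \<Lambda>" "nonneg_kernel \<Lambda>"
    "((\<lambda>T. L2_norm unitI2 (\<lambda>z. LamT T 0 z - \<Lambda> z)) \<longlongrightarrow> 0) at_top"
    using assms(9) by (simp_all add: algebraic_solvability_condition_def algebraic_solution_def)
  interpret lq_flow c \<delta> r P Pibar PT PibarT LamT \<Lambda>
  proof
    show "\<delta> > 0" using \<delta>1 \<delta>2 by (simp add: \<delta>_def)
    show "\<delta> * (norm x)\<^sup>2 \<le> x \<bullet> (cQ c *v x) + 2 * (\<theta> \<bullet> (cS c *v x)) + \<theta> \<bullet> (cR c *v \<theta>)" for x \<theta>
      by (rule order_trans[OF \<delta>(1) \<delta>1(2)])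
    show "\<delta> * (norm x)\<^sup>2 \<le> x \<bullet> ((cQ c + cQbar c) *v x) + 2 * (\<theta> \<bullet> (cS c *v x)) + \<theta> \<bullet> (cR c *v \<theta>)" for x \<theta>
      by (rule order_trans[OF \<delta>(2) \<delta>2(2)])
    show "transpose (cR c) = cR c" using adm(1) by (simp add: pd_mats_def)
  qed (fact r adm pos assms alg)+
  show ?thesis using Lambda_turnpike Theta_turnpike by blast
qed

end
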